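(* Let $p\ge1$, $d\geq 1$, $T>0$, and let $X:[0,T]\to G_d^{[p]}$ be a branched $p$-rough path; put $\omega(s,t):=\|X\|^p_{p-var,[s,t]}$. Suppose $\beta_i$, $i=1,2$, are two slowly-varying one-forms along $X$ taking values in $\mathbb{R}$. Assume that for some $\theta\in\left(1,\frac{[p]+1}{p}\right]$, $\|\beta_i\|_\theta<\infty$, $i=1,2$. Further assume that $\beta_2=\sum_{\tau\in T_d^{[p]}}\beta_2^\tau$ only contains tree components. For $t\in[0,T]$ and $a\in G_d^{[p]}$, define $$\beta(X_t)(a):=\int_0^t\beta_1(X_r)dX_r\ \beta_2(X_t)(a)+\left(\beta_1(X_t)\succ\beta_2(X_t)\right)(a).$$ Then $\beta$ is a slowly-varying one-form along $X$ taking values in $\mathbb{R}$, and there exists a constant $C$ only depending on $p,d,\theta,\omega(0,T)$ such that $$\|\beta\|_\theta\le C\,\|\beta_1\|_\theta\|\beta_2\|_\theta.$$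
   Context: **Trees and forests.** Trees are finite rooted non-planar trees with vertices labelled by $\{1,\dots,d\}$; a forest is a commutative monomial of trees, including the empty forest $\epsilon$; $|\rho|$ is the number of vertices ($|\epsilon|=0$). $T_d$ ($F_d$) is the set of labelled trees (forests), $T_d^n$ ($F_d^n$) the subset of elements of degree $1,\dots,n$. $[\rho]_j$ is the tree obtained by grafting the roots of all trees of $\rho$ to a new root labelled $j$. **The group $G_d^n$.** $\bigtriangleup$ is the labelled Connes–Kreimer coproduct (admissible cuts), multiplicative on forests, with $\bigtriangleup[\rho]_j=[\rho]_j\otimes1+\sum_{\bigtriangleup\rho}\rho_{(1)}\otimes[\rho_{(2)}]_j$, where $\bigtriangleup\rho=\sum_{\bigtriangleup\rho}\rho_{(1)}\otimes\rho_{(2)}$. $G_d^n$ is the step-$n$ truncated group of characters: maps $a:F_d\to\mathbb{R}$ with $(a,\epsilon)=1$, $(a,\rho_1\rho_2)=(a,\rho_1)(a,\rho_2)$ if $|\rho_1|+|\rho_2|\le n$, $(a,\rho)=0$ if $|\rho|>n$; product $(ab,\rho)=\sum_{\bigtriangleup\rho}(a,\rho_{(1)})(b,\rho_{(2)})$ for $|\rho|\le n$; norm $\|a\|:=\max_{1\le|\rho|\le n}|(a,\rho)|^{1/|\rho|}$. **Rough paths.** $[p]$ is the largest integer $\le p$. $X_{s,t}:=X_s^{-1}X_t$; $\|X\|_{p-var,[s,t]}:=\sup_D(\sum_k\|X_{t_k,t_{k+1}}\|^p)^{1/p}$ over finite partitions $D=\{t_k\}$ of $[s,t]$. $X:[0,T]\to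 G_d^{[p]}$ is a branched $p$-rough path if it is continuous and $\|X\|_{p-var,[0,T]}<\infty$. **Slowly-varying one-forms.** For $a\in G_d^{[p]}$ let $E_a^{\mathbb{R}}$ be the vector space of functions $\phi:G_d^{[p]}\to\mathbb{R}$ of the form $\phi(c)=\sum_{\rho\in F_d^{[p]}}\phi^\rho(c,\rho)$ with $\phi^\rho\in\mathbb{R}$ (abbreviated $\phi=\sum_\rho\phi^\rho$); $\|\phi\|_\rho:=|\phi^\rho|$ and $\|\phi\|:=\max_{\rho\in F_d^{[p]}}\|\phi\|_\rho$. For $\phi\in E_a^{\mathbb{R}}$ and $b\in G_d^{[p]}$, the parallel translate $\phi_b\in E_{ab}^{\mathbb{R}}$ is $\phi_b(c):=\phi(bc)-\phi(b)$. A map $\beta:X_t\mapsto\beta(X_t)\in E_{X_t}^{\mathbb{R}}$, $t\in[0,T]$, is a slowly-varying one-form along $X$ taking values in $\mathbb{R}$ if there is $\theta>1$ with $$\|\beta\|_\theta:=\sup_{t\in[0,T]}\|\beta(X_t)\|+\max_{\rho\in F_d^{[p]}}\sup_{0\le s<t\le T}\frac{\|\beta(X_t)-\beta(X_s)_{X_{s,t}}\|_\rho}{\omega(s,t)^{\theta-\frac{|\rho|}{p}}}<\infty.$$ Its integral is $\int_0^t\beta(X_r)dX_r:=\lim_{|D|\to0}\sum_k\beta(X_{t_k})(X_{t_k,t_{k+1}})$ over finite partitions $D=\{t_k\}$ of $[0,t]$ as the mesh tends to zero (the limit exists for slowly-varying $\beta$). "$\beta_2$ only contains tree components" means that all coefficients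 $\beta_2^\rho(X_t)$ with $\rho$ not a tree vanish. **The operation $\succ$.** For a forest $\rho$ and a tree $\tau$ with $|\tau|\ge1$, $\rho\succ\tau$ is the tree of degree $|\rho|+|\tau|$ obtained by grafting the roots of all trees in $\rho$ to the root of $\tau$ ($\epsilon\succ\tau:=\tau$). For $\phi_1=\sum_{\rho\in F_d^{[p]}}\phi_1^\rho$ and $\phi_2=\sum_{\tau\in T_d^{[p]}}\phi_2^\tau$, $(\phi_1\succ\phi_2)(a):=\sum_{\rho\in F_d^{[p]},\tau\in T_d^{[p]},|\rho|+|\tau|\le[p]}\phi_1^\rho\phi_2^\tau(a,\rho\succ\tau)$ for $a\in G_d^{[p]}$. *)

theory Defs
  imports
    "HOL-Analysis.Analysis"
    "HOL-Algebra.Group"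
    "HOL-Library.Multiset"
    "HOL-Library.Poly_Mapping"
    "HOL-Library.Product_Plus"
begin

section \<open>Labelled trees and forests\<close>

datatype (labels: 'l) ltree = Node 'l "'l ltree multiset"

text \<open>A forest is a commutative monomial of trees: the product of forests is \<open>+\<close> on multisets and
  the empty forest is \<open>{#}\<close>. The tree \<open>[\<rho>]\<^sub>j\<close> is \<open>Node j \<rho>\<close>.\<close>

type_synonym forest = "nat ltree multiset"

primrec tdeg :: "'l ltree \<Rightarrow> nat" where
  "tdeg (Node j \<rho>) = Suc (sum_mset (image_mset tdeg \<rho>))"

definition fdeg :: "'l ltree multiset \<Rightarrow> nat" where
  "fdeg \<rho> = (\<Sum>\<tau>\<in>#\<rho>. tdeg \<tau>)"

definition trees :: "nat \<Rightarrow> nat ltree set" where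
  "trees d = {\<tau>. labels \<tau> \<subseteq> {1..d}}"

definition forests :: "nat \<Rightarrow> forest set" where
  "forests d = {\<rho>. set_mset \<rho> \<subseteq> trees d}"

definition trees_upto :: "nat \<Rightarrow> nat \<Rightarrow> nat ltree set" where
  "trees_upto d n = {\<tau> \<in> trees d. 1 \<le> tdeg \<tau> \<and> tdeg \<tau> \<le> n}"

definition forests_upto :: "nat \<Rightarrow> nat \<Rightarrow> forest set" where
  "forests_upto d n = {\<rho> \<in> forests d. 1 \<le> fdeg \<rho> \<and> fdeg \<rho> \<le> n}"

primrec graft :: "'l ltree multiset \<Rightarrow> 'l ltree \<Rightarrow> 'l ltree" where
  "graft \<rho> (Node j \<sigma>) = Node j (\<rho> + \<sigma>)"


section \<open>The Connes--Kreimer coproduct\<close>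

text \<open>The tensor square of the free commutative algebra on trees has the pairs
  \<open>(\<rho>\<^sub>1, \<rho>\<^sub>2)\<close>, standing for \<open>\<rho>\<^sub>1 \<otimes> \<rho>\<^sub>2\<close>, as a basis, and these multiply
  componentwise. It is therefore the monoid algebra of \<open>forest \<times> forest\<close>, whose product is the
  convolution product of finitely supported functions.\<close>

type_synonym tensor = "(forest \<times> forest) \<Rightarrow>\<^sub>0 real"

text \<open>The linear map \<open>\<rho>\<^sub>1 \<otimes> \<rho>\<^sub>2 \<mapsto> \<rho>\<^sub>1 \<otimes> [\<rho>\<^sub>2]\<^sub>j\<close>.\<close>

definition graft_right :: "nat \<Rightarrow> tensor \<Rightarrow> tensor" where
  "graft_right j x = (\<Sum>k\<in>Poly_Mapping.keys x.
     Poly_Mapping.single (fst k, {#Node j (snd k)#}) (Poly_Mapping.lookup x k))"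

primrec tree_coproduct :: "nat ltree \<Rightarrow> tensor" where
  "tree_coproduct (Node j \<rho>) =
     Poly_Mapping.single ({#Node j \<rho>#}, {#}) 1
     + graft_right j (prod_mset (image_mset tree_coproduct \<rho>))"

definition coproduct :: "forest \<Rightarrow> tensor" where
  "coproduct \<rho> = (\<Prod>\<tau>\<in>#\<rho>. tree_coproduct \<tau>)"


section \<open>The truncated group of characters\<close>

text \<open>The pairing \<open>(a, \<rho>)\<close> is \<open>a \<rho>\<close>. Characters are maps on the forests labelled by \<open>{1..d}\<close>; they
  are extended by zero to all forests so that equality of characters is equality of functions.\<close>

definition char_group :: "nat \<Rightarrow> nat \<Rightarrow> (forest \<Rightarrow> real) monoid" where
  "char_group d n = \<lparr>
     carrier = {a. a {#} = 1
       \<and> (\<forall>\<rho>\<^sub>1\<in>forests d. \<forall>\<rho>\<^sub>2\<in>forests d. fdeg \<rho>\<^sub>1 + fdeg \<rho>\<^sub>2 \<le> n \<longrightarrow> a (\<rho>\<^sub>1 + \<rho>\<^sub>2) = a \<rho>\<^sub>1 * a \<rho>\<^sub>2)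
       \<and> (\<forall>\<rho>. \<rho> \<notin> forests d \<or> fdeg \<rho> > n \<longrightarrow> a \<rho> = 0)},
     monoid.mult = (\<lambda>a b \<rho>. if \<rho> \<in> forests d \<and> fdeg \<rho> \<le> n
       then \<Sum>k\<in>Poly_Mapping.keys (coproduct \<rho>).
              Poly_Mapping.lookup (coproduct \<rho>) k * a (fst k) * b (snd k)
       else 0),
     one = (\<lambda>\<rho>. if \<rho> = {#} then 1 else 0)\<rparr>"

definition char_norm :: "nat \<Rightarrow> nat \<Rightarrow> (forest \<Rightarrow> real) \<Rightarrow> real" where
  "char_norm d n a = (MAX \<rho>\<in>forests_upto d n. \<bar>a \<rho>\<bar> powr (1 / real (fdeg \<rho>)))"


section \<open>Branched rough paths\<close>

abbreviation step :: "real \<Rightarrow> nat" where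
  "step p \<equiv> nat \<lfloor>p\<rfloor>"

definition increment :: "real \<Rightarrow> nat \<Rightarrow> (real \<Rightarrow> forest \<Rightarrow> real) \<Rightarrow> real \<Rightarrow> real \<Rightarrow> forest \<Rightarrow> real" where
  "increment p d X s t =
     inv\<^bsub>char_group d (step p)\<^esub> (X s) \<otimes>\<^bsub>char_group d (step p)\<^esub> X t"

definition is_partition :: "real \<Rightarrow> real \<Rightarrow> real list \<Rightarrow> bool" where
  "is_partition s t D \<longleftrightarrow> D \<noteq> [] \<and> sorted_wrt (<) D \<and> hd D = s \<and> last D = t"

definition partition_sum :: "(real \<Rightarrow> real \<Rightarrow> real) \<Rightarrow> real list \<Rightarrow> real" where
  "partition_sum f D = (\<Sum>k<length D - 1. f (D ! k) (D ! Suc k))"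

definition pvar :: "real \<Rightarrow> nat \<Rightarrow> (real \<Rightarrow> forest \<Rightarrow> real) \<Rightarrow> real \<Rightarrow> real \<Rightarrow> ennreal" where
  "pvar p d X s t = (SUP D\<in>{D. is_partition s t D}.
     ennreal (partition_sum (\<lambda>u v. char_norm d (step p) (increment p d X u v) powr p) D powr (1 / p)))"

text \<open>\<open>continuous_on\<close> refers to the product topology on \<open>forest \<Rightarrow> real\<close>, which on the group is the
  topology of its finitely many non-trivial coordinates.\<close>

definition branched_rough_path :: "real \<Rightarrow> nat \<Rightarrow> real \<Rightarrow> (real \<Rightarrow> forest \<Rightarrow> real) \<Rightarrow> bool" where
  "branched_rough_path p d T X \<longleftrightarrow>
     X \<in> {0..T} \<rightarrow> carrier (char_group d (step p)) \<and> continuous_on {0..T} X \<and> pvar p d X 0 T < \<infinity>"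

text \<open>Only used for paths of finite \<open>p\<close>-variation, where \<open>enn2real\<close> loses nothing.\<close>

definition control :: "real \<Rightarrow> nat \<Rightarrow> (real \<Rightarrow> forest \<Rightarrow> real) \<Rightarrow> real \<Rightarrow> real \<Rightarrow> real" where
  "control p d X s t = enn2real (pvar p d X s t) powr p"


section \<open>Slowly-varying one-forms\<close>

type_synonym form = "(forest \<Rightarrow> real) \<Rightarrow> real"

definition represents :: "nat \<Rightarrow> nat \<Rightarrow> (forest \<Rightarrow> real) \<Rightarrow> form \<Rightarrow> bool" where
  "represents d n f \<phi> \<longleftrightarrow>
     (\<forall>c\<in>carrier (char_group d n). \<phi> c = (\<Sum>\<rho>\<in>forests_upto d n. f \<rho> * c \<rho>))"

text \<open>The spaces attached to the different points of the group coincide as sets of functions, so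
  the base point is not an argument.\<close>

definition forms :: "nat \<Rightarrow> nat \<Rightarrow> form set" where
  "forms d n = {\<phi>. \<exists>f. represents d n f \<phi>}"

text \<open>Coefficients are unique: the coordinates of the group at trees are
  free, and a forest is evaluated to the corresponding monomial in them.\<close>

definition coeffs :: "nat \<Rightarrow> nat \<Rightarrow> form \<Rightarrow> forest \<Rightarrow> real" where
  "coeffs d n \<phi> = (THE f. represents d n f \<phi> \<and> (\<forall>\<rho>. \<rho> \<notin> forests_upto d n \<longrightarrow> f \<rho> = 0))"

definition form_norm :: "nat \<Rightarrow> nat \<Rightarrow> form \<Rightarrow> real" where
  "form_norm d n \<phi> = (MAX \<rho>\<in>forests_upto d n. \<bar>coeffs d n \<phi> \<rho>\<bar>)"

definition translate :: "nat \<Rightarrow> nat \<Rightarrow> form \<Rightarrow> (forest \<Rightarrow> real) \<Rightarrow> form" where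
  "translate d n \<phi> b = (\<lambda>c. \<phi> (b \<otimes>\<^bsub>char_group d n\<^esub> c) - \<phi> b)"

text \<open>A one-form along \<open>X\<close> is a family indexed by time, \<open>\<beta> t\<close> standing for \<open>\<beta>(X\<^sub>t)\<close>.
  In \<open>ennreal\<close> one has \<open>0 / 0 = 0\<close> and \<open>x / 0 = \<infinity>\<close> for \<open>x \<noteq> 0\<close>, so that
  on an interval where the control vanishes the numerator has to vanish as well.\<close>

definition one_form_norm ::
    "real \<Rightarrow> nat \<Rightarrow> real \<Rightarrow> (real \<Rightarrow> forest \<Rightarrow> real) \<Rightarrow> real \<Rightarrow> (real \<Rightarrow> form) \<Rightarrow> ennreal" where
  "one_form_norm p d T X \<theta> \<beta> =
     (SUP t\<in>{0..T}. ennreal (form_norm d (step p) (\<beta> t)))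
     + (MAX \<rho>\<in>forests_upto d (step p). SUP (s, t)\<in>{(s, t). 0 \<le> s \<and> s < t \<and> t \<le> T}.
          ennreal \<bar>coeffs d (step p)
            (\<lambda>c. \<beta> t c - translate d (step p) (\<beta> s) (increment p d X s t) c) \<rho>\<bar>
          / ennreal (control p d X s t powr (\<theta> - real (fdeg \<rho>) / p)))"

definition slowly_varying ::
    "real \<Rightarrow> nat \<Rightarrow> real \<Rightarrow> (real \<Rightarrow> forest \<Rightarrow> real) \<Rightarrow> (real \<Rightarrow> form) \<Rightarrow> bool" where
  "slowly_varying p d T X \<beta> \<longleftrightarrow>
     \<beta> \<in> {0..T} \<rightarrow> forms d (step p) \<and> (\<exists>\<theta>>1. one_form_norm p d T X \<theta> \<beta> < \<infinity>)"

definition mesh_to_0 :: "real \<Rightarrow> real \<Rightarrow> real list filter" where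
  "mesh_to_0 s t = (INF \<delta>\<in>{0<..}.
     principal {D. is_partition s t D \<and> (\<forall>k. Suc k < length D \<longrightarrow> D ! Suc k - D ! k < \<delta>)})"

definition form_integral ::
    "real \<Rightarrow> nat \<Rightarrow> (real \<Rightarrow> forest \<Rightarrow> real) \<Rightarrow> (real \<Rightarrow> form) \<Rightarrow> real \<Rightarrow> real" where
  "form_integral p d X \<beta> t =
     Lim (mesh_to_0 0 t) (partition_sum (\<lambda>u v. \<beta> u (increment p d X u v)))"

definition only_trees :: "nat \<Rightarrow> nat \<Rightarrow> form \<Rightarrow> bool" where
  "only_trees d n \<phi> \<longleftrightarrow>
     (\<forall>\<rho>\<in>forests_upto d n. (\<nexists>\<tau>. \<rho> = {#\<tau>#}) \<longrightarrow> coeffs d n \<phi> \<rho> = 0)"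

definition form_succ :: "nat \<Rightarrow> nat \<Rightarrow> form \<Rightarrow> form \<Rightarrow> form" where
  "form_succ d n \<phi>\<^sub>1 \<phi>\<^sub>2 = (\<lambda>a.
     \<Sum>(\<rho>, \<tau>)\<in>{(\<rho>, \<tau>). \<rho> \<in> forests_upto d n \<and> \<tau> \<in> trees_upto d n \<and> fdeg \<rho> + tdeg \<tau> \<le> n}.
       coeffs d n \<phi>\<^sub>1 \<rho> * coeffs d n \<phi>\<^sub>2 {#\<tau>#} * a {#graft \<rho> \<tau>#})"

definition product_form ::
    "real \<Rightarrow> nat \<Rightarrow> (real \<Rightarrow> forest \<Rightarrow> real) \<Rightarrow> (real \<Rightarrow> form) \<Rightarrow> (real \<Rightarrow> form) \<Rightarrow> real \<Rightarrow> form" where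
  "product_form p d X \<beta>\<^sub>1 \<beta>\<^sub>2 t = (\<lambda>a.
     form_integral p d X \<beta>\<^sub>1 t * \<beta>\<^sub>2 t a + form_succ d (step p) (\<beta>\<^sub>1 t) (\<beta>\<^sub>2 t) a)"

end

theory Submission
  imports Defs
begin

text \<open>
  Write \<open>\<phi>\<^sub>b\<close> for the translate of \<open>\<phi>\<close> by \<open>b = X\<^sub>s\<^sub>,\<^sub>t\<close> and \<open>I\<close> for the integral of \<open>\<beta>\<^sub>1\<close>. Since the root
  of a tree is cut only by the total cut, \<open>\<bigtriangleup>(\<rho> \<succ> \<tau>)\<close> is the product of \<open>\<bigtriangleup>\<rho>\<close> and \<open>\<bigtriangleup>\<tau> - \<tau> \<otimes> 1\<close> with \<open>\<succ>\<close>
  in the second factor, apart from the term \<open>(\<rho> \<succ> \<tau>) \<otimes> 1\<close>. Hence \<open>(\<phi>\<^sub>1 \<succ> \<phi>\<^sub>2)\<^sub>b\<close> equals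
  \<open>\<phi>\<^sub>1(b) (\<phi>\<^sub>2)\<^sub>b + (\<phi>\<^sub>1)\<^sub>b \<succ> (\<phi>\<^sub>2)\<^sub>b\<close> minus the contribution \<open>R\<close> of the pairs with \<open>|\<rho>| + |\<tau>| > [p]\<close>, and
  the increment of \<open>\<beta>\<close> from \<open>s\<close> to \<open>t\<close> is
  \<open>(I\<^sub>t - I\<^sub>s - \<beta>\<^sub>1(X\<^sub>s)(b)) \<beta>\<^sub>2(X\<^sub>t) + (I\<^sub>s + \<beta>\<^sub>1(X\<^sub>s)(b)) (\<beta>\<^sub>2(X\<^sub>t) - \<beta>\<^sub>2(X\<^sub>s)\<^sub>b)
  + (\<beta>\<^sub>1(X\<^sub>t) \<succ> \<beta>\<^sub>2(X\<^sub>t) - \<beta>\<^sub>1(X\<^sub>s)\<^sub>b \<succ> \<beta>\<^sub>2(X\<^sub>s)\<^sub>b) + R\<close>.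
  The first factor is \<open>O(\<omega>(s,t)\<^sup>\<theta>)\<close> by sewing, the middle terms are controlled by the assumptions on
  \<open>\<beta>\<^sub>1\<close> and \<open>\<beta>\<^sub>2\<close>, and a component of degree \<open>k\<close> of \<open>R\<close> carries a factor \<open>\<omega>(s,t)\<close> to a power of at
  least \<open>([p] + 1 - k) / p \<ge> \<theta> - k / p\<close>.
\<close>

section \<open>Degrees\<close>

text \<open>The norm is defined through coefficients, and coefficients through a description
  operator, so the independence of the forest coordinates on the group is proved before any
  estimate. Estimates then live in \<open>bounded_form\<close>, which asks for some representation
  with bounded coefficients. The group laws are awkward to check under truncation; they are proved
  for characters on all forests and carried over by the truncation map. The integral exists only
  because the control becomes uniformly small on short intervals, and this has to be extracted from
  the continuity of \<open>X\<close>, since finite variation by itself allows jumps. Uniformity of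
  the constant rests on one device: \<omega>(s,t) never exceeds \<omega>(0,T), so a power of it with
  a larger exponent is at most a fixed multiple of one with a smaller exponent. Apart from this
  multiple and the sewing constant, what enters the constant counts forests or adds up coefficients
  of coproducts, hence depends only on \<open>d\<close> and \<open>[p]\<close>.\<close>

lemma fdeg_empty [simp]: "fdeg {#} = 0"
  by (simp add: fdeg_def)

lemma fdeg_union [simp]: "fdeg (\<rho> + \<sigma>) = fdeg \<rho> + fdeg \<sigma>"
  by (simp add: fdeg_def)

lemma fdeg_add_mset [simp]: "fdeg (add_mset \<tau> \<rho>) = tdeg \<tau> + fdeg \<rho>"
  by (simp add: fdeg_def)

lemma tdeg_Node [simp]: "tdeg (Node j \<rho>) = Suc (fdeg \<rho>)"
  by (simp add: fdeg_def)

declare tdeg.simps [simp del]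

lemma tdeg_pos [simp]: "0 < tdeg \<tau>"
  by (cases \<tau>) simp

lemma tdeg_neq_0 [simp]: "tdeg \<tau> \<noteq> 0"
  by (cases \<tau>) simp

lemma fdeg_eq_0_iff [simp]: "fdeg \<rho> = 0 \<longleftrightarrow> \<rho> = {#}"
  by (cases \<rho>) auto

lemma fdeg_pos_iff [simp]: "0 < fdeg \<rho> \<longleftrightarrow> \<rho> \<noteq> {#}"
  by (metis fdeg_eq_0_iff not_gr_zero)

lemma tdeg_le_fdeg: "\<tau> \<in># \<rho> \<Longrightarrow> tdeg \<tau> \<le> fdeg \<rho>"
  by (metis fdeg_add_mset le_add1 mset_add)

lemma size_le_fdeg: "size \<rho> \<le> fdeg \<rho>"
proof (induction \<rho>)
  case (add \<tau> \<rho>)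
  then show ?case using tdeg_pos[of \<tau>] by (simp del: tdeg_pos)
qed simp

lemma tdeg_graft [simp]: "tdeg (graft \<rho> \<tau>) = fdeg \<rho> + tdeg \<tau>"
  by (cases \<tau>) simp

lemma graft_empty [simp]: "graft {#} \<tau> = \<tau>"
  by (cases \<tau>) simp

lemma empty_in_forests [simp]: "{#} \<in> forests d"
  by (simp add: forests_def)

lemma union_in_forests_iff [simp]: "\<rho> + \<sigma> \<in> forests d \<longleftrightarrow> \<rho> \<in> forests d \<and> \<sigma> \<in> forests d"
  by (auto simp: forests_def)

lemma add_mset_in_forests_iff [simp]:
  "add_mset \<tau> \<rho> \<in> forests d \<longleftrightarrow> \<tau> \<in> trees d \<and> \<rho> \<in> forests d"
  by (auto simp: forests_def)

lemma Node_in_trees_iff [simp]: "Node j \<rho> \<in> trees d \<longleftrightarrow> j \<in> {1..d} \<and> \<rho> \<in> forests d"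
  by (auto simp: forests_def trees_def)

lemma graft_in_trees_iff [simp]: "graft \<rho> \<tau> \<in> trees d \<longleftrightarrow> \<rho> \<in> forests d \<and> \<tau> \<in> trees d"
  by (cases \<tau>) auto

text \<open>Forests are generated by products and by grafting onto a new root, the two operations
  for which the coproduct has a formula. Identities for the coproduct therefore take one case for
  each.\<close>

lemma forest_induct [case_names empty Node union]:
  fixes \<rho> :: "'l ltree multiset"
  assumes empty: "P {#}"
    and Node: "\<And>j \<rho>. P \<rho> \<Longrightarrow> P {#Node j \<rho>#}"
    and union: "\<And>\<rho> \<sigma>. P \<rho> \<Longrightarrow> P \<sigma> \<Longrightarrow> P (\<rho> + \<sigma>)"
  shows "P \<rho>"
proof -
  have union': "P \<rho>" if "\<And>\<tau>. \<tau> \<in># \<rho> \<Longrightarrow> P {#\<tau>#}" for \<rho> :: "'l ltree multiset"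
    using that
  proof (induction \<rho>)
    case (add \<tau> \<rho>)
    then show ?case using union[of "{#\<tau>#}" \<rho>] by simp
  qed (simp add: empty)
  have tree: "P {#\<tau>#}" for \<tau>
  proof (induction \<tau>)
    case (Node j \<rho>)
    then show ?case using union' assms(2) by blast
  qed
  show ?thesis using union' tree by blast
qed

section \<open>Finiteness of the set of forests of bounded degree\<close>

lemma finite_bounded_multisets:
  assumes "finite A"
  shows "finite {M. set_mset M \<subseteq> A \<and> size M \<le> n}"
proof (rule finite_subset)
  show "{M. set_mset M \<subseteq> A \<and> size M \<le> n} \<subseteq> mset ` {xs. set xs \<subseteq> A \<and> length xs \<le> n}"
    by clarify (metis (mono_tags, lifting) ex_mset image_eqI mem_Collect_eq set_mset_mset size_mset)
  show "finite (mset ` {xs. set xs \<subseteq> A \<and> length xs \<le> n})"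
    using finite_lists_length_le[OF assms] by blast
qed

text \<open>Induction on the degree: removing the root of a tree of degree at most
  \<open>n + 1\<close> leaves a label and a forest of degree at most \<open>n\<close>, that is, a
  multiset of at most \<open>n\<close> trees from a set already known to be finite.\<close>

lemma finite_forests_bounded: "finite {\<rho> \<in> forests d. fdeg \<rho> \<le> n}"
proof -
  have "finite {\<tau> \<in> trees d. tdeg \<tau> \<le> n}"
  proof (induction n)
    case 0
    have "{\<tau> \<in> trees d. tdeg \<tau> \<le> 0} = {}" by auto
    then show ?case by (metis finite.emptyI)
  next
    case (Suc n)
    let ?A = "{\<tau> \<in> trees d. tdeg \<tau> \<le> n}"
    let ?M = "{\<rho>. set_mset \<rho> \<subseteq> ?A \<and> size \<rho> \<le> n}"
    have "{\<tau> \<in> trees d. tdeg \<tau> \<le> Suc n} \<subseteq> (\<lambda>(j, \<rho>). Node j \<rho>) ` ({1..d} \<times> ?M)"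
    proof
      fix \<tau> assume \<tau>: "\<tau> \<in> {\<tau> \<in> trees d. tdeg \<tau> \<le> Suc n}"
      obtain j \<rho> where "\<tau> = Node j \<rho>" by (cases \<tau>)
      moreover from this \<tau> have "j \<in> {1..d}" "\<rho> \<in> forests d" "fdeg \<rho> \<le> n" by auto
      moreover from this have "\<rho> \<in> ?M"
        using size_le_fdeg[of \<rho>] tdeg_le_fdeg[of _ \<rho>] by (force simp: forests_def)
      ultimately show "\<tau> \<in> (\<lambda>(j, \<rho>). Node j \<rho>) ` ({1..d} \<times> ?M)" by blast
    qed
    then show ?case
      using finite_bounded_multisets[OF Suc.IH] by (meson finite_SigmaI finite_atLeastAtMost finite_imageI finite_subset)
  qed
  moreover have "{\<rho> \<in> forests d. fdeg \<rho> \<le> n}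
      \<subseteq> {\<rho>. set_mset \<rho> \<subseteq> {\<tau> \<in> trees d. tdeg \<tau> \<le> n} \<and> size \<rho> \<le> n}"
    using size_le_fdeg tdeg_le_fdeg by (force simp: forests_def intro: order_trans)
  ultimately show ?thesis
    using finite_subset[OF _ finite_bounded_multisets] by blast
qed

lemma finite_forests_upto [simp]: "finite (forests_upto d n)"
  by (rule finite_subset[OF _ finite_forests_bounded[of d n]]) (auto simp: forests_upto_def)

lemma forests_upto_nonempty:
  assumes "1 \<le> d" "1 \<le> n"
  shows "forests_upto d n \<noteq> {}"
proof -
  have "{#Node 1 {#}#} \<in> forests_upto d n" using assms by (simp add: forests_upto_def)
  then show ?thesis by blast
qed

lemma single_in_forests_upto_iff [simp]: "{#\<tau>#} \<in> forests_upto d n \<longleftrightarrow> \<tau> \<in> trees_upto d n"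
  by (auto simp: forests_upto_def trees_upto_def)

lemma finite_trees_upto [simp]: "finite (trees_upto d n)"
proof -
  have "(\<lambda>\<tau>. {#\<tau>#}) ` trees_upto d n \<subseteq> forests_upto d n" by auto
  then show ?thesis
    by (metis finite_forests_upto finite_imageD finite_subset inj_onI single_eq_single)
qed


section \<open>Linear functionals of the coproduct\<close>

text \<open>The linear functional on tensors with value \<open>G u v\<close> at the basis element
  indexed by \<open>(u, v)\<close>. Working with functionals keeps finitely supported functions out
  of the later identities.\<close>

definition eval_tensor :: "(forest \<Rightarrow> forest \<Rightarrow> real) \<Rightarrow> tensor \<Rightarrow> real" where
  "eval_tensor G x = (\<Sum>k\<in>Poly_Mapping.keys x. Poly_Mapping.lookup x k * G (fst k) (snd k))"

lemma eval_tensor_superset: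
  "\<lbrakk>finite S; Poly_Mapping.keys x \<subseteq> S\<rbrakk> \<Longrightarrow>
    eval_tensor G x = (\<Sum>k\<in>S. Poly_Mapping.lookup x k * G (fst k) (snd k))"
  unfolding eval_tensor_def by (rule sum.mono_neutral_left) (auto simp: in_keys_iff)

lemma eval_tensor_zero [simp]: "eval_tensor G 0 = 0"
  by (simp add: eval_tensor_def)

lemma eval_tensor_add: "eval_tensor G (x + y) = eval_tensor G x + eval_tensor G y"
proof -
  let ?S = "Poly_Mapping.keys x \<union> Poly_Mapping.keys y"
  have "Poly_Mapping.keys (x + y) \<subseteq> ?S" by (rule keys_add)
  then show ?thesis
    by (simp add: eval_tensor_superset[of ?S] lookup_add ring_distribs sum.distrib)
qed

lemma eval_tensor_single [simp]: "eval_tensor G (Poly_Mapping.single k c) = c * G (fst k) (snd k)"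
  by (simp add: eval_tensor_superset[of "{k}"])

lemma eval_tensor_sum: "eval_tensor G (sum f A) = (\<Sum>i\<in>A. eval_tensor G (f i))"
  by (induction A rule: infinite_finite_induct) (auto simp: eval_tensor_add)

lemma tensor_decompose:
  fixes x :: tensor
  shows "x = (\<Sum>k\<in>Poly_Mapping.keys x. Poly_Mapping.single k (Poly_Mapping.lookup x k))"
  by (rule poly_mapping_eqI)
     (auto simp: lookup_sum lookup_single when_def in_keys_iff sum.delta' cong: if_cong)

lemma eval_tensor_mult:
  "eval_tensor G (x * y) =
    eval_tensor (\<lambda>u v. eval_tensor (\<lambda>u' v'. G (u + u') (v + v')) y) x"
proof -
  have "x * y = (\<Sum>k\<in>Poly_Mapping.keys x. Poly_Mapping.single k (Poly_Mapping.lookup x k)) *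
      (\<Sum>l\<in>Poly_Mapping.keys y. Poly_Mapping.single l (Poly_Mapping.lookup y l))"
    using tensor_decompose by metis
  also have "\<dots> = (\<Sum>k\<in>Poly_Mapping.keys x. \<Sum>l\<in>Poly_Mapping.keys y.
      Poly_Mapping.single (k + l) (Poly_Mapping.lookup x k * Poly_Mapping.lookup y l))"
    by (simp add: sum_product mult_single)
  finally show ?thesis
    by (simp add: eval_tensor_sum) (simp add: eval_tensor_def sum_distrib_left mult.assoc)
qed

lemma eval_tensor_graft_right:
  "eval_tensor G (graft_right j x) = eval_tensor (\<lambda>u v. G u {#Node j v#}) x"
  unfolding graft_right_def by (simp add: eval_tensor_sum) (simp add: eval_tensor_def)

text \<open>In Sweedler's notation, \<open>sweedler G \<rho>\<close> is the sum of \<open>G \<rho>\<^sub>1 \<rho>\<^sub>2\<close> over \<open>\<bigtriangleup>\<rho>\<close>.\<close>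

definition sweedler :: "(forest \<Rightarrow> forest \<Rightarrow> real) \<Rightarrow> forest \<Rightarrow> real" where
  "sweedler G \<rho> = eval_tensor G (coproduct \<rho>)"

lemma coproduct_empty [simp]: "coproduct {#} = 1"
  by (simp add: coproduct_def)

lemma coproduct_union: "coproduct (\<rho> + \<sigma>) = coproduct \<rho> * coproduct \<sigma>"
  by (simp add: coproduct_def)

lemma coproduct_Node:
  "coproduct {#Node j \<rho>#} =
    Poly_Mapping.single ({#Node j \<rho>#}, {#}) 1 + graft_right j (coproduct \<rho>)"
  by (simp add: coproduct_def)

lemma one_tensor: "(1 :: tensor) = Poly_Mapping.single ({#}, {#}) 1"
  by (simp add: zero_prod_def[symmetric])

lemma sweedler_empty [simp]: "sweedler G {#} = G {#} {#}"
  by (simp add: sweedler_def one_tensor del: single_one)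

lemma sweedler_union:
  "sweedler G (\<rho> + \<sigma>) = sweedler (\<lambda>u v. sweedler (\<lambda>u' v'. G (u + u') (v + v')) \<sigma>) \<rho>"
  by (simp add: sweedler_def coproduct_union eval_tensor_mult)

lemma sweedler_Node:
  "sweedler G {#Node j \<rho>#} = G {#Node j \<rho>#} {#} + sweedler (\<lambda>u v. G u {#Node j v#}) \<rho>"
  by (simp add: sweedler_def coproduct_Node eval_tensor_add eval_tensor_graft_right)

lemma sweedler_add: "sweedler (\<lambda>u v. G u v + H u v) \<rho> = sweedler G \<rho> + sweedler H \<rho>"
  by (simp add: sweedler_def eval_tensor_def ring_distribs sum.distrib)

lemma sweedler_cmult: "sweedler (\<lambda>u v. c * G u v) \<rho> = c * sweedler G \<rho>"
  by (simp add: sweedler_def eval_tensor_def sum_distrib_left mult.left_commute)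

lemma sweedler_cmult_right: "sweedler (\<lambda>u v. G u v * c) \<rho> = sweedler G \<rho> * c"
  by (simp add: sweedler_def eval_tensor_def sum_distrib_right mult.assoc)

lemma sweedler_zero [simp]: "sweedler (\<lambda>u v. 0) \<rho> = 0"
  by (simp add: sweedler_def eval_tensor_def)

lemma sweedler_sum: "sweedler (\<lambda>u v. \<Sum>i\<in>A. G i u v) \<rho> = (\<Sum>i\<in>A. sweedler (G i) \<rho>)"
  by (induction A rule: infinite_finite_induct) (auto simp: sweedler_add)

lemma sweedler_commute:
  "sweedler (\<lambda>u v. sweedler (\<lambda>u' v'. G u v u' v') \<sigma>) \<rho> =
    sweedler (\<lambda>u' v'. sweedler (\<lambda>u v. G u v u' v') \<rho>) \<sigma>"
  unfolding sweedler_def eval_tensor_def sum_distrib_left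
  by (subst sum.swap) (simp add: mult.left_commute)

text \<open>Products add keys and the new root always goes into the right factor, so cutting
  preserves the number of vertices and the set of labels. This is what lets a truncated character
  stand for a full one under a coproduct.\<close>

lemma coproduct_keys:
  assumes "(u, v) \<in> Poly_Mapping.keys (coproduct \<rho>)"
  shows "fdeg u + fdeg v = fdeg \<rho>"
    and "\<rho> \<in> forests d \<Longrightarrow> u \<in> forests d" "\<rho> \<in> forests d \<Longrightarrow> v \<in> forests d"
proof -
  have "fdeg u + fdeg v = fdeg \<rho> \<and> (\<rho> \<in> forests d \<longrightarrow> u \<in> forests d \<and> v \<in> forests d)"
    using assms
  proof (induction \<rho> arbitrary: u v rule: forest_induct)
    case empty
    then show ?case by (simp add: one_tensor del: single_one)
  next
    case (Node j \<rho>)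
    have "Poly_Mapping.keys (graft_right j x) \<subseteq> (\<lambda>k. (fst k, {#Node j (snd k)#})) ` Poly_Mapping.keys x" for x
      unfolding graft_right_def by (rule order.trans[OF keys_sum]) (auto split: if_splits)
    moreover have "(u, v) \<in> Poly_Mapping.keys (Poly_Mapping.single ({#Node j \<rho>#}, {#}) (1 :: real)) \<union>
        Poly_Mapping.keys (graft_right j (coproduct \<rho>))"
      using Node.prems unfolding coproduct_Node by (rule subsetD[OF keys_add])
    ultimately have "(u, v) = ({#Node j \<rho>#}, {#}) \<or>
        (u, v) \<in> (\<lambda>k. (fst k, {#Node j (snd k)#})) ` Poly_Mapping.keys (coproduct \<rho>)"
      by auto
    then have "(u, v) = ({#Node j \<rho>#}, {#}) \<or>
        (\<exists>w. (u, w) \<in> Poly_Mapping.keys (coproduct \<rho>) \<and> v = {#Node j w#})"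
      by force
    then show ?case using Node.IH by auto
  next
    case (union \<rho> \<sigma>)
    obtain k l where "(u, v) = k + l" "k \<in> Poly_Mapping.keys (coproduct \<rho>)"
        "l \<in> Poly_Mapping.keys (coproduct \<sigma>)"
      using union.prems keys_mult unfolding coproduct_union by blast
    with union.IH[of "fst k" "snd k"] union.IH(2)[of "fst l" "snd l"] show ?case
      by (cases k, cases l) auto
  qed
  then show "fdeg u + fdeg v = fdeg \<rho>"
    and "\<rho> \<in> forests d \<Longrightarrow> u \<in> forests d" "\<rho> \<in> forests d \<Longrightarrow> v \<in> forests d"
    by auto
qed

lemma sweedler_cong_deg:
  assumes "\<And>u v. fdeg u + fdeg v = fdeg \<rho> \<Longrightarrow> G u v = H u v"
  shows "sweedler G \<rho> = sweedler H \<rho>"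
  unfolding sweedler_def eval_tensor_def
  using assms coproduct_keys(1)[of "fst _" "snd _"] by (auto intro!: sum.cong)

lemma sweedler_cong:
  assumes "\<rho> \<in> forests d"
    and "\<And>u v. \<lbrakk>u \<in> forests d; v \<in> forests d; fdeg u + fdeg v = fdeg \<rho>\<rbrakk> \<Longrightarrow> G u v = H u v"
  shows "sweedler G \<rho> = sweedler H \<rho>"
  unfolding sweedler_def eval_tensor_def
proof (rule sum.cong)
  fix k assume "k \<in> Poly_Mapping.keys (coproduct \<rho>)"
  then have "(fst k, snd k) \<in> Poly_Mapping.keys (coproduct \<rho>)" by simp
  then show "Poly_Mapping.lookup (coproduct \<rho>) k * G (fst k) (snd k) =
      Poly_Mapping.lookup (coproduct \<rho>) k * H (fst k) (snd k)"
    using coproduct_keys assms by (metis (no_types))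
qed simp

text \<open>The counit axiom, tested against an arbitrary \<open>f\<close>. The induction needs this
  generality: grafting a root or multiplying by a second forest changes the function applied to the
  remaining factor.\<close>

lemma sweedler_counit_left: "sweedler (\<lambda>u v. if u = {#} then f v else 0) \<rho> = f \<rho>"
proof (induction \<rho> arbitrary: f rule: forest_induct)
  case (Node j \<rho>)
  then show ?case by (simp add: sweedler_Node)
next
  case (union \<rho> \<sigma>)
  have "sweedler (\<lambda>u v. if u = {#} then f v else 0) (\<rho> + \<sigma>) =
      sweedler (\<lambda>u v. if u = {#} then sweedler (\<lambda>u' v'. if u' = {#} then f (v + v') else 0) \<sigma> else 0) \<rho>"
    unfolding sweedler_union by (rule arg_cong[where f = "\<lambda>G. sweedler G \<rho>"]) (auto simp: fun_eq_iff)
  then show ?case by (simp add: union.IH)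
qed simp

lemma sweedler_counit_right: "sweedler (\<lambda>u v. if v = {#} then f u else 0) \<rho> = f \<rho>"
proof (induction \<rho> arbitrary: f rule: forest_induct)
  case (Node j \<rho>)
  then show ?case by (simp add: sweedler_Node)
next
  case (union \<rho> \<sigma>)
  have "sweedler (\<lambda>u v. if v = {#} then f u else 0) (\<rho> + \<sigma>) =
      sweedler (\<lambda>u v. if v = {#} then sweedler (\<lambda>u' v'. if v' = {#} then f (u + u') else 0) \<sigma> else 0) \<rho>"
    unfolding sweedler_union by (rule arg_cong[where f = "\<lambda>G. sweedler G \<rho>"]) (auto simp: fun_eq_iff)
  then show ?case by (simp add: union.IH)
qed simp

section \<open>The group of characters\<close>

text \<open>Characters without truncation, on forests with arbitrary labels. Their convolution obeys
  the group laws with no degree condition to carry along.\<close>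

definition multiplicative :: "(forest \<Rightarrow> real) \<Rightarrow> bool" where
  "multiplicative a \<longleftrightarrow> a {#} = 1 \<and> (\<forall>\<rho> \<sigma>. a (\<rho> + \<sigma>) = a \<rho> * a \<sigma>)"

definition conv :: "(forest \<Rightarrow> real) \<Rightarrow> (forest \<Rightarrow> real) \<Rightarrow> forest \<Rightarrow> real" where
  "conv a b \<rho> = sweedler (\<lambda>u v. a u * b v) \<rho>"

definition counit :: "forest \<Rightarrow> real" where
  "counit \<rho> = (if \<rho> = {#} then 1 else 0)"

lemma multiplicativeD:
  assumes "multiplicative a"
  shows "a {#} = 1" "a (\<rho> + \<sigma>) = a \<rho> * a \<sigma>"
  using assms by (auto simp: multiplicative_def)

lemma multiplicative_eqI:
  assumes a: "multiplicative a" and b: "multiplicative b" and "\<And>\<tau>. a {#\<tau>#} = b {#\<tau>#}"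
  shows "a = b"
proof
  fix \<rho> show "a \<rho> = b \<rho>"
  proof (induction \<rho>)
    case (add \<tau> \<rho>)
    then show ?case
      using multiplicativeD(2)[OF a, of "{#\<tau>#}" \<rho>] multiplicativeD(2)[OF b, of "{#\<tau>#}" \<rho>] assms(3) by simp
  qed (simp add: multiplicativeD a b)
qed

text \<open>Trees are free generators of the monoid of forests, so every function on trees extends
  to a character. Inverses, lifts of truncated characters and the test characters for uniqueness of
  coefficients are all obtained this way.\<close>

definition monomial_char :: "(nat ltree \<Rightarrow> real) \<Rightarrow> forest \<Rightarrow> real" where
  "monomial_char g \<rho> = (\<Prod>\<tau>\<in>#\<rho>. g \<tau>)"

lemma multiplicative_monomial_char [simp]: "multiplicative (monomial_char g)"
  by (simp add: multiplicative_def monomial_char_def)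

lemma multiplicative_counit [simp]: "multiplicative counit"
  by (simp add: multiplicative_def counit_def)

lemma conv_union:
  assumes "multiplicative a" "multiplicative b"
  shows "conv a b (\<rho> + \<sigma>) = conv a b \<rho> * conv a b \<sigma>"
proof -
  have "conv a b (\<rho> + \<sigma>) = sweedler (\<lambda>u v. (a u * b v) * sweedler (\<lambda>u' v'. a u' * b v') \<sigma>) \<rho>"
    unfolding conv_def sweedler_union sweedler_cmult[symmetric]
    by (simp add: multiplicativeD[OF assms(1)] multiplicativeD[OF assms(2)] mult_ac)
  then show ?thesis by (simp add: conv_def sweedler_cmult_right)
qed

lemma multiplicative_conv [simp]:
  "multiplicative a \<Longrightarrow> multiplicative b \<Longrightarrow> multiplicative (conv a b)"
  by (simp add: multiplicative_def conv_union) (simp add: conv_def)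

text \<open>Coassociativity. Keeping the last functional arbitrary is what lets the induction pass
  through the grafting of a root, which does not preserve multiplicativity.\<close>

lemma sweedler_coassoc:
  assumes a: "multiplicative a" and b: "multiplicative b"
  shows "sweedler (\<lambda>u v. conv a b u * f v) \<rho> =
    sweedler (\<lambda>u v. a u * sweedler (\<lambda>u' v'. b u' * f v') v) \<rho>"
proof (induction \<rho> arbitrary: f rule: forest_induct)
  case empty
  then show ?case by (simp add: conv_def)
next
  case (Node j \<rho>)
  show ?case
    by (simp add: sweedler_Node conv_def[of a b "{#Node j \<rho>#}"] Node.IH ring_distribs sweedler_add
        multiplicativeD[OF a] multiplicativeD[OF b] sweedler_cmult_right mult.assoc[symmetric])
next
  case (union \<rho> \<sigma>)
  have "sweedler (\<lambda>u v. conv a b u * f v) (\<rho> + \<sigma>) =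
      sweedler (\<lambda>u v. conv a b u * sweedler (\<lambda>u' v'. conv a b u' * f (v + v')) \<sigma>) \<rho>"
    unfolding sweedler_union sweedler_cmult[symmetric] by (simp add: conv_union a b mult.assoc)
  also have "\<dots> = sweedler (\<lambda>u v. a u * sweedler (\<lambda>u' v'. b u' *
      sweedler (\<lambda>s t. a s * sweedler (\<lambda>s' t'. b s' * f (v' + t')) t) \<sigma>) v) \<rho>"
    by (simp add: union.IH(2)) (simp add: union.IH(1))
  \<comment> \<open>The cuts of \<open>v\<close> and of \<open>\<sigma>\<close> are independent and
    may be swapped. The two outer sums then form the coproduct of \<open>\<rho> + \<sigma>\<close>,
    the two inner ones that of its right factor.\<close>
  also have "\<dots> = sweedler (\<lambda>u v. sweedler (\<lambda>s t. sweedler (\<lambda>u' v'.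
      a u * (b u' * (a s * sweedler (\<lambda>s' t'. b s' * f (v' + t')) t))) v) \<sigma>) \<rho>"
    unfolding sweedler_cmult[symmetric] by (subst sweedler_commute) simp
  also have "\<dots> = sweedler (\<lambda>u v. a u * sweedler (\<lambda>u' v'. b u' * f v') v) (\<rho> + \<sigma>)"
    unfolding sweedler_union sweedler_cmult[symmetric]
    by (simp add: multiplicativeD[OF a] multiplicativeD[OF b] mult_ac)
  finally show ?case .
qed

lemma conv_assoc:
  assumes "multiplicative a" "multiplicative b"
  shows "conv (conv a b) c = conv a (conv b c)"
  using sweedler_coassoc[OF assms, of c] by (simp add: conv_def fun_eq_iff)

lemma conv_counit_left [simp]: "conv counit a = a"
proof
  fix \<rho>
  have "conv counit a \<rho> = sweedler (\<lambda>u v. if u = {#} then a v else 0) \<rho>"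
    unfolding conv_def counit_def by (rule arg_cong[where f = "\<lambda>G. sweedler G \<rho>"]) (auto simp: fun_eq_iff)
  then show "conv counit a \<rho> = a \<rho>" by (simp add: sweedler_counit_left)
qed

text \<open>The recursion for the antipode, composed with \<open>a\<close>: the equation
  \<open>conv b a {#\<tau>#} = 0\<close> solved for \<open>b {#\<tau>#}\<close>, which occurs only
  in the term with empty right factor. In all other terms the right factor uses up at least one
  vertex, so the recursion reaches trees of smaller degree.\<close>

function conv_inv_tree :: "(forest \<Rightarrow> real) \<Rightarrow> nat ltree \<Rightarrow> real" where
  "conv_inv_tree a \<tau> =
    - (\<Sum>k\<in>{k \<in> Poly_Mapping.keys (coproduct {#\<tau>#}). snd k \<noteq> {#}}.
        Poly_Mapping.lookup (coproduct {#\<tau>#}) k *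
        prod_mset (image_mset (conv_inv_tree a) (fst k)) * a (snd k))"
  by auto
termination
proof (relation "Wellfounded.measure (\<lambda>(a, \<tau>). tdeg \<tau>)")
  fix a :: "forest \<Rightarrow> real" and \<tau> \<sigma> :: "nat ltree" and k
  assume k: "k \<in> {k \<in> Poly_Mapping.keys (coproduct {#\<tau>#}). snd k \<noteq> {#}}" and "\<sigma> \<in># fst k"
  then have "tdeg \<sigma> \<le> fdeg (fst k)" by (simp add: tdeg_le_fdeg)
  moreover have "fdeg (fst k) + fdeg (snd k) = tdeg \<tau>"
    using coproduct_keys(1)[of "fst k" "snd k" "{#\<tau>#}"] k by simp
  moreover have "fdeg (snd k) > 0" using k by simp
  ultimately show "((a, \<sigma>), (a, \<tau>)) \<in> Wellfounded.measure (\<lambda>(a, \<tau>). tdeg \<tau>)"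
    by (simp del: fdeg_pos_iff)
qed simp

declare conv_inv_tree.simps [simp del]

lemma conv_left_inverse:
  assumes a: "multiplicative a"
  shows "conv (monomial_char (conv_inv_tree a)) a = counit"
proof (rule multiplicative_eqI)
  let ?b = "monomial_char (conv_inv_tree a)"
  fix \<tau> :: "nat ltree"
  \<comment> \<open>The term with \<open>v = {#}\<close> contributes the unknown value
    \<open>?b {#\<tau>#}\<close>; the recursion was set up so that the remaining terms add up to its
    negative.\<close>
  have "conv ?b a {#\<tau>#} = sweedler (\<lambda>u v. (if v = {#} then ?b u else 0) + (if v = {#} then 0 else ?b u * a v)) {#\<tau>#}"
    unfolding conv_def by (rule arg_cong[where f = "\<lambda>G. sweedler G _"]) (auto simp: fun_eq_iff multiplicativeD a)
  also have "\<dots> = ?b {#\<tau>#} + sweedler (\<lambda>u v. if v = {#} then 0 else ?b u * a v) {#\<tau>#}"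
    by (simp add: sweedler_add sweedler_counit_right)
  also have "sweedler (\<lambda>u v. if v = {#} then 0 else ?b u * a v) {#\<tau>#} =
    (\<Sum>k\<in>{k \<in> Poly_Mapping.keys (coproduct {#\<tau>#}). snd k \<noteq> {#}}.
        Poly_Mapping.lookup (coproduct {#\<tau>#}) k * ?b (fst k) * a (snd k))"
    unfolding sweedler_def eval_tensor_def by (rule sum.mono_neutral_cong_right) auto
  also have "\<dots> = - ?b {#\<tau>#}"
    by (simp add: monomial_char_def) (subst conv_inv_tree.simps, simp add: monomial_char_def)
  finally show "conv ?b a {#\<tau>#} = counit {#\<tau>#}" by (simp add: counit_def)
qed (use a in auto)

definition character_group :: "(forest \<Rightarrow> real) monoid" where
  "character_group = \<lparr>carrier = Collect multiplicative, monoid.mult = conv, one = counit\<rparr>"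

lemma group_character_group: "group character_group"
proof (rule groupI)
  fix a assume "a \<in> carrier character_group"
  then have "multiplicative a" by (simp add: character_group_def)
  then show "\<exists>b\<in>carrier character_group. b \<otimes>\<^bsub>character_group\<^esub> a = \<one>\<^bsub>character_group\<^esub>"
    using conv_left_inverse multiplicative_monomial_char by (fastforce simp: character_group_def)
qed (auto simp: character_group_def conv_assoc)

section \<open>Passage from full to truncated characters\<close>

definition truncate_char :: "nat \<Rightarrow> nat \<Rightarrow> (forest \<Rightarrow> real) \<Rightarrow> forest \<Rightarrow> real" where
  "truncate_char d n a \<rho> = (if \<rho> \<in> forests d \<and> fdeg \<rho> \<le> n then a \<rho> else 0)"

lemma char_group_mult_apply:
  "(a \<otimes>\<^bsub>char_group d n\<^esub> b) \<rho> =
    (if \<rho> \<in> forests d \<and> fdeg \<rho> \<le> n then sweedler (\<lambda>u v. a u * b v) \<rho> else 0)"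
  by (simp add: char_group_def sweedler_def eval_tensor_def mult.assoc)

lemma char_groupD:
  assumes "a \<in> carrier (char_group d n)"
  shows "a {#} = 1"
    and "\<lbrakk>\<rho> \<in> forests d; \<sigma> \<in> forests d; fdeg \<rho> + fdeg \<sigma> \<le> n\<rbrakk> \<Longrightarrow> a (\<rho> + \<sigma>) = a \<rho> * a \<sigma>"
    and "\<rho> \<notin> forests d \<or> n < fdeg \<rho> \<Longrightarrow> a \<rho> = 0"
  using assms by (auto simp: char_group_def)

text \<open>A truncated character is determined by its values on trees, and extending these values
  multiplicatively gives a full character that truncates to it. Truncation is thus onto.\<close>

lemma carrier_char_group: "carrier (char_group d n) = truncate_char d n ` Collect multiplicative"
proof (intro equalityI subsetI)
  fix a assume a: "a \<in> carrier (char_group d n)"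
  have eq: "a \<rho> = monomial_char (\<lambda>\<tau>. a {#\<tau>#}) \<rho>" if "\<rho> \<in> forests d" "fdeg \<rho> \<le> n" for \<rho>
    using that
  proof (induction \<rho>)
    case empty
    then show ?case by (simp add: char_groupD[OF a] monomial_char_def)
  next
    case (add \<tau> \<rho>)
    then show ?case
      using char_groupD(2)[OF a, of "{#\<tau>#}" \<rho>] by (simp add: monomial_char_def)
  qed
  have "a = truncate_char d n (monomial_char (\<lambda>\<tau>. a {#\<tau>#}))"
    using eq char_groupD(3)[OF a] by (auto simp: truncate_char_def fun_eq_iff)
  then show "a \<in> truncate_char d n ` Collect multiplicative"
    using multiplicative_monomial_char by blast
next
  fix a assume "a \<in> truncate_char d n ` Collect multiplicative"
  then show "a \<in> carrier (char_group d n)"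
    by (auto simp: char_group_def truncate_char_def multiplicative_def)
qed

lemma truncate_char_conv:
  "truncate_char d n (conv a b) = truncate_char d n a \<otimes>\<^bsub>char_group d n\<^esub> truncate_char d n b"
proof
  fix \<rho>
  have "sweedler (\<lambda>u v. a u * b v) \<rho> = sweedler (\<lambda>u v. truncate_char d n a u * truncate_char d n b v) \<rho>"
    if "\<rho> \<in> forests d" "fdeg \<rho> \<le> n"
    by (rule sweedler_cong[OF that(1)]) (use that(2) in \<open>auto simp: truncate_char_def\<close>)
  then show "truncate_char d n (conv a b) \<rho> = (truncate_char d n a \<otimes>\<^bsub>char_group d n\<^esub> truncate_char d n b) \<rho>"
    by (simp add: char_group_mult_apply) (simp add: truncate_char_def conv_def)
qed

lemma one_char_group: "\<one>\<^bsub>char_group d n\<^esub> = counit"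
  by (simp add: char_group_def counit_def[abs_def])

lemma truncate_char_counit: "truncate_char d n counit = counit"
  by (auto simp: truncate_char_def counit_def fun_eq_iff)

text \<open>A homomorphic image of a group is a group, so associativity and inverses need no
  verification under degree bounds.\<close>

lemma group_char_group: "group (char_group d n)"
proof -
  interpret group character_group by (rule group_character_group)
  have "truncate_char d n \<in> hom character_group (char_group d n)"
    by (auto simp: hom_def truncate_char_conv carrier_char_group character_group_def)
  then have "group (char_group d n\<lparr>carrier := truncate_char d n ` carrier character_group,
      one := truncate_char d n \<one>\<^bsub>character_group\<^esub>\<rparr>)"
    by (rule hom_imp_img_group)
  moreover have "char_group d n\<lparr>carrier := truncate_char d n ` carrier character_group,
      one := truncate_char d n \<one>\<^bsub>character_group\<^esub>\<rparr> = char_group d n"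
    using one_char_group[of d n] carrier_char_group[of d n]
    by (simp add: character_group_def truncate_char_counit)
  ultimately show ?thesis by simp
qed

section \<open>Uniqueness of the coefficients of a form\<close>

text \<open>Artin's argument for the linear independence of characters.\<close>

lemma monomial_char_independent:
  assumes "finite S" and "\<And>g. (\<Sum>\<rho>\<in>S. f \<rho> * monomial_char g \<rho>) = 0" and "\<rho> \<in> S"
  shows "f \<rho> = 0"
  using assms
proof (induction S arbitrary: f \<rho> rule: finite_induct)
  case (insert \<sigma> S)
  have mult: "monomial_char (\<lambda>\<tau>. g \<tau> * h \<tau>) \<rho> = monomial_char g \<rho> * monomial_char h \<rho>" for g h \<rho>
    by (simp add: monomial_char_def prod_mset.distrib)
  have S: "f \<rho> = 0" if "\<rho> \<in> S" for \<rho>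
  proof -
    have "\<rho> \<noteq> \<sigma>" using that insert.hyps by blast
    then obtain \<tau> where \<tau>: "count \<rho> \<tau> \<noteq> count \<sigma> \<tau>" by (meson multiset_eqI)
    \<comment> \<open>Doubling the value at one tree whose multiplicities in \<open>\<rho>\<close>
      and \<open>\<sigma>\<close> differ separates the two forests, because
      \<open>monomial_char h\<close> is then a power of two with that multiplicity as
      exponent.\<close>
    define h where "h = (\<lambda>\<tau>'. if \<tau>' = \<tau> then 2 else 1 :: real)"
    have h: "monomial_char h \<rho> = 2 ^ count \<rho> \<tau>" for \<rho>
      unfolding monomial_char_def h_def by (induction \<rho>) auto
    have "(\<Sum>\<rho>\<in>S. f \<rho> * (monomial_char h \<rho> - monomial_char h \<sigma>) * monomial_char g \<rho>) = 0" for g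
    proof -
      have "0 = (\<Sum>\<rho>\<in>insert \<sigma> S. f \<rho> * monomial_char (\<lambda>\<tau>. g \<tau> * h \<tau>) \<rho>)
          - monomial_char h \<sigma> * (\<Sum>\<rho>\<in>insert \<sigma> S. f \<rho> * monomial_char g \<rho>)"
        by (simp add: insert.prems del: sum.insert)
      also have "\<dots> = (\<Sum>\<rho>\<in>insert \<sigma> S. f \<rho> * (monomial_char h \<rho> - monomial_char h \<sigma>) * monomial_char g \<rho>)"
        unfolding sum_distrib_left sum_subtractf[symmetric] mult
        by (rule sum.cong) (auto simp: algebra_simps)
      also have "\<dots> = (\<Sum>\<rho>\<in>S. f \<rho> * (monomial_char h \<rho> - monomial_char h \<sigma>) * monomial_char g \<rho>)"
        using insert.hyps by simp
      finally show ?thesis by simp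
    qed
    from insert.IH[OF this that] \<tau> show ?thesis by (simp add: h)
  qed
  have "f \<sigma> = 0"
    using insert.prems(1)[of "\<lambda>_. 1"] insert.hyps S by (simp add: monomial_char_def)
  then show ?case using S insert.prems(2) by blast
qed simp

lemma represents_unique:
  assumes "represents d n f \<phi>" "represents d n f' \<phi>" "\<rho> \<in> forests_upto d n"
  shows "f \<rho> = f' \<rho>"
proof -
  have "(\<Sum>\<rho>\<in>forests_upto d n. (f \<rho> - f' \<rho>) * monomial_char g \<rho>) = 0" for g
  proof -
    let ?c = "truncate_char d n (monomial_char g)"
    have "(\<Sum>\<rho>\<in>forests_upto d n. (f \<rho> - f' \<rho>) * monomial_char g \<rho>) =
        (\<Sum>\<rho>\<in>forests_upto d n. f \<rho> * ?c \<rho>) - (\<Sum>\<rho>\<in>forests_upto d n. f' \<rho> * ?c \<rho>)"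
      unfolding sum_subtractf[symmetric]
      by (rule sum.cong) (auto simp: truncate_char_def forests_upto_def algebra_simps)
    moreover have "?c \<in> carrier (char_group d n)"
      by (simp add: carrier_char_group)
    ultimately show ?thesis using assms(1,2) by (simp add: represents_def)
  qed
  from monomial_char_independent[OF finite_forests_upto this assms(3)] show ?thesis by simp
qed

lemma coeffs_eq:
  assumes "represents d n f \<phi>" "\<rho> \<in> forests_upto d n"
  shows "coeffs d n \<phi> \<rho> = f \<rho>"
proof -
  let ?f = "\<lambda>\<rho>. if \<rho> \<in> forests_upto d n then f \<rho> else 0"
  have f: "represents d n ?f \<phi>" using assms(1) by (simp add: represents_def)
  have "coeffs d n \<phi> = ?f"
    unfolding coeffs_def
  proof (rule the_equality)
    fix f' assume "represents d n f' \<phi> \<and> (\<forall>\<rho>. \<rho> \<notin> forests_upto d n \<longrightarrow> f' \<rho> = 0)"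
    then show "f' = ?f" using represents_unique[OF _ assms(1)] by (auto simp: fun_eq_iff)
  qed (simp add: f)
  with assms(2) show ?thesis by simp
qed

lemma represents_coeffs:
  assumes "\<phi> \<in> forms d n"
  shows "represents d n (coeffs d n \<phi>) \<phi>"
proof -
  obtain f where f: "represents d n f \<phi>" using assms by (auto simp: forms_def)
  then show ?thesis using coeffs_eq[OF f] by (simp add: represents_def)
qed

section \<open>Partitions\<close>

lemma partition_sum_simps [simp]:
  "partition_sum f [] = 0"
  "partition_sum f [x] = 0"
  "partition_sum f (x # y # r) = f x y + partition_sum f (y # r)"
  by (simp_all add: partition_sum_def sum.lessThan_Suc_shift del: sum.lessThan_Suc)

lemma is_partition_simps [simp]:
  "\<not> is_partition s t []"
  "is_partition s t [x] \<longleftrightarrow> x = s \<and> s = t"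
  "is_partition s t (x # y # r) \<longleftrightarrow> x = s \<and> s < y \<and> is_partition y t (y # r)"
  by (auto simp: is_partition_def intro: less_trans)

lemma is_partition_refl_iff: "is_partition s s D \<longleftrightarrow> D = [s]"
proof
  assume D: "is_partition s s D"
  then obtain r where r: "D = s # r" by (cases D) (auto simp: is_partition_def)
  have "r = []"
  proof (rule ccontr)
    assume "r \<noteq> []"
    then have "last r \<in> set r" by simp
    with D r \<open>r \<noteq> []\<close> show False by (auto simp: is_partition_def)
  qed
  with r show "D = [s]" by simp
qed simp

lemma is_partition_append_iff:
  "is_partition s t (A @ u # B) \<longleftrightarrow> is_partition s u (A @ [u]) \<and> is_partition u t (u # B)"
  by (cases A) (auto simp: is_partition_def sorted_wrt_append intro: less_trans)

lemma partition_sum_append: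
  "partition_sum f (A @ u # B) = partition_sum f (A @ [u]) + partition_sum f (u # B)"
proof (induction A)
  case (Cons x A)
  then show ?case by (cases A) auto
qed simp

lemma is_partition_induct [consumes 1, case_names single step]:
  assumes "is_partition s t D"
    and "P t [t]"
    and "\<And>s y r. \<lbrakk>s < y; is_partition y t (y # r); P y (y # r)\<rbrakk> \<Longrightarrow> P s (s # y # r)"
  shows "P s D"
  using assms(1)
proof (induction D arbitrary: s)
  case (Cons x D)
  then show ?case using assms(2,3) by (cases D) auto
qed simp

lemma is_partition_le: "is_partition s t D \<Longrightarrow> s \<le> t"
  by (induction rule: is_partition_induct) auto

lemma is_partition_subset: "is_partition s t D \<Longrightarrow> set D \<subseteq> {s..t}"
proof (induction rule: is_partition_induct)
  case (step s y r)
  then show ?case using is_partition_le[OF step(2)] by auto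
qed simp

lemma is_partition_sorted_list_of_set:
  assumes "finite S" "S \<subseteq> {s..t}" "s \<in> S" "t \<in> S"
  shows "is_partition s t (sorted_list_of_set S)"
proof -
  let ?F = "sorted_list_of_set S"
  have F: "set ?F = S" "sorted ?F" using assms(1) by simp_all
  with assms(3) have "?F \<noteq> []" by force
  then obtain x xs where x: "?F = x # xs" by (cases ?F) auto
  obtain y ys where y: "?F = ys @ [y]" using \<open>?F \<noteq> []\<close> by (metis append_butlast_last_id)
  have "x = s" using F assms(2,3) unfolding x by force
  moreover have "y = t" using F assms(2,4) unfolding y by (force simp: sorted_append)
  moreover have "hd ?F = x" "last ?F = y" using x y by (metis list.sel(1), metis last_snoc)
  ultimately show ?thesis
    using strict_sorted_list_of_set[of S] \<open>?F \<noteq> []\<close> by (simp add: is_partition_def)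
qed

definition mesh_less :: "real \<Rightarrow> real list \<Rightarrow> bool" where
  "mesh_less \<delta> D \<longleftrightarrow> (\<forall>k. Suc k < length D \<longrightarrow> D ! Suc k - D ! k < \<delta>)"

lemma mesh_less_simps [simp]:
  "mesh_less \<delta> [x]"
  "mesh_less \<delta> (x # y # r) \<longleftrightarrow> y - x < \<delta> \<and> mesh_less \<delta> (y # r)"
proof -
  have *: "(\<forall>k. P k) \<longleftrightarrow> P 0 \<and> (\<forall>k. P (Suc k))" for P :: "nat \<Rightarrow> bool"
    by (metis not0_implies_Suc)
  show "mesh_less \<delta> (x # y # r) \<longleftrightarrow> y - x < \<delta> \<and> mesh_less \<delta> (y # r)"
    unfolding mesh_less_def by (subst *) simp
qed (simp add: mesh_less_def)

lemma mesh_less_append_iff: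
  "mesh_less \<delta> (A @ u # B) \<longleftrightarrow> mesh_less \<delta> (A @ [u]) \<and> mesh_less \<delta> (u # B)"
proof (induction A)
  case (Cons x A)
  then show ?case by (cases A) auto
qed simp

lemma mesh_less_mono: "mesh_less \<delta> D \<Longrightarrow> \<delta> \<le> \<delta>' \<Longrightarrow> mesh_less \<delta>' D"
  unfolding mesh_less_def by force

lemma fine_partition_exists:
  assumes "s \<le> t" "0 < \<delta>"
  shows "\<exists>D. is_partition s t D \<and> mesh_less \<delta> D"
proof (cases "s = t")
  case True
  then show ?thesis by (intro exI[of _ "[s]"]) simp
next
  case False
  obtain N :: nat where N: "(t - s) / \<delta> < real N" using reals_Archimedean2 by blast
  with assms False have "0 < N" by (metis diff_ge_0_iff_ge divide_nonneg_pos not_gr_zero not_le of_nat_0)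
  define D where "D = map (\<lambda>i. s + real i * ((t - s) / real N)) [0..<Suc N]"
  have "sorted_wrt (<) D"
    using assms False \<open>0 < N\<close>
    by (auto simp: D_def sorted_wrt_iff_nth_less divide_strict_right_mono simp del: upt_Suc)
  moreover have "hd D = s" by (simp add: D_def hd_map del: upt_Suc)
  moreover have "last D = t" using \<open>0 < N\<close> by (simp add: D_def)
  ultimately have "is_partition s t D" by (auto simp: is_partition_def D_def)
  moreover have "(t - s) / real N < \<delta>" using N assms \<open>0 < N\<close> by (simp add: field_simps)
  then have "mesh_less \<delta> D"
    by (auto simp: D_def mesh_less_def distrib_right simp del: upt_Suc times_divide_eq_right)
  ultimately show ?thesis by blast
qed

lemma eventually_mesh_to_0:
  "eventually P (mesh_to_0 s t) \<longleftrightarrow> (\<exists>\<delta>>0. \<forall>D. is_partition s t D \<and> mesh_less \<delta> D \<longrightarrow> P D)"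
proof -
  have "eventually P (mesh_to_0 s t) \<longleftrightarrow>
      (\<exists>\<delta>\<in>{0<..}. eventually P (principal {D. is_partition s t D \<and> mesh_less \<delta> D}))"
    unfolding mesh_to_0_def mesh_less_def[symmetric]
  proof (rule eventually_INF_base)
    fix a b :: real assume "a \<in> {0<..}" "b \<in> {0<..}"
    then show "\<exists>x\<in>{0<..}. principal {D. is_partition s t D \<and> mesh_less x D}
        \<le> inf (principal {D. is_partition s t D \<and> mesh_less a D})
              (principal {D. is_partition s t D \<and> mesh_less b D})"
      by (intro bexI[of _ "min a b"]) (auto intro: mesh_less_mono)
  qed auto
  then show ?thesis by (auto simp: eventually_principal)
qed

lemma mesh_to_0_neq_bot: "s \<le> t \<Longrightarrow> mesh_to_0 s t \<noteq> bot"
  using fine_partition_exists unfolding trivial_limit_def eventually_mesh_to_0 by blast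

lemma partition_straddle:
  assumes "is_partition s t D" "s \<le> x" "x \<le> t" "s < t"
  obtains A u v B where "D = A @ u # v # B" "u \<le> x" "x \<le> v"
proof -
  have "s \<le> x \<Longrightarrow> s < t \<Longrightarrow> \<exists>A u v B. D = A @ u # v # B \<and> u \<le> x \<and> x \<le> v"
    using assms(1)
  proof (induction rule: is_partition_induct)
    case (step s y r)
    show ?case
    proof (cases "x \<le> y")
      case True
      then show ?thesis using step.prems by (intro exI[of _ "[]"]) auto
    next
      case False
      then have "y \<le> x" "y < t" using assms(3) by auto
      from step.IH[OF this] obtain A u v B where "y # r = A @ u # v # B" "u \<le> x" "x \<le> v" by blast
      then show ?thesis by (intro exI[of _ "s # A"]) auto
    qed
  qed simp
  with assms that show thesis by blast
qed


section \<open>The control of a path of finite variation\<close>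

text \<open>\<open>V s t\<close> enters only as the least upper bound of the partition sums of
  \<open>N\<close>. The regularity argument is thereby independent of extended reals and of the
  group; in the application \<open>N\<close> is the \<open>p\<close>-th power of the norm of an
  increment.\<close>

locale variation =
  fixes N V :: "real \<Rightarrow> real \<Rightarrow> real" and T :: real
  assumes N_nonneg: "0 \<le> N s t"
    and N_refl: "\<lbrakk>0 \<le> s; s \<le> T\<rbrakk> \<Longrightarrow> N s s = 0"
    and continuous_N: "continuous_on ({0..T} \<times> {0..T}) (\<lambda>(u, v). N u v)"
    and V_upper: "\<lbrakk>0 \<le> s; t \<le> T; is_partition s t D\<rbrakk> \<Longrightarrow> partition_sum N D \<le> V s t"
    and V_least: "\<lbrakk>0 \<le> s; s \<le> t; t \<le> T; \<And>D. is_partition s t D \<Longrightarrow> partition_sum N D \<le> c\<rbrakk> \<Longrightarrow> V s t \<le> c"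
begin

lemma V_nonneg: "\<lbrakk>0 \<le> s; s \<le> t; t \<le> T\<rbrakk> \<Longrightarrow> 0 \<le> V s t"
  using V_upper[of s t "[s]"] V_upper[of s t "[s, t]"] N_nonneg[of s t] by (cases "s = t") auto

lemma V_refl: "\<lbrakk>0 \<le> s; s \<le> T\<rbrakk> \<Longrightarrow> V s s = 0"
  by (rule antisym) (auto intro!: V_least V_nonneg simp: is_partition_refl_iff)

lemma N_le_V: "\<lbrakk>0 \<le> s; s \<le> t; t \<le> T\<rbrakk> \<Longrightarrow> N s t \<le> V s t"
  using V_upper[of s t "[s, t]"] N_refl[of s] V_refl[of s] by (cases "s = t") auto

text \<open>Partitions of \<open>[s, u]\<close> and \<open>[u, t]\<close> concatenate to one of
  \<open>[s, t]\<close>. The supremum is taken over the right partition with the left one fixed, and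
  then over the left one.\<close>

lemma V_superadd:
  assumes "0 \<le> s" "s \<le> u" "u \<le> t" "t \<le> T"
  shows "V s u + V u t \<le> V s t"
proof -
  have "V u t \<le> V s t - partition_sum N D" if D: "is_partition s u D" for D
  proof (rule V_least)
    fix E assume E: "is_partition u t E"
    obtain A where A: "D = A @ [u]" using D by (metis append_butlast_last_id is_partition_def)
    obtain B where B: "E = u # B" using E by (metis hd_Cons_tl is_partition_def)
    have "is_partition s t (A @ u # B)" using D E A B is_partition_append_iff[of s t A u B] by simp
    then have "partition_sum N (A @ u # B) \<le> V s t" using V_upper assms by simp
    then show "partition_sum N E \<le> V s t - partition_sum N D"
      using A B partition_sum_append[of N A u B] by simp
  qed (use assms in auto)
  then have "partition_sum N D \<le> V s t - V u t" if "is_partition s u D" for D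
    using that by (simp add: algebra_simps)
  then have "V s u \<le> V s t - V u t" using assms by (intro V_least) auto
  then show ?thesis by simp
qed

lemma V_mono:
  assumes "0 \<le> s" "s \<le> u" "u \<le> v" "v \<le> t" "t \<le> T"
  shows "V u v \<le> V s t"
  using V_superadd[of s u t] V_superadd[of u v t] V_nonneg[of s u] V_nonneg[of v t] assms by auto

lemma V_approx:
  assumes "0 \<le> s" "s \<le> t" "t \<le> T" "0 < \<epsilon>"
  obtains D where "is_partition s t D" "V s t - \<epsilon> < partition_sum N D"
proof -
  have "V s t \<le> V s t - \<epsilon>" if "\<And>D. is_partition s t D \<Longrightarrow> partition_sum N D \<le> V s t - \<epsilon>"
    using assms(1-3) that by (rule V_least)
  then show thesis using that \<open>0 < \<epsilon>\<close> by fastforce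
qed

text \<open>If \<open>V x t \<ge> \<epsilon>\<close> for all \<open>t > x\<close>, moving the first point of a nearly optimal partition of
  \<open>[x, t]\<close> slightly to the right shows that \<open>V\<close> violates superadditivity.\<close>

lemma V_small_right:
  assumes x: "0 \<le> x" "x \<le> T" and "0 < \<epsilon>"
  shows "\<exists>r>0. \<forall>t. x \<le> t \<and> t < x + r \<and> t \<le> T \<longrightarrow> V x t < \<epsilon>"
proof (rule ccontr)
  assume "\<not> ?thesis"
  then have neg: "\<And>r. 0 < r \<Longrightarrow> \<exists>t. x \<le> t \<and> t < x + r \<and> t \<le> T \<and> \<epsilon> \<le> V x t" by (meson not_less)
  have big: "\<epsilon> \<le> V x t" if t: "x < t" "t \<le> T" for t
  proof -
    obtain v where "x \<le> v" "v < t" "\<epsilon> \<le> V x v" using neg[of "t - x"] t by auto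
    then show ?thesis using V_mono[of x x v t] t x by simp
  qed
  obtain v where "x \<le> v" "v \<le> T" "\<epsilon> \<le> V x v" using neg[of 1] by auto
  then have "x < T" using x V_refl[of x] \<open>0 < \<epsilon>\<close> by (cases "x = v") auto
  obtain D where D: "is_partition x T D" "V x T - \<epsilon> / 2 < partition_sum N D"
    using V_approx[of x T "\<epsilon> / 2"] x \<open>0 < \<epsilon>\<close> by auto
  obtain y r where y: "D = x # y # r" "x < y" "is_partition y T (y # r)"
  proof -
    obtain E where "D = x # E" using D(1) by (metis hd_Cons_tl is_partition_def)
    with D(1) \<open>x < T\<close> that show thesis by (cases E) auto
  qed
  have "y \<le> T" using is_partition_le[OF y(3)] .
  have "(\<lambda>u. (u, y)) ` {0..T} \<subseteq> {0..T} \<times> {0..T}" using y(2) x \<open>y \<le> T\<close> by auto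
  from continuous_on_compose2[OF continuous_N _ this] have "continuous_on {0..T} (\<lambda>u. N u y)"
    by (simp add: continuous_on_Pair)
  then obtain \<delta> where \<delta>: "0 < \<delta>" "\<And>u. \<lbrakk>u \<in> {0..T}; dist u x < \<delta>\<rbrakk> \<Longrightarrow> dist (N u y) (N x y) < \<epsilon> / 2"
    using x half_gt_zero[OF \<open>0 < \<epsilon>\<close>] unfolding continuous_on_iff by (meson atLeastAtMost_iff)
  \<comment> \<open>The point replaces \<open>x\<close> in front of \<open>y\<close>. The shortened
    partition of \<open>[u, T]\<close> loses less than \<epsilon>/2 against \<open>D\<close>, which
    itself loses less than \<epsilon>/2 against \<open>V x T\<close>; since \<open>V x u\<close> is
    at least \<epsilon>, \<open>V x u + V u T\<close> exceeds \<open>V x T\<close>.\<close>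
  define u where "u = min (x + \<delta> / 2) ((x + y) / 2)"
  have u: "x < u" "u < y" "dist u x < \<delta>" using y(2) \<delta>(1) by (auto simp: u_def dist_real_def min_def)
  then have "\<bar>N u y - N x y\<bar> < \<epsilon> / 2"
    using \<delta>(2)[of u] x \<open>y \<le> T\<close> by (simp add: dist_real_def)
  then have "N x y - \<epsilon> / 2 < N u y" by linarith
  moreover have "partition_sum N (u # y # r) \<le> V u T" using V_upper[of u T "u # y # r"] u x y by simp
  moreover have "\<epsilon> \<le> V x u" using big u \<open>y \<le> T\<close> by simp
  moreover have "V x u + V u T \<le> V x T" using V_superadd u x \<open>y \<le> T\<close> by simp
  ultimately show False using D(2) y(1) by simp
qed

text \<open>Mirror image of \<open>V_small_right\<close>: the last point of a nearly optimal
  partition of \<open>[0, x]\<close> is moved slightly to the left.\<close>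

lemma V_small_left:
  assumes x: "0 \<le> x" "x \<le> T" and "0 < \<epsilon>"
  shows "\<exists>r>0. \<forall>s. s \<le> x \<and> x - r < s \<and> 0 \<le> s \<longrightarrow> V s x < \<epsilon>"
proof (rule ccontr)
  assume "\<not> ?thesis"
  then have neg: "\<And>r. 0 < r \<Longrightarrow> \<exists>s. s \<le> x \<and> x - r < s \<and> 0 \<le> s \<and> \<epsilon> \<le> V s x" by (meson not_less)
  have big: "\<epsilon> \<le> V s x" if s: "s < x" "0 \<le> s" for s
  proof -
    obtain v where "v \<le> x" "s < v" "\<epsilon> \<le> V v x" using neg[of "x - s"] s by auto
    then show ?thesis using V_mono[of s v x x] s x by simp
  qed
  obtain v where "v \<le> x" "0 \<le> v" "\<epsilon> \<le> V v x" using neg[of 1] by auto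
  then have "0 < x" using x V_refl[of x] \<open>0 < \<epsilon>\<close> by (cases "x = v") auto
  obtain D where D: "is_partition 0 x D" "V 0 x - \<epsilon> / 2 < partition_sum N D"
    using V_approx[of 0 x "\<epsilon> / 2"] x \<open>0 < \<epsilon>\<close> by auto
  obtain A where A: "D = A @ [x]" using D(1) by (metis append_butlast_last_id is_partition_def)
  with D(1) \<open>0 < x\<close> have "A \<noteq> []" by auto
  then obtain B y where B: "A = B @ [y]" by (metis append_butlast_last_id)
  have y: "is_partition 0 y (B @ [y])" "y < x"
    using D(1) is_partition_append_iff[of 0 x B y "[x]"] by (auto simp: A B)
  have "0 \<le> y" using is_partition_le[OF y(1)] .
  have "(\<lambda>v. (y, v)) ` {0..T} \<subseteq> {0..T} \<times> {0..T}" using y(2) x \<open>0 \<le> y\<close> by auto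
  from continuous_on_compose2[OF continuous_N _ this] have "continuous_on {0..T} (\<lambda>v. N y v)"
    by (simp add: continuous_on_Pair)
  then obtain \<delta> where \<delta>: "0 < \<delta>" "\<And>v. \<lbrakk>v \<in> {0..T}; dist v x < \<delta>\<rbrakk> \<Longrightarrow> dist (N y v) (N y x) < \<epsilon> / 2"
    using x half_gt_zero[OF \<open>0 < \<epsilon>\<close>] unfolding continuous_on_iff by (meson atLeastAtMost_iff)
  define u where "u = max (x - \<delta> / 2) ((x + y) / 2)"
  have u: "u < x" "y < u" "dist u x < \<delta>" using y(2) \<delta>(1) by (auto simp: u_def dist_real_def max_def field_simps)
  then have "\<bar>N y u - N y x\<bar> < \<epsilon> / 2"
    using \<delta>(2)[of u] x \<open>0 \<le> y\<close> by (simp add: dist_real_def)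
  then have "N y x - \<epsilon> / 2 < N y u" by linarith
  moreover have "partition_sum N (B @ [y, u]) \<le> V 0 u"
    using V_upper[of 0 u "B @ [y, u]"] u x y is_partition_append_iff[of 0 u B y "[u]"] by simp
  moreover have "\<epsilon> \<le> V u x" using big u \<open>0 \<le> y\<close> by simp
  moreover have "V 0 u + V u x \<le> V 0 x" using V_superadd u x \<open>0 \<le> y\<close> by simp
  ultimately show False
    using D(2) partition_sum_append[of N B y "[x]"] partition_sum_append[of N B y "[u]"]
    by (simp add: A B)
qed

text \<open>Superadditivity bounds \<open>V s t\<close> from below by the two sides of
  \<open>x\<close>, and an upper bound is wanted. What is missing is the one interval of a partition
  that straddles \<open>x\<close>, and its \<open>N\<close> is small because \<open>N\<close> is
  continuous and vanishes at \<open>(x, x)\<close>.\<close>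

lemma V_small_local:
  assumes x: "0 \<le> x" "x \<le> T" and "0 < \<epsilon>"
  shows "\<exists>r>0. \<forall>s t. x - r < s \<and> s \<le> t \<and> t < x + r \<and> 0 \<le> s \<and> t \<le> T \<longrightarrow> V s t < \<epsilon>"
proof -
  obtain r1 where r1: "0 < r1" "\<And>t. \<lbrakk>x \<le> t; t < x + r1; t \<le> T\<rbrakk> \<Longrightarrow> V x t < \<epsilon> / 3"
    using V_small_right[of x "\<epsilon> / 3"] x \<open>0 < \<epsilon>\<close> by auto
  obtain r2 where r2: "0 < r2" "\<And>s. \<lbrakk>s \<le> x; x - r2 < s; 0 \<le> s\<rbrakk> \<Longrightarrow> V s x < \<epsilon> / 3"
    using V_small_left[of x "\<epsilon> / 3"] x \<open>0 < \<epsilon>\<close> by auto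
  have "(x, x) \<in> {0..T} \<times> {0..T}" using x by simp
  from continuous_N[unfolded continuous_on_iff, rule_format, OF this, of "\<epsilon> / 3"]
  obtain r3 where r3: "0 < r3"
    "\<And>z. \<lbrakk>z \<in> {0..T} \<times> {0..T}; dist z (x, x) < r3\<rbrakk> \<Longrightarrow> \<bar>N (fst z) (snd z) - N x x\<bar> < \<epsilon> / 3"
    using \<open>0 < \<epsilon>\<close> by (auto simp: dist_real_def case_prod_beta)
  have N_small: "N u v < \<epsilon> / 3" if "u \<in> {0..T}" "v \<in> {0..T}" "\<bar>u - x\<bar> < r3 / 2" "\<bar>v - x\<bar> < r3 / 2" for u v
  proof -
    have "dist (u, v) (x, x) \<le> \<bar>u - x\<bar> + \<bar>v - x\<bar>"
      using sqrt_sum_squares_le_sum_abs[of "u - x" "v - x"] by (simp add: dist_prod_def dist_real_def)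
    then have "dist (u, v) (x, x) < r3" using that by simp
    then show ?thesis using r3(2)[of "(u, v)"] that(1,2) N_refl[OF x] N_nonneg[of u v] by simp
  qed
  define r where "r = min (min r1 r2) (r3 / 2)"
  have r: "r \<le> r1" "r \<le> r2" "r \<le> r3 / 2" by (simp_all add: r_def)
  have "V s t < \<epsilon>" if st: "x - r < s" "s \<le> t" "t < x + r" "0 \<le> s" "t \<le> T" for s t
  proof -
    consider "t \<le> x" | "x \<le> s" | "s < x" "x < t" by linarith
    then show ?thesis
    proof cases
      case 1
      then have "V s t \<le> V s x" using V_mono[of s s t x] st x by simp
      then show ?thesis using r2(2)[of s] 1 st r \<open>0 < \<epsilon>\<close> by linarith
    next
      case 2
      then have "V s t \<le> V x t" using V_mono[of x s t t] st x by simp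
      then show ?thesis using r1(2)[of t] 2 st r \<open>0 < \<epsilon>\<close> by linarith
    next
      case 3
      have "V s t \<le> V s x + \<epsilon> / 3 + V x t"
      proof (rule V_least)
        fix D assume D: "is_partition s t D"
        obtain A u v B where uv: "D = A @ u # v # B" "u \<le> x" "x \<le> v"
          using partition_straddle[OF D, of x] 3 by (metis less_imp_le less_trans)
        have P: "is_partition s u (A @ [u])" "u < v" "is_partition v t (v # B)"
          using D is_partition_append_iff[of s t A u "v # B"] uv(1) by auto
        have "s \<le> u" "v \<le> t" using P is_partition_le by auto
        have "partition_sum N (A @ [u]) \<le> V s x"
          using V_upper[OF _ _ P(1)] V_mono[of s s u x] uv(2) st x \<open>s \<le> u\<close> by simp
        moreover have "partition_sum N (v # B) \<le> V x t"
          using V_upper[OF _ _ P(3)] V_mono[of x v t t] uv(3) st x \<open>v \<le> t\<close> by simp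
        moreover have "N u v < \<epsilon> / 3"
          by (rule N_small) (use \<open>s \<le> u\<close> \<open>v \<le> t\<close> uv(2,3) st x r in \<open>auto simp: abs_less_iff\<close>)
        ultimately show "partition_sum N D \<le> V s x + \<epsilon> / 3 + V x t"
          using partition_sum_append[of N A u "v # B"] uv(1) by simp
      qed (use st in auto)
      moreover have "V s x < \<epsilon> / 3" "V x t < \<epsilon> / 3" using r1(2)[of t] r2(2)[of s] 3 st r by auto
      ultimately show ?thesis by simp
    qed
  qed
  moreover have "0 < r" using r1(1) r2(1) r3(1) by (simp add: r_def)
  ultimately show ?thesis by blast
qed

text \<open>A Lebesgue number of the cover by the intervals of \<open>V_small_local\<close> makes
  the local smallness uniform.\<close>

lemma V_small:
  assumes "0 < \<epsilon>"
  shows "\<exists>\<delta>>0. \<forall>s t. 0 \<le> s \<and> s \<le> t \<and> t \<le> T \<and> t - s < \<delta> \<longrightarrow> V s t < \<epsilon>"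
proof -
  have "\<forall>x\<in>{0..T}. \<exists>r>0. \<forall>s t. x - r < s \<and> s \<le> t \<and> t < x + r \<and> 0 \<le> s \<and> t \<le> T \<longrightarrow> V s t < \<epsilon>"
    using V_small_local[OF _ _ assms] by simp
  from bchoice[OF this] obtain r where r: "\<And>x. x \<in> {0..T} \<Longrightarrow> 0 < r x"
    "\<And>x s t. \<lbrakk>x \<in> {0..T}; x - r x < s; s \<le> t; t < x + r x; 0 \<le> s; t \<le> T\<rbrakk> \<Longrightarrow> V s t < \<epsilon>"
    by blast
  let ?B = "(\<lambda>x. ball x (r x)) ` {0..T}"
  have cover: "{0..T} \<subseteq> \<Union> ?B"
  proof
    fix x assume "x \<in> {0..T}"
    moreover from this have "x \<in> ball x (r x)" using r(1) by simp
    ultimately show "x \<in> \<Union> ?B" by blast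
  qed
  have "open G" if "G \<in> ?B" for G using that by auto
  from Heine_Borel_lemma[OF compact_Icc cover this] obtain \<delta> where \<delta>: "0 < \<delta>"
    "\<And>x. x \<in> {0..T} \<Longrightarrow> \<exists>B\<in>?B. ball x \<delta> \<subseteq> B"
    by blast
  have "V s t < \<epsilon>" if st: "0 \<le> s" "s \<le> t" "t \<le> T" "t - s < \<delta>" for s t
  proof -
    obtain x where x: "x \<in> {0..T}" "ball s \<delta> \<subseteq> ball x (r x)" using \<delta>(2)[of s] st by auto
    have "s \<in> ball s \<delta>" "t \<in> ball s \<delta>" using st \<delta>(1) by (auto simp: dist_real_def)
    then have "s \<in> ball x (r x)" "t \<in> ball x (r x)" using x(2) by blast+
    then show ?thesis using r(2)[OF x(1), of s t] st by (auto simp: dist_real_def abs_less_iff)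
  qed
  with \<delta>(1) show ?thesis by blast
qed

end

section \<open>Sewing\<close>

locale sewing =
  fixes \<Xi> \<omega> :: "real \<Rightarrow> real \<Rightarrow> real" and T M \<theta> :: real
  assumes \<omega>_nonneg: "\<lbrakk>0 \<le> s; s \<le> t; t \<le> T\<rbrakk> \<Longrightarrow> 0 \<le> \<omega> s t"
    and \<omega>_superadd: "\<lbrakk>0 \<le> s; s \<le> u; u \<le> t; t \<le> T\<rbrakk> \<Longrightarrow> \<omega> s u + \<omega> u t \<le> \<omega> s t"
    and \<omega>_small: "0 < \<epsilon> \<Longrightarrow> \<exists>\<delta>>0. \<forall>s t. 0 \<le> s \<and> s \<le> t \<and> t \<le> T \<and> t - s < \<delta> \<longrightarrow> \<omega> s t < \<epsilon>"
    and \<Xi>_refl: "\<lbrakk>0 \<le> s; s \<le> T\<rbrakk> \<Longrightarrow> \<Xi> s s = 0"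
    and \<Xi>_defect: "\<lbrakk>0 \<le> s; s \<le> u; u \<le> t; t \<le> T\<rbrakk> \<Longrightarrow>
      \<bar>\<Xi> s t - \<Xi> s u - \<Xi> u t\<bar> \<le> M * \<omega> s t powr \<theta>"
    and \<theta>_gt_1: "1 < \<theta>" and M_nonneg: "0 \<le> M"
begin

text \<open>The constant solves \<open>K = 2\<^sup>1\<^sup>-\<^sup>\<theta> K + 2 M\<close>: cutting a partition where the control reaches
  half of its total leaves two shorter partitions and costs two defects.\<close>

definition K :: real where
  "K = 2 * M / (1 - 2 powr (1 - \<theta>))"

lemma two_powr_less_1: "2 powr (1 - \<theta>) < (1 :: real)"
  using \<theta>_gt_1 by (simp add: powr_less_one)

lemma K_eq: "K = 2 powr (1 - \<theta>) * K + 2 * M"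
proof -
  have "1 - 2 powr (1 - \<theta>) \<noteq> 0" using two_powr_less_1 by linarith
  then have "(1 - 2 powr (1 - \<theta>)) * K = 2 * M" unfolding K_def by (metis nonzero_eq_divide_eq mult.commute)
  then show ?thesis by (simp add: algebra_simps)
qed

lemma K_nonneg: "0 \<le> K"
  using two_powr_less_1 M_nonneg by (simp add: K_def)

lemma \<omega>_refl: "\<lbrakk>0 \<le> s; s \<le> T\<rbrakk> \<Longrightarrow> \<omega> s s = 0"
  using \<omega>_superadd[of s s s] \<omega>_nonneg[of s s] by simp

lemma \<omega>_mono:
  assumes "0 \<le> s" "s \<le> u" "u \<le> v" "v \<le> t" "t \<le> T"
  shows "\<omega> u v \<le> \<omega> s t"
  using \<omega>_superadd[of s u t] \<omega>_superadd[of u v t] \<omega>_nonneg[of s u] \<omega>_nonneg[of v t] assms by auto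

text \<open>\<open>u\<close> is the last partition point before \<open>t\<close> whose control from
  \<open>s\<close> is at most half of the total. For the next point \<open>v\<close> this fails, so
  superadditivity leaves at most half for \<open>[v, t]\<close>; or else \<open>v = t\<close> and
  nothing is left.\<close>

lemma split_at_half:
  assumes "is_partition s t D" "0 \<le> s" "t \<le> T" "s < t"
  obtains A u v B where "D = A @ u # v # B" "\<omega> s u \<le> \<omega> s t / 2" "\<omega> v t \<le> \<omega> s t / 2"
proof -
  have "\<lbrakk>s \<le> x; x < t; \<omega> s x \<le> \<omega> s t / 2\<rbrakk> \<Longrightarrow>
      \<exists>A u v B. E = A @ u # v # B \<and> \<omega> s u \<le> \<omega> s t / 2 \<and> \<omega> v t \<le> \<omega> s t / 2"
    if "is_partition x t E" for x E
    using that
  proof (induction rule: is_partition_induct)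
    case (step x y r)
    have "y \<le> t" using is_partition_le[OF step(2)] .
    show ?case
    proof (cases "\<omega> s y \<le> \<omega> s t / 2 \<and> y \<noteq> t")
      case True
      then obtain A u v B where "y # r = A @ u # v # B" "\<omega> s u \<le> \<omega> s t / 2" "\<omega> v t \<le> \<omega> s t / 2"
        using step.IH step.hyps step.prems \<open>y \<le> t\<close> by auto
      then show ?thesis by (intro exI[of _ "x # A"]) auto
    next
      case False
      have "\<omega> y t \<le> \<omega> s t / 2"
      proof (cases "y = t")
        case True
        then show ?thesis using \<omega>_refl[of t] \<omega>_nonneg[of s t] assms by simp
      next
        case False
        then show ?thesis
          using \<open>\<not> (\<omega> s y \<le> \<omega> s t / 2 \<and> y \<noteq> t)\<close> \<omega>_superadd[of s y t] \<open>y \<le> t\<close> step assms by simp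
      qed
      then show ?thesis using step.prems by (intro exI[of _ "[]"]) auto
    qed
  qed simp
  from this[OF assms(1)] show thesis
    using that assms \<omega>_refl[of s] \<omega>_nonneg[of s t] by force
qed

lemma partition_sum_near:
  assumes "is_partition s t D" "0 \<le> s" "t \<le> T"
  shows "\<bar>partition_sum \<Xi> D - \<Xi> s t\<bar> \<le> K * \<omega> s t powr \<theta>"
  using assms
proof (induction "length D" arbitrary: s t D rule: less_induct)
  case less
  have "s \<le> t" using is_partition_le less.prems by blast
  show ?case
  proof (cases "s = t")
    case True
    then show ?thesis using less.prems K_nonneg by (simp add: is_partition_refl_iff \<Xi>_refl)
  next
    case False
    with \<open>s \<le> t\<close> have "s < t" by simp
    then obtain A u v B where D: "D = A @ u # v # B"
      and half: "\<omega> s u \<le> \<omega> s t / 2" "\<omega> v t \<le> \<omega> s t / 2"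
      by (rule split_at_half[OF less.prems])
    have P: "is_partition s u (A @ [u])" "u < v" "is_partition v t (v # B)"
      using less.prems(1) is_partition_append_iff[of s t A u "v # B"] D by auto
    have le: "s \<le> u" "v \<le> t" using P is_partition_le by auto
    have pow: "x powr \<theta> \<le> 2 powr (- \<theta>) * \<omega> s t powr \<theta>" if "0 \<le> x" "x \<le> \<omega> s t / 2" for x
    proof -
      have "x powr \<theta> \<le> (\<omega> s t / 2) powr \<theta>" using that \<theta>_gt_1 by (intro powr_mono2) auto
      also have "\<dots> = 2 powr (- \<theta>) * \<omega> s t powr \<theta>"
        using \<omega>_nonneg[of s t] less.prems \<open>s \<le> t\<close> by (simp add: powr_divide powr_minus_divide)
      finally show ?thesis .
    qed
    have "\<bar>partition_sum \<Xi> (A @ [u]) - \<Xi> s u\<bar> \<le> K * (2 powr (- \<theta>) * \<omega> s t powr \<theta>)"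
      using order_trans[OF less.hyps[of "A @ [u]" s u] mult_left_mono[OF pow[OF _ half(1)] K_nonneg]]
        P(1) less.prems le P(2) \<omega>_nonneg[of s u] by (simp add: D)
    moreover have "\<bar>partition_sum \<Xi> (v # B) - \<Xi> v t\<bar> \<le> K * (2 powr (- \<theta>) * \<omega> s t powr \<theta>)"
      using order_trans[OF less.hyps[of "v # B" v t] mult_left_mono[OF pow[OF _ half(2)] K_nonneg]]
        P(3) less.prems le P(2) \<omega>_nonneg[of v t] by (simp add: D)
    moreover have "\<bar>\<Xi> s t - \<Xi> s u - \<Xi> u t\<bar> \<le> M * \<omega> s t powr \<theta>"
      using \<Xi>_defect less.prems le P(2) by simp
    moreover have "\<bar>\<Xi> u t - \<Xi> u v - \<Xi> v t\<bar> \<le> M * \<omega> s t powr \<theta>"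
    proof -
      have "\<omega> u t powr \<theta> \<le> \<omega> s t powr \<theta>"
        using \<omega>_mono[of s u t t] \<omega>_nonneg[of u t] less.prems le P(2) \<theta>_gt_1 by (intro powr_mono2) auto
      from order_trans[OF \<Xi>_defect[of u v t] mult_left_mono[OF this M_nonneg]] show ?thesis
        using less.prems le P(2) by simp
    qed
    moreover have "partition_sum \<Xi> D = partition_sum \<Xi> (A @ [u]) + \<Xi> u v + partition_sum \<Xi> (v # B)"
      using partition_sum_append[of \<Xi> A u "v # B"] by (simp add: D)
    \<comment> \<open>Two shorter partitions, each carrying at most half of the control, and two
      defects: \<open>[s, t]\<close> is cut at \<open>u\<close> and then \<open>[u, t]\<close> at
      \<open>v\<close>.\<close>
    ultimately have "\<bar>partition_sum \<Xi> D - \<Xi> s t\<bar> \<le>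
        2 * (K * (2 powr (- \<theta>) * \<omega> s t powr \<theta>)) + 2 * (M * \<omega> s t powr \<theta>)"
      by linarith
    also have "\<dots> = (2 powr (1 - \<theta>) * K + 2 * M) * \<omega> s t powr \<theta>"
      using powr_add[of 2 1 "- \<theta>"] by (simp add: algebra_simps)
    finally show ?thesis by (simp only: K_eq[symmetric])
  qed
qed

text \<open>The points of \<open>D\<close> divide \<open>E\<close> into partitions of the intervals
  of \<open>D\<close>, and \<open>partition_sum_near\<close> applies to each of them, with a bound
  that does not see how many points were added.\<close>

lemma partition_sum_refine:
  assumes "is_partition s t D" "is_partition s t E" "set D \<subseteq> set E" "0 \<le> s" "t \<le> T"
  shows "\<bar>partition_sum \<Xi> E - partition_sum \<Xi> D\<bar> \<le> K * partition_sum (\<lambda>u v. \<omega> u v powr \<theta>) D"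
  using assms
proof (induction arbitrary: E rule: is_partition_induct)
  case single
  then show ?case by (simp add: is_partition_refl_iff)
next
  case (step s y r)
  obtain A B where E: "E = A @ y # B" using step.prems(2) by (auto dest!: split_list)
  have P: "is_partition s y (A @ [y])" "is_partition y t (y # B)"
    using step.prems(1) is_partition_append_iff[of s t A y B] E by auto
  have "set (y # r) \<subseteq> set (y # B)"
  proof
    fix z assume z: "z \<in> set (y # r)"
    then have "y \<le> z" using is_partition_subset[OF step.hyps(2)] by auto
    moreover have "a < y" if "a \<in> set A" for a
      using P(1) that by (auto simp: is_partition_def sorted_wrt_append)
    moreover have "z \<in> set A \<union> set (y # B)" using z step.prems(2) E by auto
    ultimately show "z \<in> set (y # B)" by force
  qed
  then have "\<bar>partition_sum \<Xi> (y # B) - partition_sum \<Xi> (y # r)\<bar> \<le> K * partition_sum (\<lambda>u v. \<omega> u v powr \<theta>) (y # r)"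
    using step P by auto
  moreover have "\<bar>partition_sum \<Xi> (A @ [y]) - \<Xi> s y\<bar> \<le> K * \<omega> s y powr \<theta>"
    using partition_sum_near[OF P(1)] step.prems is_partition_le[OF step.hyps(2)] by simp
  ultimately show ?case
    using partition_sum_append[of \<Xi> A y B] by (simp add: E ring_distribs)
qed

text \<open>Of the exponent \<theta>, the part \<theta> - 1 > 0 is spent on the smallness over short
  intervals, and the remaining first power is summed by superadditivity.\<close>

lemma partition_sum_powr_le:
  assumes "is_partition s t D" "0 \<le> s" "t \<le> T" "mesh_less \<delta> D"
    and "\<And>s t. \<lbrakk>0 \<le> s; s \<le> t; t \<le> T; t - s < \<delta>\<rbrakk> \<Longrightarrow> \<omega> s t \<le> \<eta>"
  shows "partition_sum (\<lambda>u v. \<omega> u v powr \<theta>) D \<le> \<eta> powr (\<theta> - 1) * \<omega> s t"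
  using assms(1-4)
proof (induction rule: is_partition_induct)
  case single
  then show ?case by (simp add: \<omega>_refl)
next
  case (step s y r)
  have "y \<le> t" using is_partition_le[OF step.hyps(2)] .
  have \<omega>: "0 \<le> \<omega> s y" "\<omega> s y \<le> \<eta>" using step assms(5) \<omega>_nonneg \<open>y \<le> t\<close> by auto
  have "\<omega> s y powr \<theta> = \<omega> s y powr (\<theta> - 1) * \<omega> s y"
    using \<omega>(1) powr_add[of "\<omega> s y" "\<theta> - 1" 1] by simp
  also have "\<dots> \<le> \<eta> powr (\<theta> - 1) * \<omega> s y"
    using \<omega> \<theta>_gt_1 by (intro mult_right_mono powr_mono2) auto
  finally have "partition_sum (\<lambda>u v. \<omega> u v powr \<theta>) (s # y # r) \<le> \<eta> powr (\<theta> - 1) * (\<omega> s y + \<omega> y t)"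
    using step by (simp add: ring_distribs)
  also have "\<dots> \<le> \<eta> powr (\<theta> - 1) * \<omega> s t"
    using \<omega>_superadd[of s y t] step \<open>y \<le> t\<close> by (intro mult_left_mono) auto
  finally show ?case .
qed

section \<open>Convergence of the partition sums and increments of the limit\<close>

lemma partition_sum_cauchy:
  assumes "0 \<le> t" "t \<le> T" "0 < \<epsilon>"
  shows "\<exists>\<delta>>0. \<forall>D E. is_partition 0 t D \<and> mesh_less \<delta> D \<and> is_partition 0 t E \<and> mesh_less \<delta> E \<longrightarrow>
    \<bar>partition_sum \<Xi> D - partition_sum \<Xi> E\<bar> < \<epsilon>"
proof -
  \<comment> \<open>Chosen so that \<open>K * \<omega> 0 t * e\<close> is below \<epsilon>/2; the
    added 1 keeps the denominator positive, and \<open>\<eta>\<close> solves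
    \<open>\<eta> powr (\<theta> - 1) = e\<close>.\<close>
  define e where "e = \<epsilon> / (2 * (K * \<omega> 0 t + 1))"
  define \<eta> where "\<eta> = e powr (1 / (\<theta> - 1))"
  have pos: "0 \<le> K * \<omega> 0 t" using K_nonneg \<omega>_nonneg assms by simp
  have "0 < e" using assms pos by (simp add: e_def)
  then have "0 < \<eta>" and \<eta>: "\<eta> powr (\<theta> - 1) = e" using \<theta>_gt_1 by (simp_all add: \<eta>_def powr_powr)
  obtain \<delta> where \<delta>: "0 < \<delta>" "\<And>s t. \<lbrakk>0 \<le> s; s \<le> t; t \<le> T; t - s < \<delta>\<rbrakk> \<Longrightarrow> \<omega> s t < \<eta>"
    using \<omega>_small[OF \<open>0 < \<eta>\<close>] by blast
  have near: "\<bar>partition_sum \<Xi> E - partition_sum \<Xi> D\<bar> < \<epsilon> / 2"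
    if "is_partition 0 t D" "mesh_less \<delta> D" "is_partition 0 t E" "set D \<subseteq> set E" for D E
  proof -
    have "\<bar>partition_sum \<Xi> E - partition_sum \<Xi> D\<bar> \<le> K * (\<eta> powr (\<theta> - 1) * \<omega> 0 t)"
      using assms \<delta>(2) by (intro order_trans[OF partition_sum_refine[OF that(1,3,4)]
            mult_left_mono[OF partition_sum_powr_le[OF that(1) _ _ that(2)] K_nonneg]]) (auto intro: less_imp_le)
    also have "\<dots> = K * \<omega> 0 t * e" by (simp add: \<eta>)
    also have "\<dots> < (K * \<omega> 0 t + 1) * e" using \<open>0 < e\<close> by (simp add: algebra_simps)
    also have "\<dots> = \<epsilon> / 2" using pos by (simp add: e_def field_simps)
    finally show ?thesis .
  qed
  have "\<bar>partition_sum \<Xi> D - partition_sum \<Xi> E\<bar> < \<epsilon>"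
    if D: "is_partition 0 t D" "mesh_less \<delta> D" and E: "is_partition 0 t E" "mesh_less \<delta> E" for D E
  proof -
    \<comment> \<open>Two partitions need not be comparable; each is compared with the common
      refinement, at a cost below \<epsilon>/2.\<close>
    let ?F = "sorted_list_of_set (set D \<union> set E)"
    have "set D \<union> set E \<subseteq> {0..t}"
      using is_partition_subset[OF D(1)] is_partition_subset[OF E(1)] by simp
    moreover have "0 \<in> set D" "t \<in> set D"
      using D(1) hd_in_set[of D] last_in_set[of D] by (simp_all add: is_partition_def)
    ultimately have F: "is_partition 0 t ?F"
      by (intro is_partition_sorted_list_of_set) auto
    have set_F: "set ?F = set D \<union> set E" by simp
    have "\<bar>partition_sum \<Xi> ?F - partition_sum \<Xi> D\<bar> < \<epsilon> / 2"
      using near[OF D F] unfolding set_F by blast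
    moreover have "\<bar>partition_sum \<Xi> ?F - partition_sum \<Xi> E\<bar> < \<epsilon> / 2"
      using near[OF E F] unfolding set_F by blast
    ultimately show ?thesis by linarith
  qed
  with \<delta>(1) show ?thesis by blast
qed

lemma integral_exists:
  assumes "0 \<le> t" "t \<le> T"
  shows "\<exists>I. (partition_sum \<Xi> \<longlongrightarrow> I) (mesh_to_0 0 t)"
proof -
  let ?F = "filtermap (partition_sum \<Xi>) (mesh_to_0 0 t)"
  have "cauchy_filter ?F"
    unfolding cauchy_filter_metric_filtermap
  proof (intro allI impI)
    fix \<epsilon> :: real assume "0 < \<epsilon>"
    then obtain \<delta> where \<delta>: "0 < \<delta>" "\<forall>D E. is_partition 0 t D \<and> mesh_less \<delta> D \<and> is_partition 0 t E \<and> mesh_less \<delta> E \<longrightarrow>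
        \<bar>partition_sum \<Xi> D - partition_sum \<Xi> E\<bar> < \<epsilon>"
      using partition_sum_cauchy assms by blast
    then show "\<exists>P. eventually P (mesh_to_0 0 t) \<and>
        (\<forall>D E. P D \<and> P E \<longrightarrow> dist (partition_sum \<Xi> D) (partition_sum \<Xi> E) < \<epsilon>)"
      by (intro exI[of _ "\<lambda>D. is_partition 0 t D \<and> mesh_less \<delta> D"])
         (auto simp: eventually_mesh_to_0 dist_real_def)
  qed
  moreover have "?F \<noteq> bot" using mesh_to_0_neq_bot assms by (simp add: filtermap_bot_iff)
  ultimately obtain I where "?F \<le> nhds I"
    using complete_uniform[of "UNIV :: real set"] complete_UNIV by auto
  then show ?thesis by (auto simp: filterlim_def)
qed

definition J :: "real \<Rightarrow> real" where
  "J t = Lim (mesh_to_0 0 t) (partition_sum \<Xi>)"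

lemma J_tendsto: "\<lbrakk>0 \<le> t; t \<le> T\<rbrakk> \<Longrightarrow> (partition_sum \<Xi> \<longlongrightarrow> J t) (mesh_to_0 0 t)"
  using integral_exists[of t] tendsto_Lim[OF mesh_to_0_neq_bot[of 0 t]] unfolding J_def by blast

text \<open>Fine partitions of \<open>[0, s]\<close> and \<open>[s, t]\<close> join to a fine
  partition of \<open>[0, t]\<close>. So \<open>J t - J s\<close> is approximated by partition sums
  over \<open>[s, t]\<close>, which satisfy the bound uniformly.\<close>

lemma J_increment:
  assumes st: "0 \<le> s" "s \<le> t" "t \<le> T"
  shows "\<bar>J t - J s - \<Xi> s t\<bar> \<le> K * \<omega> s t powr \<theta>"
proof (rule field_le_epsilon)
  fix \<epsilon> :: real assume "0 < \<epsilon>"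
  have "\<exists>\<delta>>0. \<forall>D. is_partition 0 t D \<and> mesh_less \<delta> D \<longrightarrow> \<bar>partition_sum \<Xi> D - J t\<bar> < \<epsilon> / 2"
    if "0 \<le> t" "t \<le> T" for t
    using tendstoD[OF J_tendsto[OF that], of "\<epsilon> / 2"] \<open>0 < \<epsilon>\<close>
    by (simp add: eventually_mesh_to_0 dist_real_def)
  from this[of s] this[of t] obtain \<delta>1 \<delta>2 where \<delta>: "0 < \<delta>1" "0 < \<delta>2"
    "\<And>D. \<lbrakk>is_partition 0 s D; mesh_less \<delta>1 D\<rbrakk> \<Longrightarrow> \<bar>partition_sum \<Xi> D - J s\<bar> < \<epsilon> / 2"
    "\<And>D. \<lbrakk>is_partition 0 t D; mesh_less \<delta>2 D\<rbrakk> \<Longrightarrow> \<bar>partition_sum \<Xi> D - J t\<bar> < \<epsilon> / 2"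
    using st by auto
  define \<delta> where "\<delta> = min \<delta>1 \<delta>2"
  have "0 < \<delta>" using \<delta> by (simp add: \<delta>_def)
  obtain D where D: "is_partition 0 s D" "mesh_less \<delta> D" using fine_partition_exists st \<open>0 < \<delta>\<close> by blast
  obtain E where E: "is_partition s t E" "mesh_less \<delta> E" using fine_partition_exists st \<open>0 < \<delta>\<close> by blast
  obtain A where A: "D = A @ [s]" using D by (metis append_butlast_last_id is_partition_def)
  obtain B where B: "E = s # B" using E by (metis hd_Cons_tl is_partition_def)
  have "\<bar>partition_sum \<Xi> D - J s\<bar> < \<epsilon> / 2"
    using \<delta>(3)[OF D(1)] mesh_less_mono[OF D(2)] by (simp add: \<delta>_def)
  moreover have "is_partition 0 t (A @ s # B)" "mesh_less \<delta> (A @ s # B)"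
    using D E A B is_partition_append_iff[of 0 t A s B] mesh_less_append_iff[of \<delta> A s B] by auto
  then have "\<bar>partition_sum \<Xi> (A @ s # B) - J t\<bar> < \<epsilon> / 2"
    using \<delta>(4) mesh_less_mono by (simp add: \<delta>_def)
  moreover have "partition_sum \<Xi> (A @ s # B) = partition_sum \<Xi> D + partition_sum \<Xi> E"
    using partition_sum_append[of \<Xi> A s B] A B by simp
  ultimately show "\<bar>J t - J s - \<Xi> s t\<bar> \<le> K * \<omega> s t powr \<theta> + \<epsilon>"
    using partition_sum_near[OF E(1)] st by linarith
qed

lemma J_0: "0 \<le> T \<Longrightarrow> J 0 = 0"
proof -
  assume "0 \<le> T"
  have "eventually (\<lambda>D. partition_sum \<Xi> D = 0) (mesh_to_0 0 0)"
    unfolding eventually_mesh_to_0 by (intro exI[of _ 1]) (auto simp: is_partition_refl_iff)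
  then have "(partition_sum \<Xi> \<longlongrightarrow> 0) (mesh_to_0 0 0)" by (rule tendsto_eventually)
  then show "J 0 = 0"
    unfolding J_def by (rule tendsto_Lim[OF mesh_to_0_neq_bot[OF order_refl]])
qed

end

section \<open>Estimates for coefficients of forms\<close>

text \<open>Quantifying over a representation instead of using \<open>coeffs\<close> makes sums and
  multiples immediate: the representations are added or scaled. The weight \<open>h\<close> is kept
  apart from the constant so that constants add up under a common weight.\<close>

definition bounded_form :: "nat \<Rightarrow> nat \<Rightarrow> (forest \<Rightarrow> real) \<Rightarrow> real \<Rightarrow> form \<Rightarrow> bool" where
  "bounded_form d n h K \<phi> \<longleftrightarrow>
    (\<exists>f. represents d n f \<phi> \<and> (\<forall>\<gamma>\<in>forests_upto d n. \<bar>f \<gamma>\<bar> \<le> K * h \<gamma>))"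

lemma bounded_form_coeffs:
  "\<lbrakk>bounded_form d n h K \<phi>; \<gamma> \<in> forests_upto d n\<rbrakk> \<Longrightarrow> \<bar>coeffs d n \<phi> \<gamma>\<bar> \<le> K * h \<gamma>"
  unfolding bounded_form_def using coeffs_eq by metis

lemma bounded_form_forms: "bounded_form d n h K \<phi> \<Longrightarrow> \<phi> \<in> forms d n"
  by (auto simp: bounded_form_def forms_def)

lemma bounded_formI:
  "\<lbrakk>\<phi> \<in> forms d n; \<And>\<gamma>. \<gamma> \<in> forests_upto d n \<Longrightarrow> \<bar>coeffs d n \<phi> \<gamma>\<bar> \<le> K * h \<gamma>\<rbrakk> \<Longrightarrow>
    bounded_form d n h K \<phi>"
  unfolding bounded_form_def using represents_coeffs by blast

lemma bounded_form_cong: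
  assumes "bounded_form d n h K \<phi>" "\<And>c. c \<in> carrier (char_group d n) \<Longrightarrow> \<psi> c = \<phi> c"
  shows "bounded_form d n h K \<psi>"
  using assms by (auto simp: bounded_form_def represents_def)

lemma bounded_form_add:
  assumes "bounded_form d n h K \<phi>" "bounded_form d n h L \<psi>"
  shows "bounded_form d n h (K + L) (\<lambda>c. \<phi> c + \<psi> c)"
proof -
  obtain f g where "represents d n f \<phi>" "represents d n g \<psi>"
    and bd: "\<And>\<gamma>. \<gamma> \<in> forests_upto d n \<Longrightarrow> \<bar>f \<gamma>\<bar> \<le> K * h \<gamma> \<and> \<bar>g \<gamma>\<bar> \<le> L * h \<gamma>"
    using assms by (auto simp: bounded_form_def)
  then have "represents d n (\<lambda>\<gamma>. f \<gamma> + g \<gamma>) (\<lambda>c. \<phi> c + \<psi> c)"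
    by (simp add: represents_def sum.distrib ring_distribs)
  moreover have "\<bar>f \<gamma> + g \<gamma>\<bar> \<le> (K + L) * h \<gamma>" if "\<gamma> \<in> forests_upto d n" for \<gamma>
    using bd[OF that] abs_triangle_ineq[of "f \<gamma>" "g \<gamma>"] by (simp add: ring_distribs)
  ultimately show ?thesis unfolding bounded_form_def by blast
qed

lemma bounded_form_cmult:
  assumes "bounded_form d n h K \<phi>"
  shows "bounded_form d n h (\<bar>x\<bar> * K) (\<lambda>c. x * \<phi> c)"
proof -
  obtain f where "represents d n f \<phi>" and bd: "\<And>\<gamma>. \<gamma> \<in> forests_upto d n \<Longrightarrow> \<bar>f \<gamma>\<bar> \<le> K * h \<gamma>"
    using assms by (auto simp: bounded_form_def)
  then have "represents d n (\<lambda>\<gamma>. x * f \<gamma>) (\<lambda>c. x * \<phi> c)"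
    by (simp add: represents_def sum_distrib_left mult.assoc)
  moreover have "\<bar>x * f \<gamma>\<bar> \<le> \<bar>x\<bar> * K * h \<gamma>" if "\<gamma> \<in> forests_upto d n" for \<gamma>
    using mult_left_mono[OF bd[OF that], of "\<bar>x\<bar>"] by (simp add: abs_mult mult.assoc)
  ultimately show ?thesis unfolding bounded_form_def by blast
qed

text \<open>For products in which the decay comes from the scalar, so that the coefficients of
  \<open>\<phi>\<close> satisfy no weighted bound of their own.\<close>

lemma bounded_form_scale:
  assumes "\<phi> \<in> forms d n" "\<And>\<gamma>. \<gamma> \<in> forests_upto d n \<Longrightarrow> \<bar>x\<bar> * \<bar>coeffs d n \<phi> \<gamma>\<bar> \<le> K * h \<gamma>"
  shows "bounded_form d n h K (\<lambda>c. x * \<phi> c)"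
  unfolding bounded_form_def
proof (intro exI conjI)
  show "represents d n (\<lambda>\<gamma>. x * coeffs d n \<phi> \<gamma>) (\<lambda>c. x * \<phi> c)"
    using represents_coeffs[OF assms(1)] by (simp add: represents_def sum_distrib_left mult.assoc)
qed (use assms(2) in \<open>simp add: abs_mult\<close>)

lemma bounded_form_zero: "bounded_form d n h 0 (\<lambda>c. 0)"
  unfolding bounded_form_def by (rule exI[of _ "\<lambda>_. 0"]) (simp add: represents_def)

lemma bounded_form_sum:
  assumes "finite A" "\<And>i. i \<in> A \<Longrightarrow> bounded_form d n h (K i) (\<phi> i)"
  shows "bounded_form d n h (\<Sum>i\<in>A. K i) (\<lambda>c. \<Sum>i\<in>A. \<phi> i c)"
  using assms by (induction A rule: finite_induct) (auto intro: bounded_form_zero bounded_form_add)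

lemma bounded_form_mono:
  assumes "bounded_form d n h K \<phi>" "K \<le> L" "\<And>\<gamma>. 0 \<le> h \<gamma>"
  shows "bounded_form d n h L \<phi>"
  using assms unfolding bounded_form_def by (meson mult_right_mono order_trans)

lemma bounded_form_single:
  assumes "\<gamma> \<in> forests_upto d n" "\<bar>x\<bar> \<le> K * h \<gamma>" "\<And>\<gamma>. 0 \<le> h \<gamma>" "0 \<le> K"
  shows "bounded_form d n h K (\<lambda>c. x * c \<gamma>)"
  unfolding bounded_form_def
proof (intro exI conjI)
  show "represents d n (\<lambda>\<gamma>'. if \<gamma>' = \<gamma> then x else 0) (\<lambda>c. x * c \<gamma>)"
    using assms(1) by (simp add: represents_def if_distrib[of "\<lambda>y. y * _"] cong: if_cong)
  show "\<forall>\<gamma>'\<in>forests_upto d n. \<bar>if \<gamma>' = \<gamma> then x else 0\<bar> \<le> K * h \<gamma>'"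
    using assms(2-) by auto
qed

text \<open>Beyond degree \<open>n\<close> elements of the group vanish, so that no bound on \<open>x\<close> is required there.\<close>

lemma bounded_form_tree:
  assumes "\<tau> \<in> trees d" "tdeg \<tau> \<le> n \<Longrightarrow> \<bar>x\<bar> \<le> K * h {#\<tau>#}" "\<And>\<gamma>. 0 \<le> h \<gamma>" "0 \<le> K"
  shows "bounded_form d n h K (\<lambda>c. x * c {#\<tau>#})"
proof (cases "tdeg \<tau> \<le> n")
  case True
  then have "{#\<tau>#} \<in> forests_upto d n"
    using assms(1) by (simp add: trees_upto_def Suc_le_eq)
  then show ?thesis using assms True by (intro bounded_form_single) auto
next
  case False
  then have "bounded_form d n h 0 (\<lambda>c. x * c {#\<tau>#})"
    using bounded_form_zero by (rule_tac bounded_form_cong) (auto simp: char_groupD(3))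
  then show ?thesis using assms bounded_form_mono by blast
qed

section \<open>Estimates for sums over a coproduct, by the l1 norm of its coefficients\<close>

definition coproduct_size :: "forest \<Rightarrow> real" where
  "coproduct_size \<rho> = (\<Sum>k\<in>Poly_Mapping.keys (coproduct \<rho>). \<bar>Poly_Mapping.lookup (coproduct \<rho>) k\<bar>)"

lemma coproduct_size_nonneg: "0 \<le> coproduct_size \<rho>"
  by (simp add: coproduct_size_def sum_nonneg)

lemma abs_sweedler_le:
  assumes "\<rho> \<in> forests d"
    and "\<And>u v. \<lbrakk>u \<in> forests d; v \<in> forests d; fdeg u + fdeg v = fdeg \<rho>\<rbrakk> \<Longrightarrow> \<bar>G u v\<bar> \<le> B"
  shows "\<bar>sweedler G \<rho>\<bar> \<le> coproduct_size \<rho> * B"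
  unfolding sweedler_def eval_tensor_def coproduct_size_def sum_distrib_right
proof (rule order_trans[OF sum_abs], rule sum_mono)
  fix k assume "k \<in> Poly_Mapping.keys (coproduct \<rho>)"
  then have "(fst k, snd k) \<in> Poly_Mapping.keys (coproduct \<rho>)" by simp
  then have "\<bar>G (fst k) (snd k)\<bar> \<le> B" using coproduct_keys assms by blast
  then show "\<bar>Poly_Mapping.lookup (coproduct \<rho>) k * G (fst k) (snd k)\<bar> \<le>
      \<bar>Poly_Mapping.lookup (coproduct \<rho>) k\<bar> * B"
    by (simp add: abs_mult mult_left_mono)
qed

lemma bounded_form_sweedler:
  assumes "\<rho> \<in> forests d"
    and "\<And>u v. \<lbrakk>u \<in> forests d; v \<in> forests d; fdeg u + fdeg v = fdeg \<rho>\<rbrakk> \<Longrightarrow>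
      bounded_form d n h K (\<lambda>c. G c u v)"
  shows "bounded_form d n h (coproduct_size \<rho> * K) (\<lambda>c. sweedler (G c) \<rho>)"
  unfolding sweedler_def eval_tensor_def coproduct_size_def sum_distrib_right
proof (rule bounded_form_sum)
  fix k assume "k \<in> Poly_Mapping.keys (coproduct \<rho>)"
  then have "(fst k, snd k) \<in> Poly_Mapping.keys (coproduct \<rho>)" by simp
  then have "bounded_form d n h K (\<lambda>c. G c (fst k) (snd k))" using coproduct_keys assms by blast
  then show "bounded_form d n h (\<bar>Poly_Mapping.lookup (coproduct \<rho>) k\<bar> * K)
      (\<lambda>c. Poly_Mapping.lookup (coproduct \<rho>) k * G c (fst k) (snd k))"
    by (rule bounded_form_cmult)
qed simp


section \<open>Translation of forms\<close>

text \<open>The matrix of left multiplication by \<open>b\<close> in the forest coordinates: the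
  coordinate \<open>\<rho>\<close> of a product \<open>b c\<close> is the sum over
  \<open>\<gamma>\<close> of this entry times \<open>c \<gamma>\<close>.\<close>

definition translation_coeff :: "(forest \<Rightarrow> real) \<Rightarrow> forest \<Rightarrow> forest \<Rightarrow> real" where
  "translation_coeff b \<rho> \<gamma> = sweedler (\<lambda>u v. if v = \<gamma> then b u else 0) \<rho>"

lemma translation_coeff_eq_0:
  assumes "fdeg \<rho> < fdeg \<gamma>"
  shows "translation_coeff b \<rho> \<gamma> = 0"
proof -
  have "translation_coeff b \<rho> \<gamma> = sweedler (\<lambda>u v. 0) \<rho>"
    unfolding translation_coeff_def by (rule sweedler_cong_deg) (use assms in auto)
  then show ?thesis by simp
qed

lemma forests_upto_iff: "v \<in> forests d \<Longrightarrow> fdeg v \<le> n \<Longrightarrow> v \<in> forests_upto d n \<longleftrightarrow> v \<noteq> {#}"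
  by (auto simp: forests_upto_def Suc_le_eq)

text \<open>The empty right factor is split off because \<open>forests_upto\<close> starts in degree
  one. \<open>q\<close> is an arbitrary function since it will also be
  \<open>graft_translation\<close> as a function of the grafted forest, which is not a
  character.\<close>

lemma sweedler_eq_translation_coeff:
  assumes "\<rho> \<in> forests_upto d n"
  shows "sweedler (\<lambda>u v. b u * q v) \<rho> =
    b \<rho> * q {#} + (\<Sum>\<gamma>\<in>forests_upto d n. translation_coeff b \<rho> \<gamma> * q \<gamma>)"
proof -
  have "sweedler (\<lambda>u v. b u * q v) \<rho> = sweedler (\<lambda>u v. (if v = {#} then b u * q {#} else 0) +
      (\<Sum>\<gamma>\<in>forests_upto d n. (if v = \<gamma> then b u else 0) * q \<gamma>)) \<rho>"
  proof (rule sweedler_cong)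
    fix u v :: forest assume "v \<in> forests d" "fdeg u + fdeg v = fdeg \<rho>"
    then have "v \<in> forests_upto d n \<longleftrightarrow> v \<noteq> {#}"
      using assms by (intro forests_upto_iff) (auto simp: forests_upto_def)
    then show "b u * q v = (if v = {#} then b u * q {#} else 0) +
        (\<Sum>\<gamma>\<in>forests_upto d n. (if v = \<gamma> then b u else 0) * q \<gamma>)"
      by (simp add: if_distrib[of "\<lambda>y. y * _"] cong: if_cong)
  qed (use assms in \<open>simp add: forests_upto_def\<close>)
  also have "\<dots> = b \<rho> * q {#} + (\<Sum>\<gamma>\<in>forests_upto d n. translation_coeff b \<rho> \<gamma> * q \<gamma>)"
    using sweedler_counit_right[of "\<lambda>u. b u * q {#}" \<rho>]
    by (simp add: sweedler_add sweedler_sum sweedler_cmult_right translation_coeff_def)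
  finally show ?thesis .
qed

lemma char_group_closed:
  "\<lbrakk>b \<in> carrier (char_group d n); c \<in> carrier (char_group d n)\<rbrakk> \<Longrightarrow>
    b \<otimes>\<^bsub>char_group d n\<^esub> c \<in> carrier (char_group d n)"
  by (rule monoid.m_closed[OF group.is_monoid[OF group_char_group]])

text \<open>Subtracting \<open>\<phi> b\<close> removes exactly the terms with empty right factor,
  the ones that are constant in \<open>c\<close>; what remains is a form without constant
  term.\<close>

lemma represents_translate:
  assumes "represents d n f \<phi>" and b: "b \<in> carrier (char_group d n)"
  shows "represents d n (\<lambda>\<gamma>. \<Sum>\<rho>\<in>forests_upto d n. f \<rho> * translation_coeff b \<rho> \<gamma>) (translate d n \<phi> b)"
  unfolding represents_def
proof
  fix c assume c: "c \<in> carrier (char_group d n)"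
  let ?F = "forests_upto d n"
  have "translate d n \<phi> b c = (\<Sum>\<rho>\<in>?F. f \<rho> * ((b \<otimes>\<^bsub>char_group d n\<^esub> c) \<rho> - b \<rho>))"
    using assms c char_group_closed[OF b c]
    by (simp add: translate_def represents_def right_diff_distrib sum_subtractf)
  also have "\<dots> = (\<Sum>\<rho>\<in>?F. f \<rho> * (\<Sum>\<gamma>\<in>?F. translation_coeff b \<rho> \<gamma> * c \<gamma>))"
  proof (rule sum.cong)
    fix \<rho> assume \<rho>: "\<rho> \<in> ?F"
    then have "\<rho> \<in> forests d \<and> fdeg \<rho> \<le> n" by (simp add: forests_upto_def)
    then show "f \<rho> * ((b \<otimes>\<^bsub>char_group d n\<^esub> c) \<rho> - b \<rho>) = f \<rho> * (\<Sum>\<gamma>\<in>?F. translation_coeff b \<rho> \<gamma> * c \<gamma>)"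
      using sweedler_eq_translation_coeff[OF \<rho>, of b c] by (simp add: char_group_mult_apply char_groupD(1)[OF c])
  qed simp
  also have "\<dots> = (\<Sum>\<rho>\<in>?F. \<Sum>\<gamma>\<in>?F. f \<rho> * translation_coeff b \<rho> \<gamma> * c \<gamma>)"
    by (simp add: sum_distrib_left mult.assoc)
  also have "\<dots> = (\<Sum>\<gamma>\<in>?F. (\<Sum>\<rho>\<in>?F. f \<rho> * translation_coeff b \<rho> \<gamma>) * c \<gamma>)"
    by (subst sum.swap) (simp add: sum_distrib_right)
  finally show "translate d n \<phi> b c = (\<Sum>\<gamma>\<in>?F. (\<Sum>\<rho>\<in>?F. f \<rho> * translation_coeff b \<rho> \<gamma>) * c \<gamma>)" .
qed

lemma translate_in_forms:
  "\<lbrakk>\<phi> \<in> forms d n; b \<in> carrier (char_group d n)\<rbrakk> \<Longrightarrow> translate d n \<phi> b \<in> forms d n"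
  unfolding forms_def using represents_translate by blast

lemma represents_diff:
  assumes "\<phi> \<in> forms d n" "\<psi> \<in> forms d n"
  shows "represents d n (\<lambda>\<gamma>. coeffs d n \<phi> \<gamma> - coeffs d n \<psi> \<gamma>) (\<lambda>c. \<phi> c - \<psi> c)"
  using represents_coeffs[OF assms(1)] represents_coeffs[OF assms(2)]
  by (simp add: represents_def left_diff_distrib sum_subtractf)

lemma diff_in_forms: "\<lbrakk>\<phi> \<in> forms d n; \<psi> \<in> forms d n\<rbrakk> \<Longrightarrow> (\<lambda>c. \<phi> c - \<psi> c) \<in> forms d n"
  using represents_diff unfolding forms_def by blast

lemma coeffs_diff:
  "\<lbrakk>\<phi> \<in> forms d n; \<psi> \<in> forms d n; \<gamma> \<in> forests_upto d n\<rbrakk> \<Longrightarrow>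
    coeffs d n (\<lambda>c. \<phi> c - \<psi> c) \<gamma> = coeffs d n \<phi> \<gamma> - coeffs d n \<psi> \<gamma>"
  using coeffs_eq[OF represents_diff] by metis


section \<open>Grafting and translation\<close>

text \<open>In every term of the coproduct of \<open>\<tau>\<close> other than
  \<open>\<tau> \<otimes> 1\<close> the root survives and the right factor is a tree, onto which
  \<open>v\<close> can be grafted. The indicator sum selects these terms and gives the tree a name;
  the bound \<open>n\<close> makes its index set finite.\<close>

lemma sweedler_graft:
  assumes \<tau>: "\<tau> \<in> trees_upto d n"
  shows "sweedler G {#graft \<rho> \<tau>#} = G {#graft \<rho> \<tau>#} {#} + sweedler (\<lambda>u v. sweedler (\<lambda>u' v'.
    \<Sum>\<tau>'\<in>trees_upto d n. if v' = {#\<tau>'#} then G (u + u') {#graft v \<tau>'#} else 0) {#\<tau>#}) \<rho>"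
proof -
  obtain j \<sigma> where \<tau>_eq: "\<tau> = Node j \<sigma>" by (cases \<tau>)
  have \<sigma>: "\<sigma> \<in> forests d" "j \<in> {1..d}" "Suc (fdeg \<sigma>) \<le> n"
    using \<tau> by (auto simp: \<tau>_eq trees_upto_def)
  have "sweedler (\<lambda>u' v'. \<Sum>\<tau>'\<in>trees_upto d n. if {#Node j v'#} = {#\<tau>'#} then G (u + u') {#graft v \<tau>'#} else 0) \<sigma> =
      sweedler (\<lambda>u' v'. G (u + u') {#Node j (v + v')#}) \<sigma>" for u v
  proof (rule sweedler_cong[OF \<sigma>(1)])
    fix u' v' :: forest assume "v' \<in> forests d" "fdeg u' + fdeg v' = fdeg \<sigma>"
    then have "Node j v' \<in> trees_upto d n" using \<sigma> by (simp add: trees_upto_def)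
    then show "(\<Sum>\<tau>'\<in>trees_upto d n. if {#Node j v'#} = {#\<tau>'#} then G (u + u') {#graft v \<tau>'#} else 0) =
        G (u + u') {#Node j (v + v')#}"
      by simp
  qed
  then show ?thesis by (simp add: \<tau>_eq sweedler_Node sweedler_union)
qed

text \<open>The coordinate \<open>\<tau>\<close> is translated by \<open>b\<close>, and
  \<open>x\<close> is grafted onto each resulting tree before \<open>c\<close> is evaluated. For
  \<open>x = {#}\<close> this is the increment of the coordinate \<open>\<tau>\<close> from
  \<open>b\<close> to \<open>b c\<close>.\<close>

definition graft_translation ::
    "nat \<Rightarrow> nat \<Rightarrow> (forest \<Rightarrow> real) \<Rightarrow> nat ltree \<Rightarrow> forest \<Rightarrow> (forest \<Rightarrow> real) \<Rightarrow> real" where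
  "graft_translation d n b \<tau> x c =
    (\<Sum>\<tau>'\<in>trees_upto d n. translation_coeff b {#\<tau>#} {#\<tau>'#} * c {#graft x \<tau>'#})"

lemma mult_graft_apply:
  assumes b: "b \<in> carrier (char_group d n)" and c: "c \<in> carrier (char_group d n)"
    and \<rho>: "\<rho> \<in> forests d" and \<tau>: "\<tau> \<in> trees_upto d n" and deg: "fdeg \<rho> + tdeg \<tau> \<le> n"
  shows "(b \<otimes>\<^bsub>char_group d n\<^esub> c) {#graft \<rho> \<tau>#} - b {#graft \<rho> \<tau>#} =
    sweedler (\<lambda>u v. b u * graft_translation d n b \<tau> v c) \<rho>"
proof -
  have trees: "\<tau> \<in> trees d" using \<tau> by (simp add: trees_upto_def)
  have "(b \<otimes>\<^bsub>char_group d n\<^esub> c) {#graft \<rho> \<tau>#} = sweedler (\<lambda>u v. b u * c v) {#graft \<rho> \<tau>#}"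
    using \<rho> trees deg by (simp add: char_group_mult_apply)
  also have "\<dots> = b {#graft \<rho> \<tau>#} + sweedler (\<lambda>u v. sweedler (\<lambda>u' v'.
      \<Sum>\<tau>'\<in>trees_upto d n. if v' = {#\<tau>'#} then b (u + u') * c {#graft v \<tau>'#} else 0) {#\<tau>#}) \<rho>"
    by (simp add: sweedler_graft[OF \<tau>] char_groupD(1)[OF c])
  also have "sweedler (\<lambda>u v. sweedler (\<lambda>u' v'.
      \<Sum>\<tau>'\<in>trees_upto d n. if v' = {#\<tau>'#} then b (u + u') * c {#graft v \<tau>'#} else 0) {#\<tau>#}) \<rho> =
    sweedler (\<lambda>u v. b u * graft_translation d n b \<tau> v c) \<rho>"
  proof (rule sweedler_cong[OF \<rho>])
    fix u v :: forest assume u: "u \<in> forests d" "fdeg u + fdeg v = fdeg \<rho>"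
    have "sweedler (\<lambda>u' v'. \<Sum>\<tau>'\<in>trees_upto d n. if v' = {#\<tau>'#} then b (u + u') * c {#graft v \<tau>'#} else 0) {#\<tau>#}
      = sweedler (\<lambda>u' v'. \<Sum>\<tau>'\<in>trees_upto d n. b u * ((if v' = {#\<tau>'#} then b u' else 0) * c {#graft v \<tau>'#})) {#\<tau>#}"
    proof (rule sweedler_cong)
      fix u' v' :: forest assume "u' \<in> forests d" "fdeg u' + fdeg v' = fdeg {#\<tau>#}"
      \<comment> \<open>A truncated character is multiplicative only up to total degree
        \<open>n\<close>; here \<open>|u| + |u'|\<close> is at most
        \<open>|\<rho>| + |\<tau>|\<close>, which \<open>deg\<close> bounds.\<close>
      then have "b (u + u') = b u * b u'" using char_groupD(2)[OF b u(1)] u(2) deg by simp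
      then show "(\<Sum>\<tau>'\<in>trees_upto d n. if v' = {#\<tau>'#} then b (u + u') * c {#graft v \<tau>'#} else 0) =
          (\<Sum>\<tau>'\<in>trees_upto d n. b u * ((if v' = {#\<tau>'#} then b u' else 0) * c {#graft v \<tau>'#}))"
        by (intro sum.cong) auto
    qed (use trees in simp)
    then show "sweedler (\<lambda>u' v'. \<Sum>\<tau>'\<in>trees_upto d n. if v' = {#\<tau>'#} then b (u + u') * c {#graft v \<tau>'#} else 0) {#\<tau>#}
        = b u * graft_translation d n b \<tau> v c"
      by (simp add: sweedler_sum sweedler_cmult sweedler_cmult_right graft_translation_def
          translation_coeff_def sum_distrib_left)
  qed
  finally show ?thesis by simp
qed

lemma sum_forests_upto_trees:
  assumes "\<And>\<rho>. \<lbrakk>\<rho> \<in> forests_upto d n; \<nexists>\<tau>. \<rho> = {#\<tau>#}\<rbrakk> \<Longrightarrow> f \<rho> = 0"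
  shows "(\<Sum>\<rho>\<in>forests_upto d n. f \<rho>) = (\<Sum>\<tau>\<in>trees_upto d n. f {#\<tau>#})"
proof -
  have "(\<Sum>\<rho>\<in>forests_upto d n. f \<rho>) = (\<Sum>\<rho>\<in>(\<lambda>\<tau>. {#\<tau>#}) ` trees_upto d n. f \<rho>)"
  proof (rule sum.mono_neutral_right)
    show "\<forall>\<rho>\<in>forests_upto d n - (\<lambda>\<tau>. {#\<tau>#}) ` trees_upto d n. f \<rho> = 0"
    proof
      fix \<rho> assume "\<rho> \<in> forests_upto d n - (\<lambda>\<tau>. {#\<tau>#}) ` trees_upto d n"
      then have \<rho>: "\<rho> \<in> forests_upto d n" "\<rho> \<notin> (\<lambda>\<tau>. {#\<tau>#}) ` trees_upto d n" by auto
      have "\<nexists>\<tau>. \<rho> = {#\<tau>#}"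
      proof
        assume "\<exists>\<tau>. \<rho> = {#\<tau>#}"
        then obtain \<tau> where "\<rho> = {#\<tau>#}" by blast
        with \<rho> show False by (simp add: image_iff)
      qed
      with \<rho>(1) show "f \<rho> = 0" by (rule assms)
    qed
  qed auto
  also have "\<dots> = (\<Sum>\<tau>\<in>trees_upto d n. f {#\<tau>#})"
    by (subst sum.reindex) (auto simp: inj_on_def)
  finally show ?thesis .
qed

text \<open>Group elements vanish above degree \<open>n\<close>, so on the group the degree
  condition of \<open>form_succ\<close> may be dropped and the index set becomes a rectangle, over
  which sums can be exchanged and factored.\<close>

lemma form_succ_apply:
  assumes "c \<in> carrier (char_group d n)"
  shows "form_succ d n \<phi>\<^sub>1 \<phi>\<^sub>2 c = (\<Sum>\<rho>\<in>forests_upto d n. \<Sum>\<tau>\<in>trees_upto d n.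
    coeffs d n \<phi>\<^sub>1 \<rho> * coeffs d n \<phi>\<^sub>2 {#\<tau>#} * c {#graft \<rho> \<tau>#})"
proof -
  have "fdeg \<rho> + tdeg \<tau> \<le> n" if "c {#graft \<rho> \<tau>#} \<noteq> 0" for \<rho> \<tau>
    using char_groupD(3)[OF assms, of "{#graft \<rho> \<tau>#}"] that by (auto simp: not_less[symmetric])
  then show ?thesis
    unfolding form_succ_def sum.cartesian_product by (intro sum.mono_neutral_left) auto
qed

text \<open>The terms with \<open>|\<rho>| + |\<tau>| > n\<close> are absent from \<open>\<phi>\<^sub>1 \<succ> \<phi>\<^sub>2\<close> because of the truncation, but their
  translations have components of degree at most \<open>n\<close>; the last sum is what has to be taken back.\<close>

lemma translate_form_succ:
  assumes \<phi>\<^sub>1: "\<phi>\<^sub>1 \<in> forms d n" and \<phi>\<^sub>2: "\<phi>\<^sub>2 \<in> forms d n" and only: "only_trees d n \<phi>\<^sub>2"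
    and b: "b \<in> carrier (char_group d n)" and c: "c \<in> carrier (char_group d n)"
  shows "translate d n (form_succ d n \<phi>\<^sub>1 \<phi>\<^sub>2) b c =
    \<phi>\<^sub>1 b * translate d n \<phi>\<^sub>2 b c
    + (\<Sum>x\<in>forests_upto d n. \<Sum>\<tau>\<in>trees_upto d n. coeffs d n (translate d n \<phi>\<^sub>1 b) x *
        coeffs d n (translate d n \<phi>\<^sub>2 b) {#\<tau>#} * c {#graft x \<tau>#})
    - (\<Sum>\<rho>\<in>forests_upto d n. \<Sum>\<tau>\<in>trees_upto d n. if n < fdeg \<rho> + tdeg \<tau> then
        coeffs d n \<phi>\<^sub>1 \<rho> * coeffs d n \<phi>\<^sub>2 {#\<tau>#} *
        sweedler (\<lambda>u v. b u * graft_translation d n b \<tau> v c) \<rho> else 0)"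
proof -
  let ?F = "forests_upto d n" and ?T = "trees_upto d n"
  define f1 where "f1 = coeffs d n \<phi>\<^sub>1"
  define f2 where "f2 \<tau> = coeffs d n \<phi>\<^sub>2 {#\<tau>#}" for \<tau>
  define Q where "Q \<tau> x = graft_translation d n b \<tau> x c" for \<tau> x
  \<comment> \<open>What the translation of the coordinate \<open>\<rho> \<succ> \<tau>\<close>
    would be without truncation. It agrees with the true one up to degree \<open>n\<close>, and
    beyond it need not vanish.\<close>
  define H where "H \<rho> \<tau> = sweedler (\<lambda>u v. b u * Q \<tau> v) \<rho>" for \<rho> \<tau>
  have bc: "b \<otimes>\<^bsub>char_group d n\<^esub> c \<in> carrier (char_group d n)" by (rule char_group_closed[OF b c])
  have H_graft: "(b \<otimes>\<^bsub>char_group d n\<^esub> c) {#graft \<rho> \<tau>#} - b {#graft \<rho> \<tau>#} = H \<rho> \<tau>"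
    if "\<rho> \<in> forests d" "\<tau> \<in> ?T" "fdeg \<rho> + tdeg \<tau> \<le> n" for \<rho> \<tau>
    using mult_graft_apply[OF b c that] by (simp add: H_def Q_def)
  have H_split: "H \<rho> \<tau> = b \<rho> * Q \<tau> {#} + (\<Sum>x\<in>?F. translation_coeff b \<rho> x * Q \<tau> x)" if "\<rho> \<in> ?F" for \<rho> \<tau>
    unfolding H_def by (rule sweedler_eq_translation_coeff[OF that])
  have C1: "coeffs d n (translate d n \<phi>\<^sub>1 b) x = (\<Sum>\<rho>\<in>?F. f1 \<rho> * translation_coeff b \<rho> x)" if "x \<in> ?F" for x
    using coeffs_eq[OF represents_translate[OF represents_coeffs[OF \<phi>\<^sub>1] b] that] by (simp add: f1_def)
  have only': "coeffs d n \<phi>\<^sub>2 \<rho> = 0" if "\<rho> \<in> ?F" "\<nexists>\<tau>. \<rho> = {#\<tau>#}" for \<rho>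
    using only that by (simp add: only_trees_def)
  have C2: "coeffs d n (translate d n \<phi>\<^sub>2 b) {#\<tau>'#} = (\<Sum>\<tau>\<in>?T. f2 \<tau> * translation_coeff b {#\<tau>#} {#\<tau>'#})"
    if "\<tau>' \<in> ?T" for \<tau>'
  proof -
    have "{#\<tau>'#} \<in> ?F" using that by simp
    from coeffs_eq[OF represents_translate[OF represents_coeffs[OF \<phi>\<^sub>2] b] this]
    show ?thesis by (simp add: f2_def sum_forests_upto_trees only')
  qed
  have Q_sum: "(\<Sum>\<tau>\<in>?T. f2 \<tau> * Q \<tau> x) = (\<Sum>\<tau>'\<in>?T. coeffs d n (translate d n \<phi>\<^sub>2 b) {#\<tau>'#} * c {#graft x \<tau>'#})" for x
  proof -
    have "(\<Sum>\<tau>\<in>?T. f2 \<tau> * Q \<tau> x) = (\<Sum>\<tau>\<in>?T. \<Sum>\<tau>'\<in>?T. f2 \<tau> * translation_coeff b {#\<tau>#} {#\<tau>'#} * c {#graft x \<tau>'#})"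
      by (simp add: Q_def graft_translation_def sum_distrib_left mult.assoc)
    also have "\<dots> = (\<Sum>\<tau>'\<in>?T. coeffs d n (translate d n \<phi>\<^sub>2 b) {#\<tau>'#} * c {#graft x \<tau>'#})"
      by (subst sum.swap) (simp add: C2 sum_distrib_right)
    finally show ?thesis .
  qed
  have trans2: "translate d n \<phi>\<^sub>2 b c = (\<Sum>\<tau>\<in>?T. f2 \<tau> * Q \<tau> {#})"
  proof -
    have "\<phi>\<^sub>2 a = (\<Sum>\<tau>\<in>?T. f2 \<tau> * a {#\<tau>#})" if "a \<in> carrier (char_group d n)" for a
      using represents_coeffs[OF \<phi>\<^sub>2] that by (simp add: represents_def f2_def sum_forests_upto_trees only')
    then have "translate d n \<phi>\<^sub>2 b c = (\<Sum>\<tau>\<in>?T. f2 \<tau> * ((b \<otimes>\<^bsub>char_group d n\<^esub> c) {#\<tau>#} - b {#\<tau>#}))"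
      using b bc by (simp add: translate_def right_diff_distrib sum_subtractf)
    also have "\<dots> = (\<Sum>\<tau>\<in>?T. f2 \<tau> * Q \<tau> {#})"
    proof (rule sum.cong)
      fix \<tau> assume \<tau>: "\<tau> \<in> ?T"
      then have "tdeg \<tau> \<le> n" by (simp add: trees_upto_def)
      then show "f2 \<tau> * ((b \<otimes>\<^bsub>char_group d n\<^esub> c) {#\<tau>#} - b {#\<tau>#}) = f2 \<tau> * Q \<tau> {#}"
        using H_graft[of "{#}" \<tau>] \<tau> char_groupD(1)[OF b] by (simp add: H_def)
    qed simp
    finally show ?thesis .
  qed
  have "translate d n (form_succ d n \<phi>\<^sub>1 \<phi>\<^sub>2) b c = (\<Sum>\<rho>\<in>?F. \<Sum>\<tau>\<in>?T. f1 \<rho> * f2 \<tau> *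
      ((b \<otimes>\<^bsub>char_group d n\<^esub> c) {#graft \<rho> \<tau>#} - b {#graft \<rho> \<tau>#}))"
    by (simp add: translate_def form_succ_apply b bc f1_def f2_def right_diff_distrib sum_subtractf)
  \<comment> \<open>For pairs of total degree above \<open>n\<close> both group elements vanish on
    the graft, so the difference is zero; \<open>H\<close> is inserted there and subtracted again to
    make the double sum factor.\<close>
  also have "\<dots> = (\<Sum>\<rho>\<in>?F. \<Sum>\<tau>\<in>?T. f1 \<rho> * f2 \<tau> * H \<rho> \<tau> -
      (if n < fdeg \<rho> + tdeg \<tau> then f1 \<rho> * f2 \<tau> * H \<rho> \<tau> else 0))"
  proof (intro sum.cong refl)
    fix \<rho> \<tau> assume "\<rho> \<in> ?F" "\<tau> \<in> ?T"
    then show "f1 \<rho> * f2 \<tau> * ((b \<otimes>\<^bsub>char_group d n\<^esub> c) {#graft \<rho> \<tau>#} - b {#graft \<rho> \<tau>#}) =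
        f1 \<rho> * f2 \<tau> * H \<rho> \<tau> - (if n < fdeg \<rho> + tdeg \<tau> then f1 \<rho> * f2 \<tau> * H \<rho> \<tau> else 0)"
      using H_graft[of \<rho> \<tau>] char_groupD(3)[OF b] char_groupD(3)[OF bc]
      by (cases "n < fdeg \<rho> + tdeg \<tau>") (auto simp: forests_upto_def)
  qed
  also have "\<dots> = (\<Sum>\<rho>\<in>?F. \<Sum>\<tau>\<in>?T. f1 \<rho> * f2 \<tau> * H \<rho> \<tau>) -
      (\<Sum>\<rho>\<in>?F. \<Sum>\<tau>\<in>?T. if n < fdeg \<rho> + tdeg \<tau> then f1 \<rho> * f2 \<tau> * H \<rho> \<tau> else 0)"
    by (simp add: sum_subtractf)
  \<comment> \<open>Cuts of \<open>\<rho>\<close> that leave nothing to graft give the product of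
    \<open>\<phi>\<^sub>1 b\<close> with the translate of \<open>\<phi>\<^sub>2\<close>; the others
    give the two translates joined by \<succ>.\<close>
  also have "(\<Sum>\<rho>\<in>?F. \<Sum>\<tau>\<in>?T. f1 \<rho> * f2 \<tau> * H \<rho> \<tau>) =
      (\<Sum>\<rho>\<in>?F. f1 \<rho> * b \<rho>) * (\<Sum>\<tau>\<in>?T. f2 \<tau> * Q \<tau> {#}) +
      (\<Sum>\<rho>\<in>?F. \<Sum>\<tau>\<in>?T. \<Sum>x\<in>?F. f1 \<rho> * translation_coeff b \<rho> x * (f2 \<tau> * Q \<tau> x))"
  proof -
    have "(\<Sum>\<rho>\<in>?F. \<Sum>\<tau>\<in>?T. f1 \<rho> * f2 \<tau> * H \<rho> \<tau>) = (\<Sum>\<rho>\<in>?F. \<Sum>\<tau>\<in>?T. (f1 \<rho> * b \<rho>) * (f2 \<tau> * Q \<tau> {#}) +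
        (\<Sum>x\<in>?F. f1 \<rho> * translation_coeff b \<rho> x * (f2 \<tau> * Q \<tau> x)))"
      by (intro sum.cong refl) (simp add: H_split ring_distribs sum_distrib_left mult_ac)
    then show ?thesis by (simp only: sum.distrib sum_product)
  qed
  also have "(\<Sum>\<rho>\<in>?F. f1 \<rho> * b \<rho>) = \<phi>\<^sub>1 b"
    using represents_coeffs[OF \<phi>\<^sub>1] b by (simp add: represents_def f1_def)
  also have "(\<Sum>\<rho>\<in>?F. \<Sum>\<tau>\<in>?T. \<Sum>x\<in>?F. f1 \<rho> * translation_coeff b \<rho> x * (f2 \<tau> * Q \<tau> x)) =
      (\<Sum>x\<in>?F. (\<Sum>\<rho>\<in>?F. f1 \<rho> * translation_coeff b \<rho> x) * (\<Sum>\<tau>\<in>?T. f2 \<tau> * Q \<tau> x))"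
  proof -
    have "(\<Sum>\<rho>\<in>?F. \<Sum>\<tau>\<in>?T. \<Sum>x\<in>?F. f1 \<rho> * translation_coeff b \<rho> x * (f2 \<tau> * Q \<tau> x)) =
        (\<Sum>\<rho>\<in>?F. \<Sum>x\<in>?F. \<Sum>\<tau>\<in>?T. f1 \<rho> * translation_coeff b \<rho> x * (f2 \<tau> * Q \<tau> x))"
      by (intro sum.cong refl sum.swap)
    also have "\<dots> = (\<Sum>x\<in>?F. \<Sum>\<rho>\<in>?F. \<Sum>\<tau>\<in>?T. f1 \<rho> * translation_coeff b \<rho> x * (f2 \<tau> * Q \<tau> x))"
      by (rule sum.swap)
    finally show ?thesis by (simp add: sum_product)
  qed
  also have "\<dots> = (\<Sum>x\<in>?F. \<Sum>\<tau>\<in>?T. coeffs d n (translate d n \<phi>\<^sub>1 b) x *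
        coeffs d n (translate d n \<phi>\<^sub>2 b) {#\<tau>#} * c {#graft x \<tau>#})"
    by (intro sum.cong refl) (simp add: C1 Q_sum sum_distrib_left mult.assoc)
  finally show ?thesis unfolding trans2 f1_def f2_def H_def Q_def .
qed

section \<open>Increments of a branched rough path\<close>

lemma continuous_on_Max:
  fixes f :: "'i \<Rightarrow> 'a::topological_space \<Rightarrow> real"
  assumes "finite A" "A \<noteq> {}" "\<And>i. i \<in> A \<Longrightarrow> continuous_on S (f i)"
  shows "continuous_on S (\<lambda>x. MAX i\<in>A. f i x)"
  using assms
proof (induction A rule: finite_ne_induct)
  case (insert i A)
  have "continuous_on S (\<lambda>x. max (f i x) (MAX i\<in>A. f i x))"
    by (rule continuous_on_max) (use insert in auto)
  then show ?case using insert.hyps by simp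
qed simp

lemma powr_inverse_power: "0 \<le> (x :: real) \<Longrightarrow> 0 < k \<Longrightarrow> (x powr (1 / real k)) ^ k = x"
  by (cases "x = 0") (simp_all add: powr_realpow[symmetric] powr_powr)

lemma abs_le_char_norm_power:
  assumes "\<rho> \<in> forests_upto d n"
  shows "\<bar>a \<rho>\<bar> \<le> char_norm d n a ^ fdeg \<rho>"
proof -
  have "\<bar>a \<rho>\<bar> powr (1 / real (fdeg \<rho>)) \<le> char_norm d n a"
    unfolding char_norm_def using assms by (intro Max_ge) auto
  then have "(\<bar>a \<rho>\<bar> powr (1 / real (fdeg \<rho>))) ^ fdeg \<rho> \<le> char_norm d n a ^ fdeg \<rho>"
    by (rule power_mono) simp
  moreover have "0 < fdeg \<rho>" using assms by (auto simp: forests_upto_def)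
  ultimately show ?thesis by (simp only: powr_inverse_power[OF abs_ge_zero])
qed

lemma char_norm_nonneg:
  assumes "1 \<le> d" "1 \<le> n"
  shows "0 \<le> char_norm d n a"
proof -
  obtain \<rho> where "\<rho> \<in> forests_upto d n" using forests_upto_nonempty[OF assms] by blast
  then have "\<bar>a \<rho>\<bar> powr (1 / real (fdeg \<rho>)) \<le> char_norm d n a"
    unfolding char_norm_def by (intro Max_ge) auto
  then show ?thesis using powr_ge_zero order_trans by blast
qed

lemma partition_sum_nonneg: "(\<And>u v. 0 \<le> f u v) \<Longrightarrow> 0 \<le> partition_sum f D"
  by (simp add: partition_sum_def sum_nonneg)

lemma partition_extend:
  assumes D: "is_partition s t D" and "0 \<le> s" "t \<le> T" and nonneg: "\<And>u v. 0 \<le> f u v"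
  shows "\<exists>E. is_partition 0 T E \<and> partition_sum f D \<le> partition_sum f E"
proof -
  obtain D' where D': "is_partition 0 t D'" "partition_sum f D \<le> partition_sum f D'"
  proof (cases "s = 0")
    case False
    obtain r where "D = s # r" using D by (metis hd_Cons_tl is_partition_def)
    with D False \<open>0 \<le> s\<close> nonneg[of 0 s] that[of "0 # D"] show thesis by simp
  qed (use D that in blast)
  obtain A where A: "D' = A @ [t]" using D'(1) by (metis append_butlast_last_id is_partition_def)
  show ?thesis
  proof (cases "t = T")
    case False
    then have "is_partition 0 T (A @ [t, T])"
      using D'(1) A \<open>t \<le> T\<close> is_partition_append_iff[of 0 T A t "[T]"] by simp
    moreover have "partition_sum f D' \<le> partition_sum f (A @ [t, T])"
      using partition_sum_append[of f A t "[T]"] nonneg[of t T] A by simp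
    ultimately show ?thesis using D'(2) order_trans by blast
  qed (use D' in blast)
qed

locale rough_path =
  fixes p T :: real and d :: nat and X :: "real \<Rightarrow> forest \<Rightarrow> real"
  assumes p_ge_1: "1 \<le> p" and d_ge_1: "1 \<le> d" and T_pos: "0 < T"
    and rough: "branched_rough_path p d T X"
begin

definition n :: nat where "n = step p"
abbreviation "F \<equiv> forests_upto d n"
abbreviation "Tr \<equiv> trees_upto d n"
abbreviation "G \<equiv> char_group d n"
abbreviation "\<omega> \<equiv> control p d X"
abbreviation "inc \<equiv> increment p d X"

definition N :: "real \<Rightarrow> real \<Rightarrow> real" where
  "N u v = char_norm d n (inc u v) powr p"

lemma n_ge_1: "1 \<le> n" and n_le_p: "real n \<le> p"
  using p_ge_1 by (auto simp: n_def le_nat_floor le_floor_iff nat_le_iff of_nat_nat floor_le_iff)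

lemma F_finite_nonempty: "finite F" "F \<noteq> {}"
  using forests_upto_nonempty[OF d_ge_1 n_ge_1] by simp_all

lemma deg_F: "\<gamma> \<in> F \<Longrightarrow> 1 \<le> fdeg \<gamma> \<and> fdeg \<gamma> \<le> n"
  by (simp add: forests_upto_def)

lemma X_in_G: "\<lbrakk>0 \<le> t; t \<le> T\<rbrakk> \<Longrightarrow> X t \<in> carrier G"
  using rough by (auto simp: branched_rough_path_def n_def)

lemma increment_eq: "inc s t = inv\<^bsub>G\<^esub> (X s) \<otimes>\<^bsub>G\<^esub> X t"
  by (simp add: increment_def n_def)

lemma inc_in_G: "\<lbrakk>0 \<le> s; s \<le> T; 0 \<le> t; t \<le> T\<rbrakk> \<Longrightarrow> inc s t \<in> carrier G"
  unfolding increment_eq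
  by (intro char_group_closed X_in_G group.inv_closed[OF group_char_group]) auto

lemma X_mult_inc: "\<lbrakk>0 \<le> s; s \<le> T; 0 \<le> t; t \<le> T\<rbrakk> \<Longrightarrow> X s \<otimes>\<^bsub>G\<^esub> inc s t = X t"
proof -
  interpret group G by (rule group_char_group)
  show "\<lbrakk>0 \<le> s; s \<le> T; 0 \<le> t; t \<le> T\<rbrakk> \<Longrightarrow> X s \<otimes>\<^bsub>G\<^esub> inc s t = X t"
    unfolding increment_eq using X_in_G by (simp add: m_assoc[symmetric] r_inv)
qed

lemma inc_refl: "\<lbrakk>0 \<le> s; s \<le> T\<rbrakk> \<Longrightarrow> inc s s = counit"
  unfolding increment_eq
  using group.l_inv[OF group_char_group X_in_G] by (simp add: one_char_group)

lemma inc_mult: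
  assumes "0 \<le> s" "s \<le> T" "0 \<le> u" "u \<le> T" "0 \<le> t" "t \<le> T"
  shows "inc s u \<otimes>\<^bsub>G\<^esub> inc u t = inc s t"
proof -
  interpret group G by (rule group_char_group)
  have X: "X s \<in> carrier G" "X u \<in> carrier G" "X t \<in> carrier G" using X_in_G assms by auto
  have closed: "inv\<^bsub>G\<^esub> (X s) \<in> carrier G" "inv\<^bsub>G\<^esub> (X u) \<in> carrier G" using X by (rule_tac inv_closed, simp)+
  have cancel: "X u \<otimes>\<^bsub>G\<^esub> (inv\<^bsub>G\<^esub> (X u) \<otimes>\<^bsub>G\<^esub> X t) = X t"
    using m_assoc[OF X(2) closed(2) X(3)] r_inv[OF X(2)] l_one[OF X(3)] by simp
  show ?thesis
    unfolding increment_eq m_assoc[OF closed(1) X(2) m_closed[OF closed(2) X(3)]] cancel ..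
qed

lemma N_nonneg: "0 \<le> N u v"
  by (simp add: N_def)

lemma N_refl: "\<lbrakk>0 \<le> s; s \<le> T\<rbrakk> \<Longrightarrow> N s s = 0"
proof -
  have "char_norm d n counit = (MAX \<rho>\<in>F. 0)"
    unfolding char_norm_def
    by (intro arg_cong[where f = Max] image_cong refl) (auto simp: counit_def forests_upto_def)
  also have "\<dots> = 0" using F_finite_nonempty(2) by (simp add: image_constant_conv)
  finally have "char_norm d n counit = 0" .
  then show "\<lbrakk>0 \<le> s; s \<le> T\<rbrakk> \<Longrightarrow> N s s = 0" by (simp add: N_def inc_refl)
qed

lemma pvar_eq: "pvar p d X s t = (SUP D\<in>{D. is_partition s t D}. ennreal (partition_sum N D powr (1 / p)))"
  by (simp add: pvar_def N_def[abs_def] n_def)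

lemma pvar_finite:
  assumes "0 \<le> s" "t \<le> T"
  shows "pvar p d X s t < \<infinity>"
proof -
  have "pvar p d X s t \<le> pvar p d X 0 T"
    unfolding pvar_eq
  proof (rule SUP_mono)
    fix D assume "D \<in> {D. is_partition s t D}"
    then obtain E where "is_partition 0 T E" "partition_sum N D \<le> partition_sum N E"
      using partition_extend[of s t D T N] assms N_nonneg by auto
    then show "\<exists>E\<in>{D. is_partition 0 T D}. ennreal (partition_sum N D powr (1 / p)) \<le> ennreal (partition_sum N E powr (1 / p))"
      using p_ge_1 partition_sum_nonneg[of N D, OF N_nonneg] by (auto intro!: bexI[of _ E] ennreal_leI powr_mono2)
  qed
  then show ?thesis using rough by (auto simp: branched_rough_path_def)
qed

lemma powr_cancel: "0 \<le> x \<Longrightarrow> (x powr (1 / p)) powr p = x"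
  using p_ge_1 by (simp add: powr_powr)

text \<open>Together with \<open>control_le\<close> this identifies the control with the supremum of
  the partition sums: finite variation makes \<open>enn2real\<close> faithful, and the exponents
  \<open>1 / p\<close> and \<open>p\<close> cancel.\<close>

lemma partition_sum_le_control:
  assumes "0 \<le> s" "t \<le> T" "is_partition s t D"
  shows "partition_sum N D \<le> \<omega> s t"
proof -
  have nonneg: "0 \<le> partition_sum N D" by (rule partition_sum_nonneg[OF N_nonneg])
  have "ennreal (partition_sum N D powr (1 / p)) \<le> pvar p d X s t"
    unfolding pvar_eq using assms(3) by (intro SUP_upper) simp
  then have "partition_sum N D powr (1 / p) \<le> enn2real (pvar p d X s t)"
    using pvar_finite[OF assms(1,2)] enn2real_mono by fastforce
  then have "(partition_sum N D powr (1 / p)) powr p \<le> \<omega> s t"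
    unfolding control_def using p_ge_1 by (intro powr_mono2) auto
  then show ?thesis by (simp add: powr_cancel nonneg)
qed

lemma control_le:
  assumes "s \<le> t" "\<And>D. is_partition s t D \<Longrightarrow> partition_sum N D \<le> c"
  shows "\<omega> s t \<le> c"
proof -
  obtain D where "is_partition s t D" using fine_partition_exists[OF assms(1), of 1] by auto
  then have "0 \<le> c" using assms(2) partition_sum_nonneg[of N D, OF N_nonneg] order_trans by blast
  have "pvar p d X s t \<le> ennreal (c powr (1 / p))"
    unfolding pvar_eq using assms(2) p_ge_1 partition_sum_nonneg[of N, OF N_nonneg]
    by (intro SUP_least ennreal_leI powr_mono2) auto
  then have "enn2real (pvar p d X s t) \<le> c powr (1 / p)" by (intro enn2real_leI) auto
  then have "\<omega> s t \<le> (c powr (1 / p)) powr p"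
    unfolding control_def using p_ge_1 by (intro powr_mono2) auto
  then show ?thesis by (simp add: powr_cancel \<open>0 \<le> c\<close>)
qed

text \<open>Continuity of the group inverse is avoided by solving
  \<open>X s \<otimes> inc s t = X t\<close> for the coordinate \<open>\<rho>\<close> of the
  increment. The empty left factor isolates it, and the other terms involve increments of smaller
  degree.\<close>

lemma continuous_inc:
  assumes "\<rho> \<in> forests d" "fdeg \<rho> \<le> n"
  shows "continuous_on ({0..T} \<times> {0..T}) (\<lambda>z. inc (fst z) (snd z) \<rho>)"
  using assms
proof (induction "fdeg \<rho>" arbitrary: \<rho> rule: less_induct)
  case less
  let ?S = "{0..T} \<times> {0..T}" and ?k = "{k \<in> Poly_Mapping.keys (coproduct \<rho>). fst k \<noteq> {#}}"
  have "continuous_on {0..T} X" using rough by (simp add: branched_rough_path_def)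
  then have X: "continuous_on {0..T} (\<lambda>t. X t \<sigma>)" for \<sigma>
    by (rule continuous_on_product_then_coordinatewise)
  have X': "continuous_on ?S (\<lambda>z. X (fst z) \<sigma>)" "continuous_on ?S (\<lambda>z. X (snd z) \<sigma>)" for \<sigma>
    by (rule continuous_on_compose2[OF X]; auto intro!: continuous_intros)+
  have IH: "continuous_on ?S (\<lambda>z. inc (fst z) (snd z) (snd k))" if "k \<in> ?k" for k
  proof -
    have "(fst k, snd k) \<in> Poly_Mapping.keys (coproduct \<rho>)" "fst k \<noteq> {#}" using that by auto
    note k = coproduct_keys[OF this(1)] this(2)
    have "0 < fdeg (fst k)" using k by simp
    then have "fdeg (snd k) < fdeg \<rho>" using k(1) by linarith
    then show ?thesis using less.hyps k less.prems by simp
  qed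
  have eq: "inc (fst z) (snd z) \<rho> = X (snd z) \<rho> - (\<Sum>k\<in>?k. Poly_Mapping.lookup (coproduct \<rho>) k *
      (X (fst z) (fst k) * inc (fst z) (snd z) (snd k)))" if "z \<in> ?S" for z
  proof -
    have z: "0 \<le> fst z" "fst z \<le> T" "0 \<le> snd z" "snd z \<le> T" using that by auto
    let ?a = "X (fst z)" and ?b = "inc (fst z) (snd z)"
    have "X (snd z) \<rho> = sweedler (\<lambda>u v. ?a u * ?b v) \<rho>"
      using X_mult_inc[OF z] less.prems by (metis char_group_mult_apply)
    also have "\<dots> = sweedler (\<lambda>u v. (if u = {#} then ?b v else 0) + (if u = {#} then 0 else ?a u * ?b v)) \<rho>"
      using char_groupD(1)[OF X_in_G[OF z(1,2)]]
      by (intro arg_cong[where f = "\<lambda>G. sweedler G _"]) (auto simp: fun_eq_iff)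
    also have "\<dots> = ?b \<rho> + sweedler (\<lambda>u v. if u = {#} then 0 else ?a u * ?b v) \<rho>"
      by (simp add: sweedler_add sweedler_counit_left)
    also have "sweedler (\<lambda>u v. if u = {#} then 0 else ?a u * ?b v) \<rho> =
        (\<Sum>k\<in>?k. Poly_Mapping.lookup (coproduct \<rho>) k * (?a (fst k) * ?b (snd k)))"
      unfolding sweedler_def eval_tensor_def by (rule sum.mono_neutral_cong_right) auto
    finally show ?thesis by simp
  qed
  have "continuous_on ?S (\<lambda>z. X (snd z) \<rho> - (\<Sum>k\<in>?k. Poly_Mapping.lookup (coproduct \<rho>) k *
      (X (fst z) (fst k) * inc (fst z) (snd z) (snd k))))"
    by (intro continuous_intros X' IH)
  then show ?case using eq by (simp cong: continuous_on_cong)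
qed

lemma continuous_N: "continuous_on ({0..T} \<times> {0..T}) (\<lambda>(u, v). N u v)"
proof -
  have "continuous_on ({0..T} \<times> {0..T}) (\<lambda>z. char_norm d n (inc (fst z) (snd z)))"
    unfolding char_norm_def
  proof (rule continuous_on_Max[OF F_finite_nonempty])
    fix \<rho> assume \<rho>: "\<rho> \<in> F"
    then have "continuous_on ({0..T} \<times> {0..T}) (\<lambda>z. \<bar>inc (fst z) (snd z) \<rho>\<bar>)"
      by (intro continuous_on_rabs continuous_inc) (auto simp: forests_upto_def)
    then show "continuous_on ({0..T} \<times> {0..T}) (\<lambda>z. \<bar>inc (fst z) (snd z) \<rho>\<bar> powr (1 / real (fdeg \<rho>)))"
      using deg_F[OF \<rho>] by (intro continuous_on_powr') auto
  qed
  then have "continuous_on ({0..T} \<times> {0..T}) (\<lambda>z. N (fst z) (snd z))"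
    unfolding N_def using p_ge_1 char_norm_nonneg[OF d_ge_1 n_ge_1] by (intro continuous_on_powr') auto
  then show ?thesis by (simp add: case_prod_beta)
qed

sublocale variation N \<omega> T
proof
  show "N s s = 0" if "0 \<le> s" "s \<le> T" for s using that by (rule N_refl)
  show "partition_sum N D \<le> \<omega> s t" if "0 \<le> s" "t \<le> T" "is_partition s t D" for s t D
    using that by (rule partition_sum_le_control)
  show "\<omega> s t \<le> c" if "0 \<le> s" "s \<le> t" "t \<le> T" "\<And>D. is_partition s t D \<Longrightarrow> partition_sum N D \<le> c" for s t c
    using that(2,4) by (rule control_le)
qed (rule N_nonneg continuous_N)+

text \<open>A natural power covers the empty forest even where the control vanishes:
  \<open>0 ^ 0 = 1\<close>, whereas \<open>0 powr 0 = 0\<close>.\<close>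

lemma inc_bound:
  assumes "0 \<le> s" "s \<le> t" "t \<le> T" "\<rho> \<in> forests d" "fdeg \<rho> \<le> n"
  shows "\<bar>inc s t \<rho>\<bar> \<le> (\<omega> s t powr (1 / p)) ^ fdeg \<rho>"
proof (cases "\<rho> = {#}")
  case True
  then show ?thesis using char_groupD(1)[OF inc_in_G] assms by simp
next
  case False
  then have \<rho>: "\<rho> \<in> F" using assms forests_upto_iff by blast
  have norm: "0 \<le> char_norm d n (inc s t)" by (rule char_norm_nonneg[OF d_ge_1 n_ge_1])
  have "char_norm d n (inc s t) = N s t powr (1 / p)"
    using p_ge_1 norm by (simp add: N_def powr_powr)
  also have "\<dots> \<le> \<omega> s t powr (1 / p)"
    using N_le_V assms N_nonneg p_ge_1 by (intro powr_mono2) auto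
  finally have "char_norm d n (inc s t) ^ fdeg \<rho> \<le> (\<omega> s t powr (1 / p)) ^ fdeg \<rho>"
    using norm by (rule power_mono)
  then show ?thesis using abs_le_char_norm_power[OF \<rho>, of "inc s t"] by simp
qed

end

section \<open>The product of two slowly-varying one-forms\<close>

text \<open>Dominates every power of a number in \<open>[0, w]\<close> with exponent between 0 and
  \<open>\<theta> + 2\<close>, a range that covers all differences of exponents compared below. The
  maximum with 1 makes the bound monotone in the exponent.\<close>

definition power_const :: "real \<Rightarrow> real \<Rightarrow> real" where
  "power_const \<theta> w = max 1 w powr (\<theta> + 2)"

definition sewing_const :: "real \<Rightarrow> real" where
  "sewing_const \<theta> = 2 / (1 - 2 powr (1 - \<theta>))"

text \<open>The integral starts at zero, so it is bounded by the value of the one-form at time 0 on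
  the increment, plus the sewing error; these account for the two summands of
  \<open>1 + sewing_const \<theta>\<close>.\<close>

definition integral_const :: "nat \<Rightarrow> nat \<Rightarrow> real \<Rightarrow> real \<Rightarrow> real" where
  "integral_const d n \<theta> w = (1 + sewing_const \<theta>) * real (card (forests_upto d n)) * power_const \<theta> w"

definition sup_const :: "nat \<Rightarrow> nat \<Rightarrow> real \<Rightarrow> real \<Rightarrow> real" where
  "sup_const d n \<theta> w = integral_const d n \<theta> w + (\<Sum>\<rho>\<in>forests_upto d n. \<Sum>\<tau>\<in>trees_upto d n. 1)"

text \<open>One summand for each of the four terms into which the increment of the product is split,
  in the same order; \<open>w\<close> stands for \<omega>(0,T).\<close>

definition variation_const :: "nat \<Rightarrow> nat \<Rightarrow> real \<Rightarrow> real \<Rightarrow> real" where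
  "variation_const d n \<theta> w =
    sewing_const \<theta> * real (card (forests_upto d n)) * power_const \<theta> w
    + (integral_const d n \<theta> w + real (card (forests_upto d n)) * power_const \<theta> w)
    + (\<Sum>\<rho>\<in>forests_upto d n. \<Sum>\<tau>\<in>trees_upto d n. power_const \<theta> w * (2 + power_const \<theta> w))
    + (\<Sum>\<rho>\<in>forests_upto d n. \<Sum>\<tau>\<in>trees_upto d n.
        coproduct_size \<rho> * (\<Sum>\<tau>'\<in>trees_upto d n. coproduct_size {#\<tau>#} * power_const \<theta> w))"

locale rough_integration = rough_path +
  fixes \<theta> :: real
  assumes \<theta>_gt_1: "1 < \<theta>" and \<theta>_le: "\<theta> \<le> (real (step p) + 1) / p"
begin

abbreviation "M \<equiv> power_const \<theta> (\<omega> 0 T)"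

definition weight :: "real \<Rightarrow> real \<Rightarrow> forest \<Rightarrow> real" where
  "weight s t \<gamma> = \<omega> s t powr (\<theta> - real (fdeg \<gamma>) / p)"

text \<open>A bound \<open>r\<close> on both parts of the norm, in real numbers and multiplied out,
  so that intervals on which the control vanishes involve no division.\<close>

definition bounded_along :: "real \<Rightarrow> (real \<Rightarrow> form) \<Rightarrow> bool" where
  "bounded_along r \<beta> \<longleftrightarrow>
    (\<forall>t. 0 \<le> t \<and> t \<le> T \<longrightarrow> \<beta> t \<in> forms d n \<and> (\<forall>\<gamma>\<in>F. \<bar>coeffs d n (\<beta> t) \<gamma>\<bar> \<le> r)) \<and>
    (\<forall>s t. 0 \<le> s \<and> s < t \<and> t \<le> T \<longrightarrow> (\<forall>\<gamma>\<in>F.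
      \<bar>coeffs d n (\<lambda>c. \<beta> t c - translate d n (\<beta> s) (inc s t) c) \<gamma>\<bar> \<le> r * weight s t \<gamma>))"

lemma weight_nonneg [simp]: "0 \<le> weight s t \<gamma>"
  by (simp add: weight_def)

lemma control_bounds:
  assumes "0 \<le> s" "s \<le> t" "t \<le> T"
  shows "0 \<le> \<omega> s t" "\<omega> s t \<le> \<omega> 0 T"
  using assms V_nonneg[of s t] V_mono[of 0 s t T] by auto

lemma M_ge_1: "1 \<le> M"
  unfolding power_const_def using \<theta>_gt_1 by (intro ge_one_powr_ge_zero) auto

lemma powr_le_M:
  assumes "0 \<le> W" "W \<le> \<omega> 0 T" "0 \<le> a" "a \<le> \<theta> + 2"
  shows "W powr a \<le> M"
proof -
  have "W powr a \<le> max 1 (\<omega> 0 T) powr a" using assms by (intro powr_mono2) auto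
  also have "\<dots> \<le> M" unfolding power_const_def using assms by (intro powr_mono) auto
  finally show ?thesis .
qed

text \<open>The comparison behind all weighted estimates: for small \<open>W\<close> the larger
  exponent gives the smaller power, and \<open>M\<close> pays for \<open>W\<close> above 1.\<close>

lemma powr_le_M_powr:
  assumes "0 \<le> W" "W \<le> \<omega> 0 T" "b \<le> a" "a \<le> b + \<theta> + 2"
  shows "W powr a \<le> M * W powr b"
proof -
  have "W powr a = W powr (a - b) * W powr b" by (simp add: powr_add[symmetric])
  also have "\<dots> \<le> M * W powr b" using assms by (intro mult_right_mono powr_le_M) auto
  finally show ?thesis .
qed

lemma deg_div_p:
  assumes "k \<le> n"
  shows "0 \<le> real k / p" "real k / p \<le> 1"
  using assms p_ge_1 n_le_p by auto

lemma weight_exponent_pos: "\<gamma> \<in> F \<Longrightarrow> 0 < \<theta> - real (fdeg \<gamma>) / p"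
  using deg_div_p[of "fdeg \<gamma>"] deg_F[of \<gamma>] \<theta>_gt_1 by simp

lemma power_control_eq:
  "0 < k \<Longrightarrow> (\<omega> s t powr (1 / p)) ^ k = \<omega> s t powr (real k / p)"
  by (cases "\<omega> s t = 0") (simp_all add: powr_power)

lemma inc_le_M:
  assumes "0 \<le> s" "s \<le> t" "t \<le> T" "\<rho> \<in> F"
  shows "\<bar>inc s t \<rho>\<bar> \<le> M"
proof -
  have "\<bar>inc s t \<rho>\<bar> \<le> (\<omega> s t powr (1 / p)) ^ fdeg \<rho>"
    using inc_bound assms by (simp add: forests_upto_def)
  also have "\<dots> = \<omega> s t powr (real (fdeg \<rho>) / p)" using deg_F[OF assms(4)] by (intro power_control_eq) linarith
  also have "\<dots> \<le> M"
    using deg_div_p[of "fdeg \<rho>"] deg_F[OF assms(4)] control_bounds assms \<theta>_gt_1 by (intro powr_le_M) auto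
  finally show ?thesis .
qed

lemma bounded_alongD:
  assumes "bounded_along r \<beta>"
  shows "\<lbrakk>0 \<le> t; t \<le> T\<rbrakk> \<Longrightarrow> \<beta> t \<in> forms d n"
    and "\<lbrakk>0 \<le> t; t \<le> T; \<gamma> \<in> F\<rbrakk> \<Longrightarrow> \<bar>coeffs d n (\<beta> t) \<gamma>\<bar> \<le> r"
    and "\<lbrakk>0 \<le> s; s < t; t \<le> T; \<gamma> \<in> F\<rbrakk> \<Longrightarrow>
      \<bar>coeffs d n (\<lambda>c. \<beta> t c - translate d n (\<beta> s) (inc s t) c) \<gamma>\<bar> \<le> r * weight s t \<gamma>"
    and "\<lbrakk>0 \<le> s; s \<le> T; 0 \<le> t; t \<le> T\<rbrakk> \<Longrightarrow> translate d n (\<beta> s) (inc s t) \<in> forms d n"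
  using assms translate_in_forms inc_in_G unfolding bounded_along_def by auto

lemma bounded_along_nonneg:
  assumes "bounded_along r \<beta>"
  shows "0 \<le> r"
proof -
  obtain \<gamma> where "\<gamma> \<in> F" using F_finite_nonempty by blast
  then have "\<bar>coeffs d n (\<beta> 0) \<gamma>\<bar> \<le> r" using bounded_alongD(2)[OF assms] T_pos by simp
  then show ?thesis by simp
qed

lemma bounded_along_apply:
  assumes \<beta>: "bounded_along r \<beta>" and st: "0 \<le> s" "s \<le> t" "t \<le> T"
  shows "\<bar>\<beta> s (inc s t)\<bar> \<le> real (card F) * M * r"
proof -
  have "\<beta> s (inc s t) = (\<Sum>\<rho>\<in>F. coeffs d n (\<beta> s) \<rho> * inc s t \<rho>)"
    using represents_coeffs[OF bounded_alongD(1)[OF \<beta>]] inc_in_G st by (simp add: represents_def)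
  also have "\<bar>\<dots>\<bar> \<le> (\<Sum>\<rho>\<in>F. r * M)"
    using bounded_alongD(2)[OF \<beta>] inc_le_M bounded_along_nonneg[OF \<beta>] st
    by (intro order_trans[OF sum_abs] sum_mono) (simp add: abs_mult mult_mono)
  finally show ?thesis by (simp add: mult_ac)
qed

text \<open>By the multiplicativity of increments, the defect is up to sign the difference of
  \<open>\<beta> u\<close> and the translate of \<open>\<beta> s\<close>, evaluated at
  \<open>inc u t\<close>. A coefficient of degree k is of order \<theta> - k/p in the control and
  the coordinate of order k/p, so every product has order \<theta>.\<close>

lemma bounded_along_defect:
  assumes \<beta>: "bounded_along r \<beta>" and sut: "0 \<le> s" "s \<le> u" "u \<le> t" "t \<le> T"
  shows "\<bar>\<beta> s (inc s t) - \<beta> s (inc s u) - \<beta> u (inc u t)\<bar> \<le> real (card F) * r * \<omega> s t powr \<theta>"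
proof (cases "s = u")
  \<comment> \<open>Slow variation speaks only of \<open>s < u\<close>, so the diagonal is treated
    directly: the increment is the unit, whose coordinates of positive degree vanish.\<close>
  case True
  have "\<beta> u (inc u u) = (\<Sum>\<rho>\<in>F. coeffs d n (\<beta> u) \<rho> * inc u u \<rho>)"
    using represents_coeffs[OF bounded_alongD(1)[OF \<beta>]] inc_in_G sut by (simp add: represents_def)
  also have "\<dots> = 0"
    using sut by (intro sum.neutral ballI) (auto simp: inc_refl counit_def forests_upto_def)
  finally show ?thesis using True bounded_along_nonneg[OF \<beta>] by simp
next
  case False
  let ?D = "\<lambda>c. \<beta> u c - translate d n (\<beta> s) (inc s u) c"
  have "?D \<in> forms d n"
    using bounded_alongD(1,4)[OF \<beta>] sut by (intro diff_in_forms) auto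
  from represents_coeffs[OF this] have "?D (inc u t) = (\<Sum>\<rho>\<in>F. coeffs d n ?D \<rho> * inc u t \<rho>)"
    using inc_in_G sut by (simp add: represents_def)
  moreover have "?D (inc u t) = - (\<beta> s (inc s t) - \<beta> s (inc s u) - \<beta> u (inc u t))"
    using sut by (simp add: translate_def inc_mult)
  moreover have "\<bar>\<Sum>\<rho>\<in>F. coeffs d n ?D \<rho> * inc u t \<rho>\<bar> \<le> (\<Sum>\<rho>\<in>F. r * \<omega> s t powr \<theta>)"
  proof (intro order_trans[OF sum_abs] sum_mono)
    fix \<rho> assume \<rho>: "\<rho> \<in> F"
    let ?k = "real (fdeg \<rho>) / p"
    have r: "0 \<le> r" using bounded_along_nonneg[OF \<beta>] .
    have mono: "\<omega> s u \<le> \<omega> s t" "\<omega> u t \<le> \<omega> s t" "0 \<le> \<omega> s u" "0 \<le> \<omega> u t"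
      using V_mono[of s s u t] V_mono[of s u t t] control_bounds sut by auto
    have "\<bar>coeffs d n ?D \<rho>\<bar> \<le> r * \<omega> s u powr (\<theta> - ?k)"
      using bounded_alongD(3)[OF \<beta>, of s u \<rho>] False sut \<rho> by (simp add: weight_def)
    also have "\<dots> \<le> r * \<omega> s t powr (\<theta> - ?k)"
      using weight_exponent_pos[OF \<rho>] mono r by (intro mult_left_mono powr_mono2) auto
    finally have 1: "\<bar>coeffs d n ?D \<rho>\<bar> \<le> r * \<omega> s t powr (\<theta> - ?k)" .
    have "\<bar>inc u t \<rho>\<bar> \<le> (\<omega> u t powr (1 / p)) ^ fdeg \<rho>"
      using inc_bound sut \<rho> by (simp add: forests_upto_def)
    also have "\<dots> = \<omega> u t powr ?k" using deg_F[OF \<rho>] by (intro power_control_eq) linarith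
    also have "\<dots> \<le> \<omega> s t powr ?k"
      using mono p_ge_1 by (intro powr_mono2) auto
    finally have 2: "\<bar>inc u t \<rho>\<bar> \<le> \<omega> s t powr ?k" .
    have "\<bar>coeffs d n ?D \<rho> * inc u t \<rho>\<bar> \<le> (r * \<omega> s t powr (\<theta> - ?k)) * \<omega> s t powr ?k"
      unfolding abs_mult using 1 2 r by (intro mult_mono) auto
    also have "\<dots> = r * \<omega> s t powr \<theta>" by (simp add: mult.assoc powr_add[symmetric])
    finally show "\<bar>coeffs d n ?D \<rho> * inc u t \<rho>\<bar> \<le> r * \<omega> s t powr \<theta>" .
  qed
  ultimately show ?thesis by simp
qed

lemma sewing_bounded_along:
  assumes "bounded_along r \<beta>"
  shows "sewing (\<lambda>s t. \<beta> s (inc s t)) \<omega> T (real (card F) * r) \<theta>"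
proof
  fix s assume "0 \<le> s" "s \<le> T"
  \<comment> \<open>With all three points equal the defect is minus the value itself, and the
    control on the right is zero.\<close>
  then have "\<bar>\<beta> s (inc s s) - \<beta> s (inc s s) - \<beta> s (inc s s)\<bar> \<le> real (card F) * r * \<omega> s s powr \<theta>"
    using bounded_along_defect[OF assms, of s s s] by simp
  then show "\<beta> s (inc s s) = 0" using V_refl \<open>0 \<le> s\<close> \<open>s \<le> T\<close> by simp
next
  show "0 \<le> real (card F) * r" using bounded_along_nonneg[OF assms] by simp
qed (use V_superadd V_nonneg V_small bounded_along_defect[OF assms] \<theta>_gt_1 in auto)

lemma integral_bounds:
  assumes \<beta>: "bounded_along r \<beta>"
  shows "\<lbrakk>0 \<le> s; s \<le> t; t \<le> T\<rbrakk> \<Longrightarrow>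
      \<bar>form_integral p d X \<beta> t - form_integral p d X \<beta> s - \<beta> s (inc s t)\<bar>
        \<le> sewing_const \<theta> * real (card F) * r * \<omega> s t powr \<theta>"
    and "\<lbrakk>0 \<le> t; t \<le> T\<rbrakk> \<Longrightarrow> \<bar>form_integral p d X \<beta> t\<bar> \<le> integral_const d n \<theta> (\<omega> 0 T) * r"
proof -
  interpret sewing "\<lambda>s t. \<beta> s (inc s t)" \<omega> T "real (card F) * r" \<theta>
    by (rule sewing_bounded_along[OF \<beta>])
  have J: "J = form_integral p d X \<beta>" by (simp add: fun_eq_iff J_def form_integral_def)
  have K: "K = sewing_const \<theta> * real (card F) * r" by (simp add: K_def sewing_const_def)
  show *: "\<bar>form_integral p d X \<beta> t - form_integral p d X \<beta> s - \<beta> s (inc s t)\<bar>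
        \<le> sewing_const \<theta> * real (card F) * r * \<omega> s t powr \<theta>" if "0 \<le> s" "s \<le> t" "t \<le> T" for s t
    using J_increment[OF that] by (simp only: J K)
  assume t: "0 \<le> t" "t \<le> T"
  have "\<omega> 0 t powr \<theta> \<le> M" using t control_bounds \<theta>_gt_1 by (intro powr_le_M) auto
  then have "sewing_const \<theta> * real (card F) * r * \<omega> 0 t powr \<theta> \<le> sewing_const \<theta> * real (card F) * r * M"
    using K_nonneg unfolding K by (rule mult_left_mono)
  moreover have "form_integral p d X \<beta> 0 = 0" using J_0 T_pos J by simp
  moreover have "integral_const d n \<theta> (\<omega> 0 T) * r =
      real (card F) * M * r + sewing_const \<theta> * real (card F) * r * M"
    by (simp add: integral_const_def algebra_simps)
  ultimately show "\<bar>form_integral p d X \<beta> t\<bar> \<le> integral_const d n \<theta> (\<omega> 0 T) * r"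
    using *[of 0 t] bounded_along_apply[OF \<beta>, of 0 t] t by linarith
qed

section \<open>Comparison of weights of different degrees\<close>

lemma control_le_weight:
  assumes "0 \<le> s" "s \<le> t" "t \<le> T" "\<gamma> \<in> F"
  shows "\<omega> s t powr \<theta> \<le> M * weight s t \<gamma>"
  unfolding weight_def using assms control_bounds deg_div_p[of "fdeg \<gamma>"] deg_F[of \<gamma>] \<theta>_gt_1
  by (intro powr_le_M_powr) auto

lemma weight_le_M:
  assumes "0 \<le> s" "s \<le> t" "t \<le> T" "\<gamma> \<in> F"
  shows "weight s t \<gamma> \<le> M"
  unfolding weight_def using assms control_bounds deg_div_p[of "fdeg \<gamma>"] deg_F[of \<gamma>] weight_exponent_pos[of \<gamma>]
  by (intro powr_le_M) auto

text \<open>A coefficient at \<open>\<rho>\<close> or \<open>\<tau>\<close> reappears at the tree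
  \<open>\<rho> \<succ> \<tau>\<close> of larger degree, where the required exponent is smaller; the
  surplus decay is traded for the factor \<open>M\<close>.\<close>

lemma weight_antimono:
  assumes "0 \<le> s" "s \<le> t" "t \<le> T" "fdeg \<rho> \<le> fdeg \<gamma>" "fdeg \<gamma> \<le> n"
  shows "weight s t \<rho> \<le> M * weight s t \<gamma>"
proof -
  have "real (fdeg \<rho>) / p \<le> real (fdeg \<gamma>) / p" using assms p_ge_1 by (intro divide_right_mono) auto
  then show ?thesis
    unfolding weight_def using assms control_bounds deg_div_p[of "fdeg \<gamma>"] deg_div_p[of "fdeg \<rho>"] \<theta>_gt_1
    by (intro powr_le_M_powr) auto
qed

text \<open>This is where the bound \<open>\<theta> \<le> ([p] + 1) / p\<close> is used.\<close>

lemma power_control_le_weight: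
  assumes st: "0 \<le> s" "s \<le> t" "t \<le> T"
    and k: "n < k + fdeg \<gamma>" "k + fdeg \<gamma> \<le> 2 * n" "fdeg \<gamma> \<le> n"
  shows "(\<omega> s t powr (1 / p)) ^ k \<le> M * weight s t \<gamma>"
proof -
  have "real n + 1 \<le> real k + real (fdeg \<gamma>)" using k by linarith
  then have "(real n + 1) / p \<le> real k / p + real (fdeg \<gamma>) / p"
    using p_ge_1 by (simp add: divide_right_mono flip: add_divide_distrib)
  moreover have "\<theta> \<le> (real n + 1) / p" using \<theta>_le by (simp add: n_def)
  moreover have "real k / p + real (fdeg \<gamma>) / p \<le> 2"
    using k(2) n_le_p p_ge_1 by (simp add: add_divide_distrib[symmetric] divide_le_eq)
  ultimately have "\<omega> s t powr (real k / p) \<le> M * weight s t \<gamma>"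
    unfolding weight_def using st control_bounds \<theta>_gt_1 by (intro powr_le_M_powr) auto
  moreover have "0 < k" using k by linarith
  ultimately show ?thesis by (simp add: power_control_eq)
qed

text \<open>A term with cuts \<open>(u, v)\<close> of \<open>\<rho>\<close> and surviving tree
  \<open>\<tau>'\<close> carries order \<open>|u| + |\<tau>| - |\<tau>'|\<close> in
  \<open>\<omega> powr (1 / p)\<close> and lands at a tree of degree \<open>|v| + |\<tau>'|\<close>.
  The two numbers add up to \<open>|\<rho>| + |\<tau>|\<close>, which exceeds \<open>n\<close>, and
  this is the situation of \<open>power_control_le_weight\<close>.\<close>

lemma graft_translation_bound:
  assumes st: "0 \<le> s" "s \<le> t" "t \<le> T" and \<rho>: "\<rho> \<in> F" and \<tau>: "\<tau> \<in> Tr" and deg: "n < fdeg \<rho> + tdeg \<tau>"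
  shows "bounded_form d n (weight s t)
    (coproduct_size \<rho> * (\<Sum>\<tau>'\<in>Tr. coproduct_size {#\<tau>#} * M))
    (\<lambda>c. sweedler (\<lambda>u v. inc s t u * graft_translation d n (inc s t) \<tau> v c) \<rho>)"
proof (rule bounded_form_sweedler)
  let ?b = "inc s t" and ?w = "\<omega> s t powr (1 / p)"
  show "\<rho> \<in> forests d" using \<rho> by (simp add: forests_upto_def)
  fix u v :: forest
  assume uv: "u \<in> forests d" "v \<in> forests d" "fdeg u + fdeg v = fdeg \<rho>"
  have \<rho>_deg: "fdeg \<rho> \<le> n" and \<tau>_deg: "tdeg \<tau> \<le> n" "\<tau> \<in> trees d"
    using \<rho> \<tau> by (auto simp: forests_upto_def trees_upto_def)
  have "bounded_form d n (weight s t) (\<Sum>\<tau>'\<in>Tr. coproduct_size {#\<tau>#} * M)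
      (\<lambda>c. \<Sum>\<tau>'\<in>Tr. (?b u * translation_coeff ?b {#\<tau>#} {#\<tau>'#}) * c {#graft v \<tau>'#})"
  proof (intro bounded_form_sum bounded_form_tree)
    fix \<tau>' assume \<tau>': "\<tau>' \<in> Tr"
    then show "graft v \<tau>' \<in> trees d" using uv by (simp add: trees_upto_def)
    assume g: "tdeg (graft v \<tau>') \<le> n"
    show "\<bar>?b u * translation_coeff ?b {#\<tau>#} {#\<tau>'#}\<bar> \<le> coproduct_size {#\<tau>#} * M * weight s t {#graft v \<tau>'#}"
    proof (cases "tdeg \<tau> < tdeg \<tau>'")
      case True
      then have "translation_coeff ?b {#\<tau>#} {#\<tau>'#} = 0" by (intro translation_coeff_eq_0) simp
      then show ?thesis using coproduct_size_nonneg M_ge_1 by simp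
    next
      case False
      let ?k = "tdeg \<tau> - tdeg \<tau>'"
      have "\<bar>translation_coeff ?b {#\<tau>#} {#\<tau>'#}\<bar> \<le> coproduct_size {#\<tau>#} * ?w ^ ?k"
        unfolding translation_coeff_def
      proof (rule abs_sweedler_le)
        fix x y :: forest assume xy: "x \<in> forests d" "fdeg x + fdeg y = fdeg {#\<tau>#}"
        show "\<bar>if y = {#\<tau>'#} then ?b x else 0\<bar> \<le> ?w ^ ?k"
        proof (cases "y = {#\<tau>'#}")
          case True
          then have "fdeg x = ?k" using xy by simp
          with True show ?thesis using inc_bound[OF st xy(1)] \<tau>_deg by simp
        qed simp
      qed (use \<tau>_deg in simp)
      moreover have "\<bar>?b u\<bar> \<le> ?w ^ fdeg u" using inc_bound[OF st uv(1)] uv(3) \<rho>_deg by simp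
      ultimately have "\<bar>?b u * translation_coeff ?b {#\<tau>#} {#\<tau>'#}\<bar> \<le>
          ?w ^ fdeg u * (coproduct_size {#\<tau>#} * ?w ^ ?k)"
        unfolding abs_mult by (intro mult_mono) auto
      also have "\<dots> = coproduct_size {#\<tau>#} * ?w ^ (fdeg u + ?k)" by (simp add: power_add)
      also have "\<dots> \<le> coproduct_size {#\<tau>#} * (M * weight s t {#graft v \<tau>'#})"
        using False uv(3) deg g \<rho>_deg \<tau>_deg coproduct_size_nonneg
        by (intro mult_left_mono power_control_le_weight st) auto
      finally show ?thesis by (simp add: mult.assoc)
    qed
  qed (use coproduct_size_nonneg M_ge_1 in auto)
  then show "bounded_form d n (weight s t) (\<Sum>\<tau>'\<in>Tr. coproduct_size {#\<tau>#} * M)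
      (\<lambda>c. ?b u * graft_translation d n ?b \<tau> v c)"
    by (simp add: graft_translation_def sum_distrib_left mult.assoc)
qed

section \<open>The sup bound and the increment bound for the product form\<close>

context
  fixes \<beta>\<^sub>1 \<beta>\<^sub>2 :: "real \<Rightarrow> form" and r\<^sub>1 r\<^sub>2 :: real
  assumes \<beta>\<^sub>1: "bounded_along r\<^sub>1 \<beta>\<^sub>1" and \<beta>\<^sub>2: "bounded_along r\<^sub>2 \<beta>\<^sub>2"
    and only: "\<And>t. \<lbrakk>0 \<le> t; t \<le> T\<rbrakk> \<Longrightarrow> only_trees d n (\<beta>\<^sub>2 t)"
begin

lemma nonneg: "0 \<le> r\<^sub>1" "0 \<le> r\<^sub>2"
  using bounded_along_nonneg \<beta>\<^sub>1 \<beta>\<^sub>2 by auto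

lemma product_form_eq: "product_form p d X \<beta>\<^sub>1 \<beta>\<^sub>2 t a =
    form_integral p d X \<beta>\<^sub>1 t * \<beta>\<^sub>2 t a + form_succ d n (\<beta>\<^sub>1 t) (\<beta>\<^sub>2 t) a"
  by (simp add: product_form_def n_def)

lemma product_form_sup_bound:
  assumes t: "0 \<le> t" "t \<le> T"
  shows "bounded_form d n (\<lambda>_. 1) (sup_const d n \<theta> (\<omega> 0 T) * (r\<^sub>1 * r\<^sub>2)) (product_form p d X \<beta>\<^sub>1 \<beta>\<^sub>2 t)"
proof -
  let ?I = "form_integral p d X \<beta>\<^sub>1 t"
  have I: "bounded_form d n (\<lambda>_. 1) (integral_const d n \<theta> (\<omega> 0 T) * r\<^sub>1 * r\<^sub>2) (\<lambda>c. ?I * \<beta>\<^sub>2 t c)"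
  proof (rule bounded_form_scale)
    fix \<gamma> assume "\<gamma> \<in> F"
    then have "\<bar>?I\<bar> * \<bar>coeffs d n (\<beta>\<^sub>2 t) \<gamma>\<bar> \<le> (integral_const d n \<theta> (\<omega> 0 T) * r\<^sub>1) * r\<^sub>2"
      using integral_bounds(2)[OF \<beta>\<^sub>1 t] bounded_alongD(2)[OF \<beta>\<^sub>2 t] nonneg by (intro mult_mono) auto
    then show "\<bar>?I\<bar> * \<bar>coeffs d n (\<beta>\<^sub>2 t) \<gamma>\<bar> \<le> integral_const d n \<theta> (\<omega> 0 T) * r\<^sub>1 * r\<^sub>2 * 1" by simp
  qed (use bounded_alongD(1)[OF \<beta>\<^sub>2 t] in simp)
  have S: "bounded_form d n (\<lambda>_. 1) (\<Sum>\<rho>\<in>F. \<Sum>\<tau>\<in>Tr. r\<^sub>1 * r\<^sub>2) (\<lambda>c. \<Sum>\<rho>\<in>F. \<Sum>\<tau>\<in>Tr.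
      (coeffs d n (\<beta>\<^sub>1 t) \<rho> * coeffs d n (\<beta>\<^sub>2 t) {#\<tau>#}) * c {#graft \<rho> \<tau>#})"
  proof (intro bounded_form_sum bounded_form_tree)
    fix \<rho> \<tau> assume \<rho>: "\<rho> \<in> F" and \<tau>: "\<tau> \<in> Tr"
    then show "graft \<rho> \<tau> \<in> trees d" by (simp add: forests_upto_def trees_upto_def)
    have "{#\<tau>#} \<in> F" using \<tau> by simp
    then show "\<bar>coeffs d n (\<beta>\<^sub>1 t) \<rho> * coeffs d n (\<beta>\<^sub>2 t) {#\<tau>#}\<bar> \<le> r\<^sub>1 * r\<^sub>2 * 1"
      using bounded_alongD(2)[OF \<beta>\<^sub>1 t \<rho>] bounded_alongD(2)[OF \<beta>\<^sub>2 t] nonneg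
      by (simp add: abs_mult mult_mono)
  qed (use nonneg in auto)
  have "bounded_form d n (\<lambda>_. 1) (integral_const d n \<theta> (\<omega> 0 T) * r\<^sub>1 * r\<^sub>2 + (\<Sum>\<rho>\<in>F. \<Sum>\<tau>\<in>Tr. r\<^sub>1 * r\<^sub>2))
      (product_form p d X \<beta>\<^sub>1 \<beta>\<^sub>2 t)"
    by (rule bounded_form_cong[OF bounded_form_add[OF I S]]) (simp add: product_form_eq form_succ_apply)
  then show ?thesis by (simp add: sup_const_def algebra_simps)
qed

lemma product_form_increment_bound:
  assumes st: "0 \<le> s" "s < t" "t \<le> T"
  shows "bounded_form d n (weight s t) (variation_const d n \<theta> (\<omega> 0 T) * (r\<^sub>1 * r\<^sub>2))
    (\<lambda>c. product_form p d X \<beta>\<^sub>1 \<beta>\<^sub>2 t c - translate d n (product_form p d X \<beta>\<^sub>1 \<beta>\<^sub>2 s) (inc s t) c)"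
proof -
  let ?b = "inc s t" and ?I = "form_integral p d X \<beta>\<^sub>1" and ?h = "weight s t"
  let ?f1 = "coeffs d n (\<beta>\<^sub>1 t)" and ?f2 = "coeffs d n (\<beta>\<^sub>2 t)"
  let ?g1 = "coeffs d n (translate d n (\<beta>\<^sub>1 s) ?b)" and ?g2 = "coeffs d n (translate d n (\<beta>\<^sub>2 s) ?b)"
  have st': "0 \<le> s" "s \<le> t" "t \<le> T" "s \<le> T" "0 \<le> t" using st by auto
  have b: "?b \<in> carrier G" using inc_in_G st' by simp
  have forms: "\<beta>\<^sub>1 s \<in> forms d n" "\<beta>\<^sub>2 s \<in> forms d n" "\<beta>\<^sub>1 t \<in> forms d n" "\<beta>\<^sub>2 t \<in> forms d n"
    using bounded_alongD(1) \<beta>\<^sub>1 \<beta>\<^sub>2 st' by auto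
  note trans = translate_in_forms[OF forms(1) b] translate_in_forms[OF forms(2) b]
  have diff1: "\<bar>?f1 \<gamma> - ?g1 \<gamma>\<bar> \<le> r\<^sub>1 * ?h \<gamma>" if "\<gamma> \<in> F" for \<gamma>
    using bounded_alongD(3)[OF \<beta>\<^sub>1 st that] coeffs_diff[OF forms(3) trans(1) that] by simp
  have diff2: "\<bar>?f2 \<gamma> - ?g2 \<gamma>\<bar> \<le> r\<^sub>2 * ?h \<gamma>" if "\<gamma> \<in> F" for \<gamma>
    using bounded_alongD(3)[OF \<beta>\<^sub>2 st that] coeffs_diff[OF forms(4) trans(2) that] by simp
  let ?C1 = "sewing_const \<theta> * real (card F) * M"
  let ?C2 = "integral_const d n \<theta> (\<omega> 0 T) + real (card F) * M"
  have 1: "bounded_form d n ?h (?C1 * (r\<^sub>1 * r\<^sub>2)) (\<lambda>c. (?I t - ?I s - \<beta>\<^sub>1 s ?b) * \<beta>\<^sub>2 t c)"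
  proof (rule bounded_form_scale[OF forms(4)])
    fix \<gamma> assume \<gamma>: "\<gamma> \<in> F"
    have sc: "0 \<le> sewing_const \<theta>"
      using \<theta>_gt_1 powr_less_one[of 2 "1 - \<theta>"] by (simp add: sewing_const_def)
    have "\<bar>?I t - ?I s - \<beta>\<^sub>1 s ?b\<bar> \<le> sewing_const \<theta> * real (card F) * r\<^sub>1 * \<omega> s t powr \<theta>"
      using integral_bounds(1)[OF \<beta>\<^sub>1] st' by blast
    also have "\<dots> \<le> sewing_const \<theta> * real (card F) * r\<^sub>1 * (M * ?h \<gamma>)"
      using control_le_weight[OF st'(1-3) \<gamma>] sc nonneg by (intro mult_left_mono) auto
    finally have "\<bar>?I t - ?I s - \<beta>\<^sub>1 s ?b\<bar> * \<bar>?f2 \<gamma>\<bar> \<le> (sewing_const \<theta> * real (card F) * r\<^sub>1 * (M * ?h \<gamma>)) * r\<^sub>2"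
      using bounded_alongD(2)[OF \<beta>\<^sub>2 st'(5,3) \<gamma>] by (intro mult_mono) auto
    then show "\<bar>?I t - ?I s - \<beta>\<^sub>1 s ?b\<bar> * \<bar>?f2 \<gamma>\<bar> \<le> ?C1 * (r\<^sub>1 * r\<^sub>2) * ?h \<gamma>"
      by (simp add: mult_ac)
  qed
  have 2: "bounded_form d n ?h (?C2 * (r\<^sub>1 * r\<^sub>2))
      (\<lambda>c. (?I s + \<beta>\<^sub>1 s ?b) * (\<beta>\<^sub>2 t c - translate d n (\<beta>\<^sub>2 s) ?b c))"
  proof (rule bounded_form_mono[OF bounded_form_cmult])
    show "bounded_form d n ?h r\<^sub>2 (\<lambda>c. \<beta>\<^sub>2 t c - translate d n (\<beta>\<^sub>2 s) ?b c)"
      using diff_in_forms[OF forms(4) trans(2)] bounded_alongD(3)[OF \<beta>\<^sub>2 st] by (intro bounded_formI) auto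
    have "\<bar>?I s + \<beta>\<^sub>1 s ?b\<bar> \<le> ?C2 * r\<^sub>1"
      using integral_bounds(2)[OF \<beta>\<^sub>1, of s] bounded_along_apply[OF \<beta>\<^sub>1 st'(1-3)] st'
      by (simp add: ring_distribs)
    from mult_right_mono[OF this nonneg(2)] show "\<bar>?I s + \<beta>\<^sub>1 s ?b\<bar> * r\<^sub>2 \<le> ?C2 * (r\<^sub>1 * r\<^sub>2)"
      by (simp only: mult.assoc)
  qed simp
  have 3: "bounded_form d n ?h (\<Sum>x\<in>F. \<Sum>\<tau>\<in>Tr. M * (2 + M) * (r\<^sub>1 * r\<^sub>2))
      (\<lambda>c. \<Sum>x\<in>F. \<Sum>\<tau>\<in>Tr. (?f1 x * ?f2 {#\<tau>#} - ?g1 x * ?g2 {#\<tau>#}) * c {#graft x \<tau>#})"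
  proof (intro bounded_form_sum bounded_form_tree)
    fix x \<tau> assume x: "x \<in> F" and \<tau>: "\<tau> \<in> Tr"
    then show "graft x \<tau> \<in> trees d" by (simp add: forests_upto_def trees_upto_def)
    assume deg: "tdeg (graft x \<tau>) \<le> n"
    have \<tau>': "{#\<tau>#} \<in> F" using \<tau> by simp
    let ?H = "?h {#graft x \<tau>#}"
    have h: "?h x \<le> M * ?H" "?h {#\<tau>#} \<le> M * ?H" by (rule weight_antimono[OF st'(1-3)]; use deg in simp)+
    \<comment> \<open>The translate is bounded by comparison with \<open>\<beta>\<^sub>1 t\<close>:
      by slow variation the coefficients differ by at most \<open>r\<^sub>1\<close> times a weight,
      and weights are at most \<open>M\<close>.\<close>
    have g1: "\<bar>?g1 x\<bar> \<le> r\<^sub>1 * (1 + M)"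
    proof -
      have "r\<^sub>1 * ?h x \<le> r\<^sub>1 * M" using weight_le_M[OF st'(1-3) x] nonneg by (intro mult_left_mono)
      moreover have "\<bar>?g1 x\<bar> \<le> \<bar>?f1 x - ?g1 x\<bar> + \<bar>?f1 x\<bar>" by linarith
      ultimately have "\<bar>?g1 x\<bar> \<le> r\<^sub>1 + r\<^sub>1 * M"
        using diff1[OF x] bounded_alongD(2)[OF \<beta>\<^sub>1 st'(5,3) x] by linarith
      then show ?thesis by (simp add: ring_distribs)
    qed
    \<comment> \<open>The discrete product rule. Its first term contributes 1 and its second
      \<open>1 + M\<close>, from the bound on \<open>?g1\<close>, to the factor
      \<open>2 + M\<close>.\<close>
    have eq: "?f1 x * ?f2 {#\<tau>#} - ?g1 x * ?g2 {#\<tau>#} =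
        (?f1 x - ?g1 x) * ?f2 {#\<tau>#} + ?g1 x * (?f2 {#\<tau>#} - ?g2 {#\<tau>#})"
      by (simp add: algebra_simps)
    have "\<bar>?f1 x * ?f2 {#\<tau>#} - ?g1 x * ?g2 {#\<tau>#}\<bar> \<le>
        \<bar>?f1 x - ?g1 x\<bar> * \<bar>?f2 {#\<tau>#}\<bar> + \<bar>?g1 x\<bar> * \<bar>?f2 {#\<tau>#} - ?g2 {#\<tau>#}\<bar>"
      unfolding eq abs_mult[symmetric] by (rule abs_triangle_ineq)
    also have "\<dots> \<le> (r\<^sub>1 * (M * ?H)) * r\<^sub>2 + (r\<^sub>1 * (1 + M)) * (r\<^sub>2 * (M * ?H))"
    proof (intro add_mono mult_mono)
      show "\<bar>?f1 x - ?g1 x\<bar> \<le> r\<^sub>1 * (M * ?H)"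
        using diff1[OF x] mult_left_mono[OF h(1) nonneg(1)] by linarith
      show "\<bar>?f2 {#\<tau>#} - ?g2 {#\<tau>#}\<bar> \<le> r\<^sub>2 * (M * ?H)"
        using diff2[OF \<tau>'] mult_left_mono[OF h(2) nonneg(2)] by linarith
    qed (use bounded_alongD(2)[OF \<beta>\<^sub>2 st'(5,3) \<tau>'] g1 nonneg M_ge_1 in auto)
    also have "\<dots> = M * (2 + M) * (r\<^sub>1 * r\<^sub>2) * ?H" by (simp add: algebra_simps)
    finally show "\<bar>?f1 x * ?f2 {#\<tau>#} - ?g1 x * ?g2 {#\<tau>#}\<bar> \<le> M * (2 + M) * (r\<^sub>1 * r\<^sub>2) * ?H" .
  qed (use nonneg M_ge_1 in auto)
  let ?S = "\<lambda>\<rho> \<tau>. coproduct_size \<rho> * (\<Sum>\<tau>'\<in>Tr. coproduct_size {#\<tau>#} * M)"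
  let ?R = "\<lambda>\<rho> \<tau> c. sweedler (\<lambda>u v. ?b u * graft_translation d n ?b \<tau> v c) \<rho>"
  let ?e1 = "coeffs d n (\<beta>\<^sub>1 s)" and ?e2 = "coeffs d n (\<beta>\<^sub>2 s)"
  have S_nonneg: "0 \<le> ?S \<rho> \<tau>" for \<rho> \<tau>
    using coproduct_size_nonneg M_ge_1 by (simp add: sum_nonneg)
  have 4: "bounded_form d n ?h (\<Sum>\<rho>\<in>F. \<Sum>\<tau>\<in>Tr. ?S \<rho> \<tau> * (r\<^sub>1 * r\<^sub>2))
      (\<lambda>c. \<Sum>\<rho>\<in>F. \<Sum>\<tau>\<in>Tr. if n < fdeg \<rho> + tdeg \<tau> then ?e1 \<rho> * ?e2 {#\<tau>#} * ?R \<rho> \<tau> c else 0)"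
  proof (intro bounded_form_sum finite_forests_upto finite_trees_upto)
    fix \<rho> \<tau> assume \<rho>: "\<rho> \<in> F" and \<tau>: "\<tau> \<in> Tr"
    show "bounded_form d n ?h (?S \<rho> \<tau> * (r\<^sub>1 * r\<^sub>2))
        (\<lambda>c. if n < fdeg \<rho> + tdeg \<tau> then ?e1 \<rho> * ?e2 {#\<tau>#} * ?R \<rho> \<tau> c else 0)"
    proof (cases "n < fdeg \<rho> + tdeg \<tau>")
      case True
      have "{#\<tau>#} \<in> F" using \<tau> by simp
      then have "\<bar>?e1 \<rho> * ?e2 {#\<tau>#}\<bar> \<le> r\<^sub>1 * r\<^sub>2"
        using bounded_alongD(2)[OF \<beta>\<^sub>1 st'(1,4) \<rho>] bounded_alongD(2)[OF \<beta>\<^sub>2 st'(1,4)] nonneg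
        by (simp add: abs_mult mult_mono)
      then have "\<bar>?e1 \<rho> * ?e2 {#\<tau>#}\<bar> * ?S \<rho> \<tau> \<le> (r\<^sub>1 * r\<^sub>2) * ?S \<rho> \<tau>"
        using S_nonneg by (rule mult_right_mono)
      then have "bounded_form d n ?h ((r\<^sub>1 * r\<^sub>2) * ?S \<rho> \<tau>) (\<lambda>c. ?e1 \<rho> * ?e2 {#\<tau>#} * ?R \<rho> \<tau> c)"
        by (rule bounded_form_mono[OF bounded_form_cmult[OF graft_translation_bound[OF st'(1-3) \<rho> \<tau> True]]]) simp
      then show ?thesis using True by (simp add: mult.commute)
    next
      case False
      have "0 \<le> ?S \<rho> \<tau> * (r\<^sub>1 * r\<^sub>2)" using S_nonneg nonneg by simp
      then have "bounded_form d n ?h (?S \<rho> \<tau> * (r\<^sub>1 * r\<^sub>2)) (\<lambda>c. 0)"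
        by (rule bounded_form_mono[OF bounded_form_zero]) simp
      then show ?thesis using False by simp
    qed
  qed
  have "bounded_form d n ?h (?C1 * (r\<^sub>1 * r\<^sub>2) + ?C2 * (r\<^sub>1 * r\<^sub>2) +
      (\<Sum>x\<in>F. \<Sum>\<tau>\<in>Tr. M * (2 + M) * (r\<^sub>1 * r\<^sub>2)) + (\<Sum>\<rho>\<in>F. \<Sum>\<tau>\<in>Tr. ?S \<rho> \<tau> * (r\<^sub>1 * r\<^sub>2)))
    (\<lambda>c. product_form p d X \<beta>\<^sub>1 \<beta>\<^sub>2 t c - translate d n (product_form p d X \<beta>\<^sub>1 \<beta>\<^sub>2 s) ?b c)"
  proof (rule bounded_form_cong[OF bounded_form_add[OF bounded_form_add[OF bounded_form_add[OF 1 2] 3] 4]])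
    \<comment> \<open>The translate of \<open>\<beta>\<^sub>2 s\<close> occurs with total factor
      \<open>?I s + \<beta>\<^sub>1 s ?b\<close>; adding and subtracting this factor times
      \<open>\<beta>\<^sub>2 t c\<close> produces the first two terms. The truncation terms,
      subtracted in the translate, enter the increment with a plus sign.\<close>
    fix c assume c: "c \<in> carrier G"
    have "translate d n (product_form p d X \<beta>\<^sub>1 \<beta>\<^sub>2 s) ?b c =
        ?I s * translate d n (\<beta>\<^sub>2 s) ?b c + translate d n (form_succ d n (\<beta>\<^sub>1 s) (\<beta>\<^sub>2 s)) ?b c"
      by (simp add: translate_def product_form_eq algebra_simps)
    also note translate_form_succ[OF forms(1,2) only[OF st'(1,4)] b c]
    finally show "product_form p d X \<beta>\<^sub>1 \<beta>\<^sub>2 t c - translate d n (product_form p d X \<beta>\<^sub>1 \<beta>\<^sub>2 s) ?b c =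
        (?I t - ?I s - \<beta>\<^sub>1 s ?b) * \<beta>\<^sub>2 t c
        + (?I s + \<beta>\<^sub>1 s ?b) * (\<beta>\<^sub>2 t c - translate d n (\<beta>\<^sub>2 s) ?b c)
        + (\<Sum>x\<in>F. \<Sum>\<tau>\<in>Tr. (?f1 x * ?f2 {#\<tau>#} - ?g1 x * ?g2 {#\<tau>#}) * c {#graft x \<tau>#})
        + (\<Sum>\<rho>\<in>F. \<Sum>\<tau>\<in>Tr. if n < fdeg \<rho> + tdeg \<tau> then ?e1 \<rho> * ?e2 {#\<tau>#} * ?R \<rho> \<tau> c else 0)"
      unfolding product_form_eq[of t] form_succ_apply[OF c] left_diff_distrib sum_subtractf
      by (simp add: ring_distribs)
  qed
  moreover have "?C1 * (r\<^sub>1 * r\<^sub>2) + ?C2 * (r\<^sub>1 * r\<^sub>2) +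
      (\<Sum>x\<in>F. \<Sum>\<tau>\<in>Tr. M * (2 + M) * (r\<^sub>1 * r\<^sub>2)) + (\<Sum>\<rho>\<in>F. \<Sum>\<tau>\<in>Tr. ?S \<rho> \<tau> * (r\<^sub>1 * r\<^sub>2)) =
      variation_const d n \<theta> (\<omega> 0 T) * (r\<^sub>1 * r\<^sub>2)"
    unfolding variation_const_def sum_distrib_right[symmetric] by (simp only: ring_distribs)
  ultimately show ?thesis by simp
qed

end

section \<open>Between the extended-real norm and bounds in real numbers\<close>

lemma bounded_alongI_norm:
  assumes forms: "\<beta> \<in> {0..T} \<rightarrow> forms d n" and norm: "one_form_norm p d T X \<theta> \<beta> = ennreal r" and "0 \<le> r"
  shows "bounded_along r \<beta>"
proof -
  let ?sup = "SUP t\<in>{0..T}. ennreal (form_norm d n (\<beta> t))"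
  let ?q = "\<lambda>\<gamma> (s, t). ennreal \<bar>coeffs d n (\<lambda>c. \<beta> t c - translate d n (\<beta> s) (inc s t) c) \<gamma>\<bar> / ennreal (weight s t \<gamma>)"
  let ?var = "MAX \<gamma>\<in>F. SUP z\<in>{(s, t). 0 \<le> s \<and> s < t \<and> t \<le> T}. ?q \<gamma> z"
  have eq: "?sup + ?var = ennreal r"
    using norm by (simp add: one_form_norm_def weight_def n_def case_prod_beta)
  have sup: "?sup \<le> ennreal r" and var: "?var \<le> ennreal r"
    unfolding eq[symmetric] by simp_all
  have "\<bar>coeffs d n (\<beta> t) \<gamma>\<bar> \<le> r" if "0 \<le> t" "t \<le> T" "\<gamma> \<in> F" for t \<gamma>
  proof -
    have "ennreal (form_norm d n (\<beta> t)) \<le> ?sup" using that by (intro SUP_upper) simp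
    then have "form_norm d n (\<beta> t) \<le> r" using sup \<open>0 \<le> r\<close> order_trans by (metis ennreal_le_iff)
    moreover have "\<bar>coeffs d n (\<beta> t) \<gamma>\<bar> \<le> form_norm d n (\<beta> t)"
      unfolding form_norm_def using that by (intro Max_ge) auto
    ultimately show ?thesis by simp
  qed
  moreover have "\<bar>coeffs d n (\<lambda>c. \<beta> t c - translate d n (\<beta> s) (inc s t) c) \<gamma>\<bar> \<le> r * weight s t \<gamma>"
    (is "\<bar>?x\<bar> \<le> _") if "0 \<le> s" "s < t" "t \<le> T" "\<gamma> \<in> F" for s t \<gamma>
  proof -
    have "?q \<gamma> (s, t) \<le> (SUP z\<in>{(s, t). 0 \<le> s \<and> s < t \<and> t \<le> T}. ?q \<gamma> z)"
      using that by (intro SUP_upper) simp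
    also have "\<dots> \<le> ?var" using that(4) by (intro Max_ge) auto
    also note var
    finally have le: "ennreal \<bar>?x\<bar> / ennreal (weight s t \<gamma>) \<le> ennreal r" by simp
    show ?thesis
    proof (cases "weight s t \<gamma> = 0")
      case True
      \<comment> \<open>Division by a vanishing weight gives \<infinity> unless the numerator is
        zero, so a finite norm forces the coefficient to vanish.\<close>
      have "?x = 0"
      proof (rule ccontr)
        assume "?x \<noteq> 0"
        then have "ennreal \<bar>?x\<bar> / ennreal (weight s t \<gamma>) = \<infinity>"
          using True by simp
        with le show False by (simp add: infinity_ennreal_def top_unique)
      qed
      then show ?thesis using \<open>0 \<le> r\<close> by simp
    next
      case False
      then have "0 < weight s t \<gamma>" by (simp add: less_le)
      then show ?thesis using le \<open>0 \<le> r\<close> by (simp add: divide_ennreal divide_le_eq)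
    qed
  qed
  ultimately show ?thesis using forms by (auto simp: bounded_along_def)
qed

lemma one_form_norm_le:
  assumes sup: "\<And>t. \<lbrakk>0 \<le> t; t \<le> T\<rbrakk> \<Longrightarrow> bounded_form d n (\<lambda>_. 1) r (\<beta> t)"
    and var: "\<And>s t. \<lbrakk>0 \<le> s; s < t; t \<le> T\<rbrakk> \<Longrightarrow>
      bounded_form d n (weight s t) r' (\<lambda>c. \<beta> t c - translate d n (\<beta> s) (inc s t) c)"
    and "0 \<le> r" "0 \<le> r'"
  shows "one_form_norm p d T X \<theta> \<beta> \<le> ennreal (r + r')"
proof -
  have "(SUP t\<in>{0..T}. ennreal (form_norm d n (\<beta> t))) \<le> ennreal r"
  proof (intro SUP_least ennreal_leI)
    fix t assume "t \<in> {0..T}"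
    then show "form_norm d n (\<beta> t) \<le> r"
      unfolding form_norm_def using F_finite_nonempty bounded_form_coeffs[OF sup[of t]]
      by (intro Max.boundedI) auto
  qed
  moreover have "(MAX \<gamma>\<in>F. SUP (s, t)\<in>{(s, t). 0 \<le> s \<and> s < t \<and> t \<le> T}.
      ennreal \<bar>coeffs d n (\<lambda>c. \<beta> t c - translate d n (\<beta> s) (inc s t) c) \<gamma>\<bar> / ennreal (weight s t \<gamma>)) \<le> ennreal r'"
  proof (rule Max.boundedI)
    fix y assume "y \<in> (\<lambda>\<gamma>. SUP (s, t)\<in>{(s, t). 0 \<le> s \<and> s < t \<and> t \<le> T}.
      ennreal \<bar>coeffs d n (\<lambda>c. \<beta> t c - translate d n (\<beta> s) (inc s t) c) \<gamma>\<bar> / ennreal (weight s t \<gamma>)) ` F"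
    then obtain \<gamma> where \<gamma>: "\<gamma> \<in> F" and y: "y = (SUP (s, t)\<in>{(s, t). 0 \<le> s \<and> s < t \<and> t \<le> T}.
      ennreal \<bar>coeffs d n (\<lambda>c. \<beta> t c - translate d n (\<beta> s) (inc s t) c) \<gamma>\<bar> / ennreal (weight s t \<gamma>))"
      by blast
    have "ennreal \<bar>coeffs d n (\<lambda>c. \<beta> t c - translate d n (\<beta> s) (inc s t) c) \<gamma>\<bar> / ennreal (weight s t \<gamma>) \<le> ennreal r'"
      (is "ennreal \<bar>?x\<bar> / _ \<le> _") if "0 \<le> s" "s < t" "t \<le> T" for s t
    proof -
      have le: "\<bar>?x\<bar> \<le> r' * weight s t \<gamma>" using bounded_form_coeffs[OF var[OF that] \<gamma>] .
      show ?thesis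
      proof (cases "weight s t \<gamma> = 0")
        case False
        then have "0 < weight s t \<gamma>" by (simp add: less_le)
        then show ?thesis using le by (simp add: divide_ennreal divide_le_eq ennreal_leI)
      \<comment> \<open>A zero weight forces a zero numerator, and \<open>0 / 0 = 0\<close> in
        \<open>ennreal\<close>.\<close>
      qed (use le in simp)
    qed
    then show "y \<le> ennreal r'" unfolding y by (intro SUP_least) auto
  qed (use F_finite_nonempty in auto)
  ultimately show ?thesis
    unfolding ennreal_plus[OF assms(3,4)] one_form_norm_def weight_def[symmetric] n_def[symmetric]
    by (rule add_mono)
qed

end

text \<open>The order of quantifiers expresses the dependence of the constant: \<open>C\<close> is
  chosen after \<open>p\<close>, \<open>d\<close>, \<open>\<theta>\<close> and the value
  \<open>w\<close> of \<omega>(0,T), and before the time horizon, the path and the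
  one-forms.\<close>

theorem lemma23:
  fixes p \<theta> w :: real and d :: nat
  assumes "p \<ge> 1" and "d \<ge> 1" and "1 < \<theta>" and "\<theta> \<le> (real (step p) + 1) / p"
  shows "\<exists>C::real. \<forall>(T::real) (X :: real \<Rightarrow> forest \<Rightarrow> real) (\<beta>\<^sub>1 :: real \<Rightarrow> form) (\<beta>\<^sub>2 :: real \<Rightarrow> form).
    T > 0 \<longrightarrow>
    branched_rough_path p d T X \<longrightarrow>
    control p d X 0 T = w \<longrightarrow>
    slowly_varying p d T X \<beta>\<^sub>1 \<longrightarrow>
    slowly_varying p d T X \<beta>\<^sub>2 \<longrightarrow>
    one_form_norm p d T X \<theta> \<beta>\<^sub>1 < \<infinity> \<longrightarrow>
    one_form_norm p d T X \<theta> \<beta>\<^sub>2 < \<infinity> \<longrightarrow>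
    (\<forall>t\<in>{0..T}. only_trees d (step p) (\<beta>\<^sub>2 t)) \<longrightarrow>
    slowly_varying p d T X (product_form p d X \<beta>\<^sub>1 \<beta>\<^sub>2) \<and>
    one_form_norm p d T X \<theta> (product_form p d X \<beta>\<^sub>1 \<beta>\<^sub>2)
      \<le> ennreal C * one_form_norm p d T X \<theta> \<beta>\<^sub>1 * one_form_norm p d T X \<theta> \<beta>\<^sub>2"
proof (intro exI allI impI)
  fix T :: real and X :: "real \<Rightarrow> forest \<Rightarrow> real" and \<beta>\<^sub>1 \<beta>\<^sub>2 :: "real \<Rightarrow> form"
  assume T: "T > 0" and X: "branched_rough_path p d T X" and w: "control p d X 0 T = w"
    and sv: "slowly_varying p d T X \<beta>\<^sub>1" "slowly_varying p d T X \<beta>\<^sub>2"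
    and fin: "one_form_norm p d T X \<theta> \<beta>\<^sub>1 < \<infinity>" "one_form_norm p d T X \<theta> \<beta>\<^sub>2 < \<infinity>"
    and only: "\<forall>t\<in>{0..T}. only_trees d (step p) (\<beta>\<^sub>2 t)"
  interpret rough_integration p T d X \<theta>
    using assms T X by unfold_locales auto
  let ?P = "product_form p d X \<beta>\<^sub>1 \<beta>\<^sub>2" and ?n = "step p"
  obtain r\<^sub>1 where r\<^sub>1: "one_form_norm p d T X \<theta> \<beta>\<^sub>1 = ennreal r\<^sub>1" "0 \<le> r\<^sub>1"
    using fin(1) by (metis ennreal_cases infinity_ennreal_def less_irrefl)
  obtain r\<^sub>2 where r\<^sub>2: "one_form_norm p d T X \<theta> \<beta>\<^sub>2 = ennreal r\<^sub>2" "0 \<le> r\<^sub>2"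
    using fin(2) by (metis ennreal_cases infinity_ennreal_def less_irrefl)
  have \<beta>\<^sub>1: "bounded_along r\<^sub>1 \<beta>\<^sub>1" and \<beta>\<^sub>2: "bounded_along r\<^sub>2 \<beta>\<^sub>2"
    using sv r\<^sub>1 r\<^sub>2 by (auto simp: slowly_varying_def n_def intro!: bounded_alongI_norm)
  have only': "only_trees d n (\<beta>\<^sub>2 t)" if "0 \<le> t" "t \<le> T" for t
    using only that by (simp add: n_def)
  have K: "0 \<le> sewing_const \<theta>"
    using \<theta>_gt_1 powr_less_one[of 2 "1 - \<theta>"] by (simp add: sewing_const_def)
  have I: "0 \<le> integral_const d n \<theta> w" "0 \<le> power_const \<theta> w"
    using K by (simp_all add: integral_const_def power_const_def)
  have nonneg: "0 \<le> sup_const d n \<theta> w" "0 \<le> variation_const d n \<theta> w"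
    unfolding sup_const_def variation_const_def using K I coproduct_size_nonneg
    by (auto intro!: add_nonneg_nonneg mult_nonneg_nonneg sum_nonneg)
  have sup: "bounded_form d n (\<lambda>_. 1) (sup_const d n \<theta> w * (r\<^sub>1 * r\<^sub>2)) (?P t)" if "0 \<le> t" "t \<le> T" for t
    using product_form_sup_bound[OF \<beta>\<^sub>1 \<beta>\<^sub>2 only' that] by (simp add: w)
  have "one_form_norm p d T X \<theta> ?P \<le> ennreal (sup_const d n \<theta> w * (r\<^sub>1 * r\<^sub>2) + variation_const d n \<theta> w * (r\<^sub>1 * r\<^sub>2))"
    using product_form_increment_bound[OF \<beta>\<^sub>1 \<beta>\<^sub>2 only'] nonneg r\<^sub>1(2) r\<^sub>2(2)
    by (intro one_form_norm_le sup) (auto simp: w)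
  also have "\<dots> = ennreal (sup_const d ?n \<theta> w + variation_const d ?n \<theta> w) *
      one_form_norm p d T X \<theta> \<beta>\<^sub>1 * one_form_norm p d T X \<theta> \<beta>\<^sub>2"
    using nonneg r\<^sub>1(2) r\<^sub>2(2)
    by (simp add: r\<^sub>1(1) r\<^sub>2(1) n_def[symmetric] ennreal_mult[symmetric] algebra_simps)
  finally have norm: "one_form_norm p d T X \<theta> ?P \<le> ennreal (sup_const d ?n \<theta> w + variation_const d ?n \<theta> w) *
      one_form_norm p d T X \<theta> \<beta>\<^sub>1 * one_form_norm p d T X \<theta> \<beta>\<^sub>2" .
  moreover have "\<dots> < \<infinity>" by (simp add: r\<^sub>1(1) r\<^sub>2(1) ennreal_mult_less_top)
  ultimately have "one_form_norm p d T X \<theta> ?P < \<infinity>" by (rule le_less_trans)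
  moreover have "?P \<in> {0..T} \<rightarrow> forms d ?n"
    using bounded_form_forms[OF sup] by (auto simp: n_def)
  ultimately have "slowly_varying p d T X ?P" using assms(3) by (auto simp: slowly_varying_def)
  with norm show "slowly_varying p d T X ?P \<and> one_form_norm p d T X \<theta> ?P \<le>
      ennreal (sup_const d ?n \<theta> w + variation_const d ?n \<theta> w) *
        one_form_norm p d T X \<theta> \<beta>\<^sub>1 * one_form_norm p d T X \<theta> \<beta>\<^sub>2" by blast
qed

end
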